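(* Let $\mathcal{J}$ be a Euclidean Jordan algebra of rank $r$ and dimension $k$ with cone of squares $\mathcal{K}$. Let $A=\{a_1,\dots,a_m\}\in\mathcal{J}^m$ be such that all eigenvalues of each $a_i$ lie in $[-1,1]$, and let $b\in\mathbb{R}^m$ be such that there exists $x\in\mathcal{K}$ with $\mathrm{Tr}(x)=1$ and $\langle a_i,x\rangle\le b_i$ for all $i\in[m]$. Fix $\beta,\epsilon>0$ and $\delta\in(0,1)$. Then, with probability at least $1-\beta$, the noisy multiplicative weights algorithm described in the context, run with the exponential mechanism as dual oracle, returns $x^*\in\mathcal{K}$ with $\mathrm{Tr}(x^* )=1$ such that $$\langle a_i,x^*\rangle\le b_i+\alpha\qquad\forall i\in[m],$$ where $$\alpha=\widetilde O\!\left(\frac{\Delta_\infty^{1/2}r^{1/4}k^{1/4}}{\epsilon^{1/2}}\cdot\mathrm{poly}\log(r,1/\beta,1/\delta)\right).$$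
   Context: A Euclidean Jordan algebra (EJA) is a finite-dimensional real vector space $\mathcal{J}$ with a commutative bilinear product $\circ$ satisfying $x^2\circ(x\circ y)=x\circ(x^2\circ y)$ (where $x^2=x\circ x$), an identity element $e$, and an inner product with $\langle x\circ y,z\rangle=\langle x,y\circ z\rangle$. A Jordan frame is a set $\{q_1,\dots,q_r\}$ of primitive idempotents with $q_i\circ q_j=0$ for $i\ne j$ and $\sum_i q_i=e$. Every $x\in\mathcal{J}$ has a spectral decomposition $x=\sum_{i=1}^r\lambda_i(x)q_i$ for some Jordan frame; $r$ is the rank of $\mathcal{J}$ and the $\lambda_i(x)$ are the eigenvalues. $\mathrm{Tr}(x)=\sum_i\lambda_i(x)$, $\exp(x)=\sum_ie^{\lambda_i(x)}q_i$, $\langle x,y\rangle=\mathrm{Tr}(x\circ y)$, $\|x\|_\infty=\max_i|\lambda_i(x)|$. The cone of squares is $\mathcal{K}=\{x\circ x:x\in\mathcal{J}\}$. $\widetilde O(f)$ means $O(f\,\mathrm{poly}\log f)$. $\Delta_\infty>0$ is the sensitivity parameter: neighboring constraint sets $A,A'$ satisfy $\max_i\|a_i-a'_i\|_\infty\le\Delta_\infty$. Algorithm (accuracy parameter $\alpha$): let $\phi:\mathcal{J}\to\mathbb{R}^k$ be a linear isomorphism with $\langle\phi(x),\phi(y)\rangle=\langle x,y\rangle$. Put $$T=\frac{144\log r}{\alpha^2},\quad\epsilon'=\frac{\epsilon}{4\sqrt{T\log(1/\delta)}},\quad\eta=\frac{\alpha}{12},\quad\sigma=\frac{\Delta_\infty\sqrt{2r\log(T/\delta)}}{\epsilon'},\quad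 x^1=e/r.$$ For $t=1,\dots,T$: sample $p^t\in[m]$ by the $\epsilon'$-private exponential mechanism with quality score $Q(i,A)=\langle a_i,x^t\rangle-b_i$, i.e. with probability proportional to $\exp(\frac{\epsilon'}{2\Delta_\infty}Q(i,A))$; sample $\nu^t\sim\mathcal{N}(0,\sigma^2I_k)$ and set $z^t=\phi^{-1}(\nu^t)$, $\widehat\ell^t=\frac{a_{p^t}+z^t}{2}$, and $x^{t+1}=\exp(-\eta\sum_{i=1}^t\widehat\ell^i)/\mathrm{Tr}(\exp(-\eta\sum_{i=1}^t\widehat\ell^i))$. Return $x^*=\frac1T\sum_{t=1}^Tx^t$.
   Formalization: The bound on α carries an extra factor polylog(m), since without it the claim fails as m grows; T is rounded up to an integer at least 1 (log r = 0 when r = 1), m ≥ 1, and algebras are finite-dimensional subspaces of an ambient real vector space. *)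

theory Defs
  imports "HOL-Probability.Probability"
begin

text \<open>
  A hidden constant in an asymptotic bound has to be chosen before the algebra, hence before its
  rank and dimension, and HOL cannot quantify over types inside a formula. An algebra is therefore
  a finite-dimensional subspace \<open>carr\<close> of an ambient real vector space \<open>'a\<close>, with
  operations that are only constrained on \<open>carr\<close>. If \<open>'a\<close> is infinite-dimensional
  (for instance \<open>(real, real) bcontfun\<close>), then every Euclidean Jordan algebra, of every
  dimension, is isomorphic to one with carrier in \<open>'a\<close>.
\<close>

record 'a jalg =
  carr :: "'a set"
  jmult :: "'a \<Rightarrow> 'a \<Rightarrow> 'a" (infixl "\<circ>\<index>" 70)
  junit :: 'a

definition inner_product_on :: "'a::real_vector set \<Rightarrow> ('a \<Rightarrow> 'a \<Rightarrow> real) \<Rightarrow> bool" where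
  "inner_product_on V ip \<longleftrightarrow>
     (\<forall>x\<in>V. \<forall>y\<in>V. ip x y = ip y x) \<and>
     (\<forall>x\<in>V. \<forall>y\<in>V. \<forall>z\<in>V. ip (x + y) z = ip x z + ip y z) \<and>
     (\<forall>c. \<forall>x\<in>V. \<forall>y\<in>V. ip (c *\<^sub>R x) y = c * ip x y) \<and>
     (\<forall>x\<in>V. x \<noteq> 0 \<longrightarrow> ip x x > 0)"

locale euclidean_jordan_algebra =
  fixes J :: "'a::real_vector jalg" (structure)
  assumes subspace_carr: "subspace (carr J)"
    and finite_dim: "\<exists>B. finite B \<and> span B = carr J"
    and mult_closed: "\<lbrakk>x \<in> carr J; y \<in> carr J\<rbrakk> \<Longrightarrow> x \<circ> y \<in> carr J"
    and mult_commute: "\<lbrakk>x \<in> carr J; y \<in> carr J\<rbrakk> \<Longrightarrow> x \<circ> y = y \<circ> x"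
    and mult_add_left:
      "\<lbrakk>x \<in> carr J; y \<in> carr J; z \<in> carr J\<rbrakk> \<Longrightarrow> (x + y) \<circ> z = x \<circ> z + y \<circ> z"
    and mult_scale_left: "\<lbrakk>x \<in> carr J; y \<in> carr J\<rbrakk> \<Longrightarrow> (c *\<^sub>R x) \<circ> y = c *\<^sub>R (x \<circ> y)"
    and jordan_identity:
      "\<lbrakk>x \<in> carr J; y \<in> carr J\<rbrakk> \<Longrightarrow> (x \<circ> x) \<circ> (x \<circ> y) = x \<circ> ((x \<circ> x) \<circ> y)"
    and unit_closed: "junit J \<in> carr J"
    and unit_left: "x \<in> carr J \<Longrightarrow> junit J \<circ> x = x"
    and associative_inner_product:
      "\<exists>ip. inner_product_on (carr J) ip \<and>
         (\<forall>x\<in>carr J. \<forall>y\<in>carr J. \<forall>z\<in>carr J. ip (x \<circ> y) z = ip x (y \<circ> z))"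

definition idempotent :: "('a::real_vector, 'e) jalg_scheme \<Rightarrow> 'a \<Rightarrow> bool" where
  "idempotent J c \<longleftrightarrow> c \<in> carr J \<and> c \<circ>\<^bsub>J\<^esub> c = c"

text \<open>
  Orthogonality of the two summands need not be demanded: if \<open>c\<close>, \<open>a\<close>, \<open>b\<close> and
  \<open>c = a + b\<close> are idempotents, expanding the square of \<open>c\<close> shows that \<open>a\<close> and
  \<open>b\<close> have product 0.
\<close>

definition primitive_idempotent :: "('a::real_vector, 'e) jalg_scheme \<Rightarrow> 'a \<Rightarrow> bool" where
  "primitive_idempotent J c \<longleftrightarrow> idempotent J c \<and> c \<noteq> 0 \<and>
     \<not> (\<exists>a b. idempotent J a \<and> idempotent J b \<and> a \<noteq> 0 \<and> b \<noteq> 0 \<and> c = a + b)"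

definition jordan_frame :: "('a::real_vector, 'e) jalg_scheme \<Rightarrow> 'a set \<Rightarrow> bool" where
  "jordan_frame J Q \<longleftrightarrow> finite Q \<and> (\<forall>q\<in>Q. primitive_idempotent J q) \<and>
     (\<forall>p\<in>Q. \<forall>q\<in>Q. p \<noteq> q \<longrightarrow> p \<circ>\<^bsub>J\<^esub> q = 0) \<and> \<Sum>Q = junit J"

definition spectral_decomp ::
    "('a::real_vector, 'e) jalg_scheme \<Rightarrow> 'a \<Rightarrow> 'a set \<Rightarrow> ('a \<Rightarrow> real) \<Rightarrow> bool" where
  "spectral_decomp J x Q \<mu> \<longleftrightarrow> jordan_frame J Q \<and> x = (\<Sum>q\<in>Q. \<mu> q *\<^sub>R q)"

text \<open>
  Rank, trace and exponential are read off from an arbitrary Jordan frame. In a Euclidean Jordan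
  algebra a decomposition exists and the result does not depend on it, so the descriptions denote.
\<close>

definition jrank :: "('a::real_vector, 'e) jalg_scheme \<Rightarrow> nat" where
  "jrank J = (THE r. \<exists>Q. jordan_frame J Q \<and> card Q = r)"

definition jdim :: "('a::real_vector, 'e) jalg_scheme \<Rightarrow> nat" where
  "jdim J = dim (carr J)"

definition eigenvalues :: "('a::real_vector, 'e) jalg_scheme \<Rightarrow> 'a \<Rightarrow> real set" where
  "eigenvalues J x = {l. \<exists>Q \<mu>. spectral_decomp J x Q \<mu> \<and> l \<in> \<mu> ` Q}"

definition Tr :: "('a::real_vector, 'e) jalg_scheme \<Rightarrow> 'a \<Rightarrow> real" where
  "Tr J x = (THE t. \<exists>Q \<mu>. spectral_decomp J x Q \<mu> \<and> t = (\<Sum>q\<in>Q. \<mu> q))"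

definition jexp :: "('a::real_vector, 'e) jalg_scheme \<Rightarrow> 'a \<Rightarrow> 'a" where
  "jexp J x = (THE y. \<exists>Q \<mu>. spectral_decomp J x Q \<mu> \<and> y = (\<Sum>q\<in>Q. exp (\<mu> q) *\<^sub>R q))"

definition trace_inner :: "('a::real_vector, 'e) jalg_scheme \<Rightarrow> 'a \<Rightarrow> 'a \<Rightarrow> real" where
  "trace_inner J x y = Tr J (x \<circ>\<^bsub>J\<^esub> y)"

definition cone_of_squares :: "('a::real_vector, 'e) jalg_scheme \<Rightarrow> 'a set" where
  "cone_of_squares J = {x \<circ>\<^bsub>J\<^esub> x | x. x \<in> carr J}"

text \<open>
  Vectors of \<open>\<real>\<^sup>k\<close> are the extensional functions on \<open>{..<k}\<close>, the points of
  the product measure space over \<open>{..<k}\<close>.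
\<close>

definition coordinate_isometry ::
    "('a::real_vector, 'e) jalg_scheme \<Rightarrow> ('a \<Rightarrow> nat \<Rightarrow> real) \<Rightarrow> bool" where
  "coordinate_isometry J \<phi> \<longleftrightarrow>
     bij_betw \<phi> (carr J) ({..<jdim J} \<rightarrow>\<^sub>E UNIV) \<and>
     (\<forall>x\<in>carr J. \<forall>y\<in>carr J. \<forall>i<jdim J. \<phi> (x + y) i = \<phi> x i + \<phi> y i) \<and>
     (\<forall>c. \<forall>x\<in>carr J. \<forall>i<jdim J. \<phi> (c *\<^sub>R x) i = c * \<phi> x i) \<and>
     (\<forall>x\<in>carr J. \<forall>y\<in>carr J. (\<Sum>i<jdim J. \<phi> x i * \<phi> y i) = trace_inner J x y)"

text \<open>The Borel sigma-algebra of the algebra, transported from \<open>\<real>\<^sup>k\<close>.\<close>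

definition borel_alg ::
    "('a::real_vector, 'e) jalg_scheme \<Rightarrow> ('a \<Rightarrow> nat \<Rightarrow> real) \<Rightarrow> 'a measure" where
  "borel_alg J \<phi> = vimage_algebra (carr J) \<phi> (PiM {..<jdim J} (\<lambda>_. borel))"

definition gaussian_noise ::
    "('a::real_vector, 'e) jalg_scheme \<Rightarrow> ('a \<Rightarrow> nat \<Rightarrow> real) \<Rightarrow> real \<Rightarrow> 'a measure" where
  "gaussian_noise J \<phi> \<sigma> =
     distr (PiM {..<jdim J} (\<lambda>_. density lborel (normal_density 0 \<sigma>))) (borel_alg J \<phi>)
       (the_inv_into (carr J) \<phi>)"

definition exponential_mechanism :: "nat \<Rightarrow> real \<Rightarrow> real \<Rightarrow> (nat \<Rightarrow> real) \<Rightarrow> nat measure" where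
  "exponential_mechanism m \<epsilon> \<Delta> Q = point_measure {..<m}
     (\<lambda>i. ennreal (exp (\<epsilon> / (2 * \<Delta>) * Q i) / (\<Sum>j<m. exp (\<epsilon> / (2 * \<Delta>) * Q j))))"

text \<open>
  The nominal number of rounds is rounded up to a positive integer. The lower bound 1 only matters
  in rank 1, where \<open>ln r = 0\<close>. Logarithms are natural.
\<close>

definition mw_rounds :: "nat \<Rightarrow> real \<Rightarrow> nat" where
  "mw_rounds r \<alpha> = max 1 (nat \<lceil>144 * ln (real r) / \<alpha>\<^sup>2\<rceil>)"

definition mw_eps :: "nat \<Rightarrow> real \<Rightarrow> real \<Rightarrow> real \<Rightarrow> real" where
  "mw_eps r \<alpha> \<epsilon> \<delta> = \<epsilon> / (4 * sqrt (real (mw_rounds r \<alpha>) * ln (1 / \<delta>)))"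

definition mw_sigma :: "nat \<Rightarrow> real \<Rightarrow> real \<Rightarrow> real \<Rightarrow> real \<Rightarrow> real" where
  "mw_sigma r \<alpha> \<Delta> \<epsilon> \<delta> =
     \<Delta> * sqrt (2 * real r * ln (real (mw_rounds r \<alpha>) / \<delta>)) / mw_eps r \<alpha> \<epsilon> \<delta>"

text \<open>
  The state after \<open>t\<close> rounds is \<open>(L, x, S)\<close>, where \<open>L\<close> is the sum of the first
  \<open>t\<close> noisy losses, \<open>x\<close> the iterate with (one-based) index \<open>t + 1\<close>, and \<open>S\<close>
  the sum of the first \<open>t\<close> iterates. Constraints are indexed by \<open>{..<m}\<close>.
\<close>

primrec mw_run ::
    "('a::real_vector, 'e) jalg_scheme \<Rightarrow> ('a \<Rightarrow> nat \<Rightarrow> real) \<Rightarrow> nat \<Rightarrow> (nat \<Rightarrow> 'a) \<Rightarrow> (nat \<Rightarrow> real)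
       \<Rightarrow> real \<Rightarrow> real \<Rightarrow> real \<Rightarrow> real \<Rightarrow> nat \<Rightarrow> ('a \<times> 'a \<times> 'a) measure" where
  "mw_run J \<phi> m a b \<Delta> \<epsilon>' \<eta> \<sigma> 0 =
     return (borel_alg J \<phi> \<Otimes>\<^sub>M borel_alg J \<phi> \<Otimes>\<^sub>M borel_alg J \<phi>) (0, junit J /\<^sub>R real (jrank J), 0)"
| "mw_run J \<phi> m a b \<Delta> \<epsilon>' \<eta> \<sigma> (Suc t) = do {
     (L, x, S) \<leftarrow> mw_run J \<phi> m a b \<Delta> \<epsilon>' \<eta> \<sigma> t;
     p \<leftarrow> exponential_mechanism m \<epsilon>' \<Delta> (\<lambda>i. trace_inner J (a i) x - b i);
     z \<leftarrow> gaussian_noise J \<phi> \<sigma>;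
     let L' = L + (1 / 2) *\<^sub>R (a p + z);
         w = jexp J (- \<eta> *\<^sub>R L')
     in return (borel_alg J \<phi> \<Otimes>\<^sub>M borel_alg J \<phi> \<Otimes>\<^sub>M borel_alg J \<phi>) (L', w /\<^sub>R Tr J w, S + x)
   }"

definition noisy_mw ::
    "('a::real_vector, 'e) jalg_scheme \<Rightarrow> ('a \<Rightarrow> nat \<Rightarrow> real) \<Rightarrow> nat \<Rightarrow> (nat \<Rightarrow> 'a) \<Rightarrow> (nat \<Rightarrow> real)
       \<Rightarrow> real \<Rightarrow> real \<Rightarrow> real \<Rightarrow> real \<Rightarrow> 'a measure" where
  "noisy_mw J \<phi> m a b \<Delta> \<epsilon> \<delta> \<alpha> =
     (let r = jrank J; T = mw_rounds r \<alpha>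
      in distr
           (mw_run J \<phi> m a b \<Delta> (mw_eps r \<alpha> \<epsilon> \<delta>) (\<alpha> / 12) (mw_sigma r \<alpha> \<Delta> \<epsilon> \<delta>) T)
           (borel_alg J \<phi>) (\<lambda>(L, x, S). S /\<^sub>R real T))"

text \<open>
  A soft-O bound on \<open>P\<close> with respect to \<open>g\<close>: at most \<open>g\<close> times a polynomial in the
  logarithm of \<open>g\<close>, times the hidden factor \<open>C\<close>. The absolute value is needed because
  \<open>g\<close> may be far below 1. The hidden factor may depend polylogarithmically on the number
  \<open>m\<close> of constraints, and on nothing else: the error of the exponential mechanism over
  \<open>m\<close> candidates grows like \<open>ln m\<close>, which does not occur in \<open>accuracy_rate\<close>,
  and no bound uniform in \<open>m\<close> holds.
\<close>

definition soft_O_bound :: "real \<Rightarrow> nat \<Rightarrow> real \<Rightarrow> real" where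
  "soft_O_bound C q g = C * g * (1 + \<bar>ln g\<bar>) ^ q"

definition accuracy_rate :: "nat \<Rightarrow> nat \<Rightarrow> nat \<Rightarrow> real \<Rightarrow> real \<Rightarrow> real \<Rightarrow> real \<Rightarrow> real" where
  "accuracy_rate p r k \<Delta> \<epsilon> \<beta> \<delta> =
     \<Delta> powr (1 / 2) * real r powr (1 / 4) * real k powr (1 / 4) / \<epsilon> powr (1 / 2) *
     (1 + ln (real r) + \<bar>ln (1 / \<beta>)\<bar> + ln (1 / \<delta>)) ^ p"

end

theory Submission
  imports Defs "HOL-Computational_Algebra.Fundamental_Theorem_Algebra"
begin

text \<open>
  The accuracy is chosen so large that the randomness can be removed at once. With probability at
  least \<open>1 - \<beta>\<close>, in every round the Gaussian element \<open>z\<close> has norm at most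
  \<open>\<zeta> \<le> \<alpha> / 8\<close> in the trace inner product and the exponential mechanism picks a constraint whose violation is within
  \<open>\<gamma> \<le> \<alpha> / 4\<close> of the largest one (a union bound over the rounds, using
  \<open>gaussian_noise_bound\<close> and \<open>exponential_mechanism_utility\<close>). Both error terms are of
  order \<open>1 / \<alpha>\<close>, because the number of rounds is of order \<open>1 / \<alpha>\<^sup>2\<close>; requiring them to be
  small multiples of \<open>\<alpha>\<close> gives the square root in the rate (\<open>mw_parameters\<close>). If
  \<open>\<alpha> \<ge> 2\<close> there is nothing to prove about the constraints, since \<open>\<langle>a, x\<rangle>\<close> lies in
  \<open>[-1, 1]\<close> for all density elements \<open>x\<close>.

  On good rounds the statement is a deterministic regret bound. Its potential is
  \<open>\<Phi> v = ln (Tr (exp v))\<close>, and the step inequality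
  \<open>\<Phi> (v - \<eta> l) \<le> \<Phi> v - \<eta> \<langle>l, x\<rangle> + \<eta>\<^sup>2\<close> for \<open>x = exp v / Tr (exp v)\<close> and
  \<open>- e \<le> l \<le> e\<close> (\<open>log_partition_step\<close>) is usually derived from the Golden-Thompson
  inequality. Here it comes from a lower bound on the relative entropy: for Jordan frames \<open>p\<close>
  and \<open>q\<close> diagonalising two elements, the numbers \<open>\<langle>p, q\<rangle>\<close> are the entries of a doubly
  stochastic matrix, so that a scalar inequality between eigenvalues can be averaged. This bounds the
  relative entropy of \<open>y\<close> and \<open>x\<close> from below by
  \<open>\<parallel>\<surd>y - \<surd>x\<parallel>\<^sup>2\<close> (\<open>klein_hellinger\<close>), and
  \<open>x - y = (\<surd>x - \<surd>y) \<circ> (\<surd>x + \<surd>y)\<close> converts the square root distance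
  into a bound on \<open>\<langle>l, x - y\<rangle>\<close>.

  The Jordan theory is built from the axioms. Polarising the Jordan identity shows that the
  multiplication operators of iterates of \<open>x\<close> commute with that of \<open>x\<close>; diagonalising the
  symmetric operator of multiplication by \<open>x\<close> on the space of such elements decomposes the unit
  into orthogonal idempotents, which are refined to primitive ones (\<open>spectral_theorem\<close>). That
  rank and trace do not depend on the frame follows from the fact that two primitive idempotents
  which are not orthogonal have the same norm in every associative inner product
  (\<open>primitive_norm_eq\<close>): hence one fixed element represents the trace as a linear functional
  (\<open>sum_eigenvalues_eq_aip\<close>), and its multiplication operator commutes with all others,
  which makes the trace form associative (\<open>trace_inner_assoc\<close>).

  Measurability of the algorithm rests on the power series of the exponential; the cone is measurable
  because membership is a countable condition on traces of exponentials
  (\<open>cone_iff_trace_jexp\<close>).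
\<close>

section \<open>Arithmetic in a Euclidean Jordan algebra\<close>

(* the symbol is reserved for the Jordan product *)
no_notation comp (infixl "\<circ>" 55)

context euclidean_jordan_algebra
begin

lemma add_closed [simp, intro]: "x \<in> carr J \<Longrightarrow> y \<in> carr J \<Longrightarrow> x + y \<in> carr J"
  using subspace_carr subspace_add by blast

lemma zero_closed [simp, intro]: "0 \<in> carr J"
  using subspace_carr subspace_0 by blast

lemma scale_closed [simp, intro]: "x \<in> carr J \<Longrightarrow> c *\<^sub>R x \<in> carr J"
  using subspace_carr subspace_scale by blast

lemma diff_closed [simp, intro]: "x \<in> carr J \<Longrightarrow> y \<in> carr J \<Longrightarrow> x - y \<in> carr J"
  using subspace_carr subspace_diff by blast

lemma minus_closed [simp, intro]: "x \<in> carr J \<Longrightarrow> - x \<in> carr J"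
  using subspace_carr subspace_neg by blast

lemma sum_closed [simp, intro]: "(\<And>i. i \<in> I \<Longrightarrow> f i \<in> carr J) \<Longrightarrow> (\<Sum>i\<in>I. f i) \<in> carr J"
  using subspace_carr subspace_sum by blast

declare mult_closed [simp, intro] unit_closed [simp, intro] unit_left [simp]

lemma mult_add_right:
  "\<lbrakk>x \<in> carr J; y \<in> carr J; z \<in> carr J\<rbrakk> \<Longrightarrow> z \<circ> (x + y) = z \<circ> x + z \<circ> y"
  using mult_add_left mult_commute add_closed by metis

lemma mult_scale_right: "\<lbrakk>x \<in> carr J; y \<in> carr J\<rbrakk> \<Longrightarrow> y \<circ> (c *\<^sub>R x) = c *\<^sub>R (y \<circ> x)"
  using mult_scale_left mult_commute scale_closed by metis

lemma unit_right [simp]: "x \<in> carr J \<Longrightarrow> x \<circ> junit J = x"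
  using mult_commute unit_left unit_closed by metis

lemma mult_zero_left [simp]: "x \<in> carr J \<Longrightarrow> 0 \<circ> x = 0"
  using mult_scale_left[of x x 0] mult_scale_left[of 0 x 0] by simp

lemma mult_zero_right [simp]: "x \<in> carr J \<Longrightarrow> x \<circ> 0 = 0"
  using mult_commute mult_zero_left zero_closed by metis

lemma mult_minus_left: "\<lbrakk>x \<in> carr J; y \<in> carr J\<rbrakk> \<Longrightarrow> (- x) \<circ> y = - (x \<circ> y)"
  using mult_scale_left[of x y "-1"] by simp

lemma mult_minus_right: "\<lbrakk>x \<in> carr J; y \<in> carr J\<rbrakk> \<Longrightarrow> x \<circ> (- y) = - (x \<circ> y)"
  using mult_scale_right[of y x "-1"] by simp

lemma mult_diff_left:
  "\<lbrakk>x \<in> carr J; y \<in> carr J; z \<in> carr J\<rbrakk> \<Longrightarrow> (x - y) \<circ> z = x \<circ> z - y \<circ> z"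
  using mult_add_left[of x "-y" z] by (simp add: mult_minus_left)

lemma mult_diff_right:
  "\<lbrakk>x \<in> carr J; y \<in> carr J; z \<in> carr J\<rbrakk> \<Longrightarrow> z \<circ> (x - y) = z \<circ> x - z \<circ> y"
  using mult_add_right[of x "-y" z] by (simp add: mult_minus_right)

lemma mult_sum_left:
  "\<lbrakk>\<And>i. i \<in> I \<Longrightarrow> f i \<in> carr J; z \<in> carr J\<rbrakk> \<Longrightarrow> (\<Sum>i\<in>I. f i) \<circ> z = (\<Sum>i\<in>I. f i \<circ> z)"
  by (induction I rule: infinite_finite_induct) (auto simp: mult_add_left)

lemma mult_sum_right:
  "\<lbrakk>\<And>i. i \<in> I \<Longrightarrow> f i \<in> carr J; z \<in> carr J\<rbrakk> \<Longrightarrow> z \<circ> (\<Sum>i\<in>I. f i) = (\<Sum>i\<in>I. z \<circ> f i)"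
  by (induction I rule: infinite_finite_induct) (auto simp: mult_add_right)

lemmas mult_linear = mult_add_left mult_add_right mult_scale_left mult_scale_right
  mult_minus_left mult_minus_right mult_diff_left mult_diff_right

text \<open>
  An arbitrary associative inner product, fixed once and for all. The trace form cannot be used
  yet: that the trace is linear is a consequence of the spectral theory below.
\<close>

definition aip :: "'a \<Rightarrow> 'a \<Rightarrow> real" where
  "aip = (SOME ip. inner_product_on (carr J) ip \<and>
         (\<forall>x\<in>carr J. \<forall>y\<in>carr J. \<forall>z\<in>carr J. ip (x \<circ> y) z = ip x (y \<circ> z)))"

lemma aip_spec:
  shows "inner_product_on (carr J) aip"
  and "\<forall>x\<in>carr J. \<forall>y\<in>carr J. \<forall>z\<in>carr J. aip (x \<circ> y) z = aip x (y \<circ> z)"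
  using someI_ex[OF associative_inner_product] unfolding aip_def by blast+

lemma aip_commute: "\<lbrakk>x \<in> carr J; y \<in> carr J\<rbrakk> \<Longrightarrow> aip x y = aip y x"
  using aip_spec(1) unfolding inner_product_on_def by meson

lemma aip_assoc: "\<lbrakk>x \<in> carr J; y \<in> carr J; z \<in> carr J\<rbrakk> \<Longrightarrow> aip (x \<circ> y) z = aip x (y \<circ> z)"
  using aip_spec(2) by blast

lemma aip_assoc': "\<lbrakk>x \<in> carr J; y \<in> carr J; z \<in> carr J\<rbrakk> \<Longrightarrow> aip (x \<circ> y) z = aip y (x \<circ> z)"
  using aip_assoc[of y x z] mult_commute[of x y] by simp

lemma aip_pos: "\<lbrakk>x \<in> carr J; x \<noteq> 0\<rbrakk> \<Longrightarrow> aip x x > 0"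
  using aip_spec(1) unfolding inner_product_on_def by meson

lemma aip_add_left: "\<lbrakk>x \<in> carr J; y \<in> carr J; z \<in> carr J\<rbrakk> \<Longrightarrow> aip (x + y) z = aip x z + aip y z"
  using aip_spec(1) unfolding inner_product_on_def by meson

lemma aip_scale_left: "\<lbrakk>x \<in> carr J; y \<in> carr J\<rbrakk> \<Longrightarrow> aip (c *\<^sub>R x) y = c * aip x y"
  using aip_spec(1) unfolding inner_product_on_def by meson

lemma aip_add_right: "\<lbrakk>x \<in> carr J; y \<in> carr J; z \<in> carr J\<rbrakk> \<Longrightarrow> aip z (x + y) = aip z x + aip z y"
  using aip_add_left aip_commute add_closed by metis

lemma aip_scale_right: "\<lbrakk>x \<in> carr J; y \<in> carr J\<rbrakk> \<Longrightarrow> aip y (c *\<^sub>R x) = c * aip y x"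
  using aip_scale_left aip_commute scale_closed by metis

lemma aip_zero_left [simp]: "x \<in> carr J \<Longrightarrow> aip 0 x = 0"
  using aip_scale_left[of x x 0] by simp

lemma aip_zero_right [simp]: "x \<in> carr J \<Longrightarrow> aip x 0 = 0"
  using aip_scale_right[of x x 0] by simp

lemma aip_minus_left: "\<lbrakk>x \<in> carr J; y \<in> carr J\<rbrakk> \<Longrightarrow> aip (- x) y = - aip x y"
  using aip_scale_left[of x y "-1"] by simp

lemma aip_minus_right: "\<lbrakk>x \<in> carr J; y \<in> carr J\<rbrakk> \<Longrightarrow> aip x (- y) = - aip x y"
  using aip_scale_right[of y x "-1"] by simp

lemma aip_diff_left: "\<lbrakk>x \<in> carr J; y \<in> carr J; z \<in> carr J\<rbrakk> \<Longrightarrow> aip (x - y) z = aip x z - aip y z"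
  using aip_add_left[of x "-y" z] by (simp add: aip_minus_left)

lemma aip_diff_right: "\<lbrakk>x \<in> carr J; y \<in> carr J; z \<in> carr J\<rbrakk> \<Longrightarrow> aip z (x - y) = aip z x - aip z y"
  using aip_add_right[of x "-y" z] by (simp add: aip_minus_right)

lemma aip_sum_left:
  "\<lbrakk>\<And>i. i \<in> I \<Longrightarrow> f i \<in> carr J; z \<in> carr J\<rbrakk> \<Longrightarrow> aip (\<Sum>i\<in>I. f i) z = (\<Sum>i\<in>I. aip (f i) z)"
  by (induction I rule: infinite_finite_induct) (auto simp: aip_add_left)

lemma aip_sum_right:
  "\<lbrakk>\<And>i. i \<in> I \<Longrightarrow> f i \<in> carr J; z \<in> carr J\<rbrakk> \<Longrightarrow> aip z (\<Sum>i\<in>I. f i) = (\<Sum>i\<in>I. aip z (f i))"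
  by (induction I rule: infinite_finite_induct) (auto simp: aip_add_right)

lemma aip_nonneg: "x \<in> carr J \<Longrightarrow> aip x x \<ge> 0"
  by (cases "x = 0") (auto simp: less_imp_le aip_pos)

lemma aip_eq_0_iff: "x \<in> carr J \<Longrightarrow> aip x x = 0 \<longleftrightarrow> x = 0"
  using aip_pos[of x] by (cases "x = 0") auto

lemmas aip_linear = aip_add_left aip_add_right aip_scale_left aip_scale_right
  aip_minus_left aip_minus_right aip_diff_left aip_diff_right

section \<open>The linearised Jordan identity and idempotents\<close>

text \<open>
  With \<open>L\<^sub>u\<close> for multiplication by \<open>u\<close>, this is the commutator of
  \<open>L\<^bsub>x\<circ>y\<^esub>\<close> and \<open>L\<^sub>z\<close> applied to \<open>w\<close>. It is linear in each of
  \<open>x\<close>, \<open>y\<close>, \<open>z\<close>, and the Jordan identity says that it vanishes for \<open>x = y = z\<close>.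
\<close>

definition jassoc :: "'a \<Rightarrow> 'a \<Rightarrow> 'a \<Rightarrow> 'a \<Rightarrow> 'a" where
  "jassoc w x y z = (x \<circ> y) \<circ> (z \<circ> w) - z \<circ> ((x \<circ> y) \<circ> w)"

lemma jassoc_commute: "\<lbrakk>x \<in> carr J; y \<in> carr J\<rbrakk> \<Longrightarrow> jassoc w x y z = jassoc w y x z"
  by (simp add: jassoc_def mult_commute)

lemma jassoc_add:
  assumes "w \<in> carr J" "x \<in> carr J" "x' \<in> carr J" "y \<in> carr J" "z \<in> carr J"
  shows "jassoc w (x + x') y z = jassoc w x y z + jassoc w x' y z"
    and "jassoc w y (x + x') z = jassoc w y x z + jassoc w y x' z"
    and "jassoc w y z (x + x') = jassoc w y z x + jassoc w y z x'"
  using assms by (simp_all add: jassoc_def mult_linear)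

lemma jassoc_minus:
  assumes "w \<in> carr J" "x \<in> carr J" "y \<in> carr J" "z \<in> carr J"
  shows "jassoc w (- x) y z = - jassoc w x y z"
    and "jassoc w y (- x) z = - jassoc w y x z"
    and "jassoc w y z (- x) = - jassoc w y z x"
  using assms by (simp_all add: jassoc_def mult_linear)

lemma jassoc_self: "\<lbrakk>w \<in> carr J; x \<in> carr J\<rbrakk> \<Longrightarrow> jassoc w x x x = 0"
  by (simp add: jassoc_def jordan_identity)

text \<open>
  The part of degree two in \<open>x\<close> of the cubic identity at \<open>x + y\<close>. Replacing \<open>y\<close> by \<open>- y\<close>
  changes the sign of the part of odd degree in \<open>y\<close> and so separates the two mixed parts.
\<close>

lemma jordan_linearised_quadratic:
  assumes "w \<in> carr J" "x \<in> carr J" "y \<in> carr J"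
  shows "jassoc w x x y + 2 *\<^sub>R jassoc w x y x = 0"
proof -
  let ?S = "\<lambda>x y. jassoc w x x y + 2 *\<^sub>R jassoc w x y x"
  have A: "?S x y + ?S y x = 0"
    using jassoc_self[of w "x + y"] jassoc_self[of w x] jassoc_self[of w y] assms
      jassoc_commute[of x y w]
    by (simp add: jassoc_add scaleR_2 algebra_simps)
  have B: "- ?S x y + ?S y x = 0"
    using jassoc_self[of w "x + - y"] jassoc_self[of w x] jassoc_self[of w y] assms
      jassoc_commute[of x y w]
    by (simp add: jassoc_add jassoc_minus scaleR_2 algebra_simps del: add_uminus_conv_diff)
  have "2 *\<^sub>R ?S x y = (?S x y + ?S y x) - (- ?S x y + ?S y x)" by (simp add: scaleR_2)
  also have "\<dots> = 0" unfolding A B by simp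
  finally show ?thesis by simp
qed

lemma jordan_linearised:
  assumes "w \<in> carr J" "x \<in> carr J" "y \<in> carr J" "z \<in> carr J"
  shows "jassoc w x y z + jassoc w y z x + jassoc w z x y = 0"
proof -
  have "2 *\<^sub>R (jassoc w x y z + jassoc w y z x + jassoc w z x y)
     = (jassoc w (x+z) (x+z) y + 2 *\<^sub>R jassoc w (x+z) y (x+z))
       - (jassoc w x x y + 2 *\<^sub>R jassoc w x y x) - (jassoc w z z y + 2 *\<^sub>R jassoc w z y z)"
    using assms jassoc_commute[of x z w y] jassoc_commute[of y z w x] 
    by (simp add: jassoc_add algebra_simps scaleR_2)
  also have "\<dots> = 0" using assms by (simp add: jordan_linearised_quadratic)
  finally show ?thesis by simp
qed

text \<open>
  The linearised identity read as an equation between operators acting on \<open>z\<close>: multiplication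
  by a product of three elements is a combination of compositions of multiplications by products
  of at most two of them.
\<close>

lemma mult_operator_formula:
  assumes "w \<in> carr J" "x \<in> carr J" "y \<in> carr J" "z \<in> carr J"
  shows "((x \<circ> y) \<circ> w) \<circ> z = (x \<circ> y) \<circ> (w \<circ> z) + (y \<circ> w) \<circ> (x \<circ> z) + (x \<circ> w) \<circ> (y \<circ> z)
     - y \<circ> (w \<circ> (x \<circ> z)) - x \<circ> (w \<circ> (y \<circ> z))"
proof -
  have "z \<circ> ((x \<circ> y) \<circ> w) = ((x \<circ> y) \<circ> w) \<circ> z" "y \<circ> ((z \<circ> x) \<circ> w) = y \<circ> (w \<circ> (x \<circ> z))"
    "(z \<circ> x) \<circ> (y \<circ> w) = (y \<circ> w) \<circ> (x \<circ> z)" "x \<circ> ((y \<circ> z) \<circ> w) = x \<circ> (w \<circ> (y \<circ> z))"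
    "(y \<circ> z) \<circ> (x \<circ> w) = (x \<circ> w) \<circ> (y \<circ> z)" "(x \<circ> y) \<circ> (z \<circ> w) = (x \<circ> y) \<circ> (w \<circ> z)"
    using assms by (simp_all add: mult_commute)
  then show ?thesis
    using jordan_linearised[OF assms] unfolding jassoc_def by (simp add: algebra_simps)
qed

definition op_commute :: "'a \<Rightarrow> 'a \<Rightarrow> bool" where
  "op_commute x y \<longleftrightarrow> (\<forall>z\<in>carr J. x \<circ> (y \<circ> z) = y \<circ> (x \<circ> z))"

lemma op_commuteD: "\<lbrakk>op_commute x y; z \<in> carr J\<rbrakk> \<Longrightarrow> x \<circ> (y \<circ> z) = y \<circ> (x \<circ> z)"
  by (simp add: op_commute_def)

lemma op_commute_sym: "op_commute x y \<Longrightarrow> op_commute y x"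
  by (simp add: op_commute_def)

lemma op_commute_refl: "op_commute x x"
  by (simp add: op_commute_def)

lemma op_commute_unit: "x \<in> carr J \<Longrightarrow> op_commute x (junit J)"
  by (simp add: op_commute_def)

lemma op_commute_add:
  "\<lbrakk>x \<in> carr J; y \<in> carr J; y' \<in> carr J; op_commute x y; op_commute x y'\<rbrakk> \<Longrightarrow> op_commute x (y + y')"
  by (simp add: op_commute_def mult_linear)

lemma op_commute_scale:
  "\<lbrakk>x \<in> carr J; y \<in> carr J; op_commute x y\<rbrakk> \<Longrightarrow> op_commute x (c *\<^sub>R y)"
  by (simp add: op_commute_def mult_linear)

lemma op_commute_zero: "x \<in> carr J \<Longrightarrow> op_commute x 0"
  by (simp add: op_commute_def)

lemma op_commute_sum:
  "\<lbrakk>x \<in> carr J; \<And>i. i \<in> I \<Longrightarrow> f i \<in> carr J; \<And>i. i \<in> I \<Longrightarrow> op_commute x (f i)\<rbrakk>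
    \<Longrightarrow> op_commute x (\<Sum>i\<in>I. f i)"
  by (induction I rule: infinite_finite_induct) (auto simp: op_commute_zero intro!: op_commute_add)

lemma op_commute_square: "x \<in> carr J \<Longrightarrow> op_commute x (x \<circ> x)"
  by (simp add: op_commute_def jordan_identity)

text \<open>
  This takes the place of power associativity: by \<open>mult_operator_formula\<close>, multiplication by
  \<open>x \<circ> (x \<circ> y)\<close> is a polynomial in the multiplications by \<open>x\<close>, \<open>x \<circ> x\<close>,
  \<open>y\<close> and \<open>x \<circ> y\<close>.
\<close>

lemma op_commute_step:
  assumes x: "x \<in> carr J" and y: "y \<in> carr J" and "op_commute x y" "op_commute x (x \<circ> y)"
  shows "op_commute x (x \<circ> (x \<circ> y))"
  unfolding op_commute_def
proof
  fix z assume z: "z \<in> carr J"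
  note sq = op_commuteD[OF op_commute_square[OF x]]
  note c1 = op_commuteD[OF assms(3)] and c2 = op_commuteD[OF assms(4)]
  have F: "(x \<circ> (x \<circ> y)) \<circ> z = 2 *\<^sub>R ((x \<circ> y) \<circ> (x \<circ> z)) + (x \<circ> x) \<circ> (y \<circ> z)
     - y \<circ> (x \<circ> (x \<circ> z)) - x \<circ> (x \<circ> (y \<circ> z))" if z: "z \<in> carr J" for z
  proof -
    have "x \<circ> (x \<circ> y) = (x \<circ> y) \<circ> x" "y \<circ> x = x \<circ> y"
      using x y by (simp_all add: mult_commute)
    then show ?thesis using mult_operator_formula[of x x y z] x y z by (simp add: scaleR_2)
  qed
  show "x \<circ> (x \<circ> (x \<circ> y) \<circ> z) = x \<circ> (x \<circ> y) \<circ> (x \<circ> z)"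
    using x y z by (simp add: F mult_linear c1 c2 sq)
qed

text \<open>
  The Peirce equation: multiplication by an idempotent has its eigenvalues in \<open>{0, 1/2, 1}\<close>.
  It is the linearised identity for \<open>c\<close>, \<open>c\<close>, \<open>a\<close>, applied to \<open>c\<close>.
\<close>

lemma idempotent_cubic:
  assumes "idempotent J c" "a \<in> carr J"
  shows "2 *\<^sub>R (c \<circ> (c \<circ> (c \<circ> a))) = 3 *\<^sub>R (c \<circ> (c \<circ> a)) - c \<circ> a"
proof -
  have c: "c \<in> carr J" "c \<circ> c = c" using assms by (auto simp: idempotent_def)
  have cm: "a \<circ> c = c \<circ> a" "(c \<circ> a) \<circ> c = c \<circ> (c \<circ> a)" using c assms(2) by (simp_all add: mult_commute)
  have e: "3 *\<^sub>R v = v + v + v" for v :: 'a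
    using scaleR_add_left[of 2 1 v] by (simp add: scaleR_2)
  show ?thesis
    using jordan_linearised[of c c c a] c assms(2) unfolding jassoc_def
    by (simp add: cm scaleR_2 e algebra_simps)
qed

text \<open>
  The linearised identity for \<open>p\<close>, \<open>p\<close>, \<open>q\<close>, in which the terms containing \<open>p \<circ> q\<close>
  disappear.
\<close>

lemma orthogonal_idempotents_commute:
  assumes "idempotent J p" "q \<in> carr J" "p \<circ> q = 0"
  shows "op_commute p q"
  unfolding op_commute_def
proof
  fix w assume w: "w \<in> carr J"
  have p: "p \<in> carr J" "p \<circ> p = p" and q: "q \<circ> p = 0"
    using assms mult_commute[of p q] by (auto simp: idempotent_def)
  show "p \<circ> (q \<circ> w) = q \<circ> (p \<circ> w)"
    using jordan_linearised[of w p p q] w assms(2) p q assms(3)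
    unfolding jassoc_def by simp
qed

text \<open>
  Multiplication \<open>L\<close> by an idempotent is positive semidefinite: on the eigenvalues \<open>0\<close>,
  \<open>1/2\<close>, \<open>1\<close> the polynomials \<open>L\<close> and \<open>L\<^sup>2 + 4 (L - L\<^sup>2)\<^sup>2\<close> agree.
\<close>

lemma aip_idempotent_expand:
  assumes "idempotent J c" "t \<in> carr J"
  shows "aip (c \<circ> t) t = aip (c \<circ> t) (c \<circ> t)
     + 4 * aip (c \<circ> t - c \<circ> (c \<circ> t)) (c \<circ> t - c \<circ> (c \<circ> t))"
proof -
  have c: "c \<in> carr J" "c \<circ> c = c" using assms by (auto simp: idempotent_def)
  have sym: "aip x (c \<circ> y) = aip (c \<circ> x) y" if "x \<in> carr J" "y \<in> carr J" for x y
    using that c by (simp add: aip_assoc')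
  have cub: "2 * aip (c \<circ> (c \<circ> (c \<circ> u))) t = 3 * aip (c \<circ> (c \<circ> u)) t - aip (c \<circ> u) t"
    if u: "u \<in> carr J" for u
    using arg_cong[OF idempotent_cubic[OF assms(1) u], of "\<lambda>v. aip v t"] c u assms(2)
    by (simp add: aip_linear)
  show ?thesis
    using cub[of t] cub[of "c \<circ> t"] c assms(2) by (simp add: aip_linear mult_linear sym)
qed

lemma aip_idempotent_nonneg:
  assumes "idempotent J c" "idempotent J d"
  shows "aip c d \<ge> 0" and "aip c d = 0 \<Longrightarrow> c \<circ> d = 0"
proof -
  have cd: "c \<in> carr J" "d \<in> carr J" "d \<circ> d = d" using assms by (auto simp: idempotent_def)
  have "aip c d = aip (c \<circ> d) d" using cd by (simp add: aip_assoc)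
  then have *: "aip c d = aip (c \<circ> d) (c \<circ> d)
     + 4 * aip (c \<circ> d - c \<circ> (c \<circ> d)) (c \<circ> d - c \<circ> (c \<circ> d))"
    using aip_idempotent_expand[OF assms(1) cd(2)] by simp
  have n: "aip (c \<circ> d) (c \<circ> d) \<ge> 0" "aip (c \<circ> d - c \<circ> (c \<circ> d)) (c \<circ> d - c \<circ> (c \<circ> d)) \<ge> 0"
    using cd by (simp_all add: aip_nonneg)
  show "aip c d \<ge> 0" using * n by simp
  show "c \<circ> d = 0" if "aip c d = 0"
  proof -
    have "aip (c \<circ> d) (c \<circ> d) = 0" using * n that by linarith
    then show ?thesis using cd by (simp add: aip_eq_0_iff)
  qed
qed

end

section \<open>Spectral decomposition\<close>

lemma poly_of_real_add:
  "poly (map_poly complex_of_real (p + q)) z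
     = poly (map_poly complex_of_real p) z + poly (map_poly complex_of_real q) z"
  by (induction p q rule: poly_induct2) (simp_all add: map_poly_pCons algebra_simps)

lemma poly_of_real_smult:
  "poly (map_poly complex_of_real (smult c q)) z
     = complex_of_real c * poly (map_poly complex_of_real q) z"
  by (induction q) (simp_all add: map_poly_pCons algebra_simps)

lemma poly_of_real_mult:
  "poly (map_poly complex_of_real (p * q)) z
     = poly (map_poly complex_of_real p) z * poly (map_poly complex_of_real q) z"
  by (induction p)
    (simp_all add: map_poly_pCons poly_of_real_add poly_of_real_smult algebra_simps)

text \<open>
  Divide by the quadratic polynomial of a nonreal root; the remainder is linear with real
  coefficients and vanishes at that root.
\<close>

lemma real_poly_quadratic_factor:
  fixes p :: "real poly"
  assumes "degree p > 0" "\<And>a. poly p a \<noteq> 0"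
  obtains a b d where "b \<noteq> 0" "p = [:a\<^sup>2 + b\<^sup>2, - 2 * a, 1:] * d"
proof -
  let ?c = "\<lambda>p. poly (map_poly complex_of_real p)"
  have "degree (map_poly complex_of_real p) = degree p" by (rule degree_map_poly) auto
  with assms(1) have "\<not> constant (?c p)" by (simp add: constant_degree)
  then obtain z where z: "?c p z = 0" using fundamental_theorem_of_algebra by blast
  define a b where "a = Re z" and "b = Im z"
  have b: "b \<noteq> 0"
  proof
    assume "b = 0"
    then have "z = complex_of_real a" by (simp add: a_def b_def complex_eq_iff)
    moreover have "?c q (complex_of_real a) = complex_of_real (poly q a)" for q
      by (induction q) (simp_all add: map_poly_pCons)
    ultimately show False using z assms(2)[of a] by simp
  qed
  define q where "q = [:a\<^sup>2 + b\<^sup>2, - 2 * a, 1:]"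
  have q: "?c q z = 0" "degree q = 2" "q \<noteq> 0"
    by (simp_all add: q_def map_poly_pCons complex_eq_iff a_def b_def power2_eq_square algebra_simps)
  define r where "r = p mod q"
  have "p = q * (p div q) + r" by (simp add: r_def)
  then have "?c p z = ?c q z * ?c (p div q) z + ?c r z"
    by (metis poly_of_real_add poly_of_real_mult)
  then have rz: "?c r z = 0" using z q by simp
  have "degree r < 2" using q degree_mod_less[of q p] by (auto simp: r_def)
  then have "degree r \<le> 1" by simp
  then have "r = [:coeff r 0, coeff r 1:]"
    by (intro poly_eqI) (auto simp: coeff_pCons coeff_eq_0 split: nat.splits)
  then obtain u v where uv: "r = [:u, v:]" by blast
  have "v * b = 0" "u + v * a = 0"
    using rz by (auto simp: uv map_poly_pCons complex_eq_iff a_def b_def algebra_simps)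
  then have "r = 0" using b uv by simp
  then have "p = q * (p div q)" using \<open>p = q * (p div q) + r\<close> by simp
  then show ?thesis using that b unfolding q_def by blast
qed

context euclidean_jordan_algebra
begin

text \<open>
  The value at \<open>v\<close> of the polynomial \<open>p\<close> in the operator of multiplication by \<open>x\<close>, by
  Horner's rule.
\<close>

definition mult_poly :: "'a \<Rightarrow> real poly \<Rightarrow> 'a \<Rightarrow> 'a" where
  "mult_poly x p v = fold_coeffs (\<lambda>a w. a *\<^sub>R v + x \<circ> w) p 0"

lemma mult_poly_0 [simp]: "mult_poly x 0 v = 0"
  by (simp add: mult_poly_def)

lemma mult_poly_pCons: "x \<in> carr J \<Longrightarrow> mult_poly x (pCons a p) v = a *\<^sub>R v + x \<circ> mult_poly x p v"
  by (cases "p = 0"; cases "a = 0") (simp_all add: mult_poly_def)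

lemma mult_poly_closed [simp]: "x \<in> carr J \<Longrightarrow> v \<in> carr J \<Longrightarrow> mult_poly x p v \<in> carr J"
  by (induction p) (auto simp: mult_poly_pCons)

lemma mult_poly_add: "x \<in> carr J \<Longrightarrow> v \<in> carr J \<Longrightarrow> mult_poly x (p + q) v = mult_poly x p v + mult_poly x q v"
  by (induction p q rule: poly_induct2) (simp_all add: mult_poly_pCons mult_linear algebra_simps)

lemma mult_poly_smult: "x \<in> carr J \<Longrightarrow> v \<in> carr J \<Longrightarrow> mult_poly x (smult c p) v = c *\<^sub>R mult_poly x p v"
  by (induction p) (simp_all add: mult_poly_pCons mult_linear algebra_simps)

lemma mult_poly_mult: "x \<in> carr J \<Longrightarrow> v \<in> carr J \<Longrightarrow> mult_poly x (p * q) v = mult_poly x p (mult_poly x q v)"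
  by (induction p) (simp_all add: mult_poly_pCons mult_poly_add mult_poly_smult)

lemma mult_poly_sum: "x \<in> carr J \<Longrightarrow> v \<in> carr J \<Longrightarrow> mult_poly x (\<Sum>i\<in>I. f i) v = (\<Sum>i\<in>I. mult_poly x (f i) v)"
  by (induction I rule: infinite_finite_induct) (simp_all add: mult_poly_add)

lemma mult_poly_monom: "x \<in> carr J \<Longrightarrow> v \<in> carr J \<Longrightarrow> mult_poly x (monom c n) v = c *\<^sub>R mult_poly x (monom 1 n) v"
  using mult_poly_smult[of x v c "monom 1 n"] by (simp add: smult_monom)

text \<open>
  The vectors obtained by repeated multiplication with \<open>x\<close> lie in a space of finite dimension,
  so that sufficiently many of them are linearly dependent.
\<close>

lemma mult_poly_annihilator:
  assumes "x \<in> carr J" "v \<in> carr J"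
  obtains p where "p \<noteq> 0" "mult_poly x p v = 0"
proof -
  obtain B where B: "finite B" "span B = carr J" using finite_dim by blast
  define N where "N = card B"
  define y where "y = (\<lambda>n. mult_poly x (monom 1 n) v)"
  have yc: "y n \<in> carr J" for n using assms by (simp add: y_def)
  show ?thesis
  proof (cases "inj_on y {..N}")
    case False
    then obtain i j where ij: "i \<noteq> j" "y i = y j" by (auto simp: inj_on_def)
    have "monom 1 i + monom (-1) j \<noteq> (0 :: real poly)"
      using ij(1) by (auto simp: poly_eq_iff dest!: spec[of _ i])
    moreover have "mult_poly x (monom 1 i + monom (-1) j) v = 0"
      using assms ij(2) mult_poly_monom[of x v "-1" j] by (simp add: mult_poly_add y_def)
    ultimately show ?thesis using that by blast
  next
    case True
    have "card (y ` {..N}) = Suc N" using True by (simp add: card_image)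
    moreover have "y ` {..N} \<subseteq> span B" using yc B by auto
    ultimately have "dependent (y ` {..N})"
      using independent_span_bound[OF B(1), of "y ` {..N}"] by (force simp: N_def)
    then obtain u where u: "\<exists>w\<in>y ` {..N}. u w \<noteq> 0" "(\<Sum>w\<in>y ` {..N}. u w *\<^sub>R w) = 0"
      by (subst (asm) dependent_finite) auto
    have s: "(\<Sum>i\<le>N. u (y i) *\<^sub>R y i) = 0" using u(2) by (simp add: sum.reindex[OF True])
    define p where "p = (\<Sum>i\<le>N. monom (u (y i)) i)"
    have "mult_poly x p v = (\<Sum>i\<le>N. u (y i) *\<^sub>R y i)"
      unfolding p_def y_def using assms by (simp add: mult_poly_sum mult_poly_monom[of x v "u _"])
    then have "mult_poly x p v = 0" using s by simp
    moreover obtain i where i: "i \<le> N" "u (y i) \<noteq> 0" using u(1) by auto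
    have "coeff p i = (\<Sum>j\<le>N. if j = i then u (y j) else 0)"
      unfolding p_def by (simp add: coeff_sum)
    then have "coeff p i \<noteq> 0" using i by simp
    then have "p \<noteq> 0" by auto
    ultimately show ?thesis using that by blast
  qed
qed

lemma symmetric_kernel_square:
  assumes "x \<in> carr J" "y \<in> carr J"
    and "x \<circ> (x \<circ> y - a *\<^sub>R y) - a *\<^sub>R (x \<circ> y - a *\<^sub>R y) = 0"
  shows "x \<circ> y = a *\<^sub>R y"
proof -
  let ?w = "x \<circ> y - a *\<^sub>R y"
  have "aip ?w ?w = aip y (x \<circ> ?w - a *\<^sub>R ?w)"
    using assms(1,2) by (simp add: aip_linear mult_linear aip_assoc' algebra_simps)
  then have "aip ?w ?w = 0" unfolding assms(3) using assms(2) by simp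
  then have "?w = 0" using assms(1,2) aip_eq_0_iff[of ?w] by simp
  then show ?thesis by simp
qed

lemma symmetric_no_complex_eigenvalue:
  assumes "x \<in> carr J" "w \<in> carr J" "b \<noteq> 0" and "mult_poly x [:a\<^sup>2 + b\<^sup>2, - 2 * a, 1:] w = 0"
  shows "w = 0"
proof -
  have "aip (mult_poly x [:a\<^sup>2 + b\<^sup>2, - 2 * a, 1:] w) w
    = aip (x \<circ> w - a *\<^sub>R w) (x \<circ> w - a *\<^sub>R w) + b\<^sup>2 * aip w w"
    using assms(1,2) aip_commute[of "x \<circ> w" w]
    by (simp add: mult_poly_pCons aip_linear mult_linear aip_assoc' power2_eq_square algebra_simps)
  then have "aip (x \<circ> w - a *\<^sub>R w) (x \<circ> w - a *\<^sub>R w) + b\<^sup>2 * aip w w = 0"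
    using assms by simp
  moreover have "aip (x \<circ> w - a *\<^sub>R w) (x \<circ> w - a *\<^sub>R w) \<ge> 0" "aip w w \<ge> 0"
    using assms by (simp_all add: aip_nonneg)
  ultimately have "b\<^sup>2 * aip w w = 0"
    by (smt (verit) mult_nonneg_nonneg zero_le_power2)
  then show ?thesis using assms by (simp add: aip_eq_0_iff)
qed

text \<open>
  Symmetry of the multiplication operator with respect to an associative inner product excludes
  nonreal eigenvalues and nontrivial Jordan blocks, so the annihilating polynomial can be
  stripped of its factors one by one. The invariant subspace is kept general because the
  eigenvectors are needed with an additional property in \<open>weak_spectral\<close>.
\<close>

lemma mult_diagonalisable:
  assumes x: "x \<in> carr J" and U: "subspace U" "U \<subseteq> carr J" "\<And>u. u \<in> U \<Longrightarrow> x \<circ> u \<in> U"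
    and "p \<noteq> 0" "v \<in> U" "mult_poly x p v = 0"
  shows "\<exists>\<Lambda> w. finite \<Lambda> \<and> (\<forall>l\<in>\<Lambda>. w l \<in> U \<and> x \<circ> w l = l *\<^sub>R w l) \<and> v = (\<Sum>l\<in>\<Lambda>. w l)"
  using assms(5-7)
proof (induction "degree p" arbitrary: p v rule: less_induct)
  case less
  have v: "v \<in> carr J" using less U by blast
  show ?case
  proof (cases "degree p = 0")
    case True
    then obtain c where "p = [:c:]" by (metis degree_eq_zeroE)
    then have "v = 0" using less x by (simp add: mult_poly_pCons)
    then show ?thesis by (intro exI[of _ "{}"]) simp
  next
    case deg: False
    show ?thesis
    proof (cases "\<exists>a. poly p a = 0")
      case True
      then obtain a q where q: "p = [:-a, 1:] * q" by (metis poly_eq_0_iff_dvd dvdE)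
      then have q0: "q \<noteq> 0" using less by auto
      then have dq: "degree q < degree p" unfolding q by (simp add: degree_mult_eq del: mult_pCons_left)
      let ?M = "\<lambda>u. x \<circ> u - a *\<^sub>R u"
      have "mult_poly x [:-a, 1:] v = ?M v" using x v by (simp add: mult_poly_pCons)
      then have "mult_poly x q (?M v) = 0" using less(4) x v mult_poly_mult[OF x v, of q "[:-a, 1:]"]
        by (simp add: q mult.commute del: mult_pCons_left mult_pCons_right)
      moreover have MU: "?M u \<in> U" if "u \<in> U" for u
        using that U by (simp add: subspace_diff subspace_scale)
      ultimately obtain \<Lambda> w where w: "finite \<Lambda>" "\<And>l. l \<in> \<Lambda> \<Longrightarrow> w l \<in> U"
        "\<And>l. l \<in> \<Lambda> \<Longrightarrow> x \<circ> w l = l *\<^sub>R w l" "?M v = (\<Sum>l\<in>\<Lambda>. w l)"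
        using less(1)[OF dq q0 MU[OF less(3)]] by blast
      have wc: "w l \<in> carr J" if "l \<in> \<Lambda>" for l using w(2) that U by blast
      let ?r = "\<lambda>l. (1 / (l - a)) *\<^sub>R w l"
      \<comment> \<open>\<open>?r l\<close> is a preimage of \<open>w l\<close> under \<open>?M\<close>; what remains of \<open>v\<close> is an eigenvector for \<open>a\<close>\<close>
      define y where "y = v - (\<Sum>l\<in>\<Lambda> - {a}. ?r l)"
      have yU: "y \<in> U" unfolding y_def
        using U less(3) w(2) by (intro subspace_diff subspace_sum subspace_scale) auto
      have yc: "y \<in> carr J" using yU U by blast
      have sc: "(\<Sum>l\<in>\<Lambda> - {a}. ?r l) \<in> carr J" using wc by auto
      have "x \<circ> (\<Sum>l\<in>\<Lambda> - {a}. ?r l) - a *\<^sub>R (\<Sum>l\<in>\<Lambda> - {a}. ?r l)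
          = (\<Sum>l\<in>\<Lambda> - {a}. x \<circ> ?r l - a *\<^sub>R ?r l)"
        using x wc by (subst mult_sum_right) (auto simp: scaleR_sum_right sum_subtractf)
      also have "\<dots> = (\<Sum>l\<in>\<Lambda> - {a}. w l)"
      proof (rule sum.cong[OF refl])
        fix l assume l: "l \<in> \<Lambda> - {a}"
        then have "x \<circ> ?r l - a *\<^sub>R ?r l = (l / (l - a) - a / (l - a)) *\<^sub>R w l"
          using x wc w(3) by (simp add: mult_linear scaleR_diff_left)
        also have "l / (l - a) - a / (l - a) = 1" using l by (simp add: diff_divide_distrib[symmetric])
        finally show "x \<circ> ?r l - a *\<^sub>R ?r l = w l" by simp
      qed
      finally have "?M y = (\<Sum>l\<in>\<Lambda>. w l) - (\<Sum>l\<in>\<Lambda> - {a}. w l)"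
        unfolding y_def using x v sc w(4) by (simp add: mult_linear algebra_simps)
      also have "\<dots> = (if a \<in> \<Lambda> then w a else 0)"
        using w(1) by (simp add: sum_diff1)
      finally have My: "?M y = (if a \<in> \<Lambda> then w a else 0)" .
      have "x \<circ> ?M y - a *\<^sub>R ?M y = 0"
        unfolding My using w(3) x by simp
      then have eig: "x \<circ> y = a *\<^sub>R y" using symmetric_kernel_square x yc by blast
      define w' where "w' = (\<lambda>l. if l = a then y else ?r l)"
      have "finite (insert a \<Lambda>)" using w by simp
      moreover have "w' l \<in> U \<and> x \<circ> w' l = l *\<^sub>R w' l" if "l \<in> insert a \<Lambda>" for l
        using that yU eig w(2,3) wc x U by (auto simp: w'_def subspace_scale mult_linear)
      moreover have "v = (\<Sum>l\<in>insert a \<Lambda>. w' l)"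
      proof -
        have "(\<Sum>l\<in>insert a \<Lambda>. w' l) = w' a + (\<Sum>l\<in>\<Lambda> - {a}. w' l)"
          using w(1) by (simp add: sum.insert_remove)
        also have "(\<Sum>l\<in>\<Lambda> - {a}. w' l) = (\<Sum>l\<in>\<Lambda> - {a}. ?r l)"
          by (rule sum.cong) (auto simp: w'_def)
        finally show ?thesis by (simp add: w'_def y_def)
      qed
      ultimately show ?thesis by blast
    next
      case False
      then obtain a b d where d: "b \<noteq> 0" "p = [:a\<^sup>2 + b\<^sup>2, - 2 * a, 1:] * d"
        using real_poly_quadratic_factor[of p] deg by (metis gr0I)
      then have d0: "d \<noteq> 0" using less by auto
      have "degree d < degree p" unfolding d(2) using d0 by (simp add: degree_mult_eq del: mult_pCons_left)
      moreover have "mult_poly x d v = 0"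
      proof (rule symmetric_no_complex_eigenvalue[OF x _ d(1)])
        show "mult_poly x [:a\<^sup>2 + b\<^sup>2, - 2 * a, 1:] (mult_poly x d v) = 0"
          using less(4) mult_poly_mult[OF x v] unfolding d(2) by metis
      qed (use x v in simp)
      ultimately show ?thesis using less(1) d0 less(3) by blast
    qed
  qed
qed

definition orthogonal_idempotents :: "'a set \<Rightarrow> bool" where
  "orthogonal_idempotents S \<longleftrightarrow> finite S \<and> (\<forall>c\<in>S. idempotent J c) \<and>
     (\<forall>c\<in>S. \<forall>d\<in>S. c \<noteq> d \<longrightarrow> c \<circ> d = 0)"

text \<open>
  The unit is decomposed into eigenvectors of multiplication by \<open>x\<close> inside the space \<open>U\<close> of
  elements whose multiplication commutes with that of \<open>x\<close>. Commutation shows that the product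
  of eigenvectors for different eigenvalues is an eigenvector for both of them, hence zero;
  multiplying the decomposition of the unit by one of its summands then gives idempotency.
\<close>

lemma weak_spectral:
  assumes x: "x \<in> carr J"
  obtains \<Lambda> c where "finite \<Lambda>" "\<And>l. l \<in> \<Lambda> \<Longrightarrow> idempotent J (c l)"
    "\<And>l \<kappa>. l \<in> \<Lambda> \<Longrightarrow> \<kappa> \<in> \<Lambda> \<Longrightarrow> l \<noteq> \<kappa> \<Longrightarrow> c l \<circ> c \<kappa> = 0"
    "(\<Sum>l\<in>\<Lambda>. c l) = junit J" "x = (\<Sum>l\<in>\<Lambda>. l *\<^sub>R c l)"
proof -
  define U where "U = {v \<in> carr J. op_commute x v \<and> op_commute x (x \<circ> v)}"
  have U: "subspace U"
    unfolding subspace_def U_def using x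
    by (auto simp: mult_linear op_commute_zero intro!: op_commute_add op_commute_scale)
  have Uc: "U \<subseteq> carr J" by (auto simp: U_def)
  have UL: "x \<circ> u \<in> U" if "u \<in> U" for u
    using that x by (auto simp: U_def op_commute_step)
  have eU: "junit J \<in> U"
    using x by (auto simp: U_def op_commute_unit op_commute_refl)
  obtain p where p: "p \<noteq> 0" "mult_poly x p (junit J) = 0" using mult_poly_annihilator[OF x unit_closed] by blast
  obtain \<Lambda> c where c: "finite \<Lambda>" "\<And>l. l \<in> \<Lambda> \<Longrightarrow> c l \<in> U"
      "\<And>l. l \<in> \<Lambda> \<Longrightarrow> x \<circ> c l = l *\<^sub>R c l" "junit J = (\<Sum>l\<in>\<Lambda>. c l)"
    using mult_diagonalisable[OF x U Uc UL p(1) eU p(2)] by blast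
  have cc: "c l \<in> carr J" if "l \<in> \<Lambda>" for l using c(2)[OF that] Uc by blast
  have orth: "c l \<circ> c \<kappa> = 0" if "l \<in> \<Lambda>" "\<kappa> \<in> \<Lambda>" "l \<noteq> \<kappa>" for l \<kappa>
  proof -
    have *: "x \<circ> (c l \<circ> c \<kappa>) = \<kappa> *\<^sub>R (c l \<circ> c \<kappa>)" if "l \<in> \<Lambda>" "\<kappa> \<in> \<Lambda>" for l \<kappa>
      using that c(2)[OF that(1)] c(3)[OF that(2)] cc x
      by (simp add: U_def op_commute_def mult_linear)
    have "l *\<^sub>R (c l \<circ> c \<kappa>) = \<kappa> *\<^sub>R (c l \<circ> c \<kappa>)"
      using *[of l \<kappa>] *[of \<kappa> l] that cc mult_commute[of "c l" "c \<kappa>"] by simp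
    then show ?thesis using that(3) by simp
  qed
  have idem: "idempotent J (c l)" if l: "l \<in> \<Lambda>" for l
  proof -
    have "c l = c l \<circ> junit J" using cc l by simp
    also have "\<dots> = (\<Sum>\<kappa>\<in>\<Lambda>. c l \<circ> c \<kappa>)" unfolding c(4) using cc l by (simp add: mult_sum_right)
    also have "\<dots> = (\<Sum>\<kappa>\<in>\<Lambda>. if \<kappa> = l then c l \<circ> c l else 0)"
      using orth l by (intro sum.cong) auto
    also have "\<dots> = c l \<circ> c l" using l c(1) by simp
    finally show ?thesis using cc l by (simp add: idempotent_def)
  qed
  have "x = x \<circ> junit J" using x by simp
  also have "\<dots> = (\<Sum>l\<in>\<Lambda>. l *\<^sub>R c l)" unfolding c(4) using x cc c(3) by (simp add: mult_sum_right)
  finally show ?thesis using that[of \<Lambda> c] c(1,4) idem orth by simp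
qed

lemma idempotent_closed: "idempotent J c \<Longrightarrow> c \<in> carr J"
  by (simp add: idempotent_def)

lemma idempotent_square: "idempotent J c \<Longrightarrow> c \<circ> c = c"
  by (simp add: idempotent_def)

lemma idempotent_sum_orthogonal:
  assumes "idempotent J a" "idempotent J b" "idempotent J (a + b)"
  shows "a \<circ> b = 0"
proof -
  have "(a + b) \<circ> (a + b) = a + b + 2 *\<^sub>R (a \<circ> b)"
    using assms(1,2) mult_commute[of a b] by (simp add: idempotent_def mult_linear scaleR_2)
  then show ?thesis using idempotent_square[OF assms(3)] by simp
qed

lemma idempotent_diff:
  assumes "idempotent J p" "idempotent J q" "q \<circ> p = q"
  shows "idempotent J (p - q)"
  using assms mult_commute[of p q] by (simp add: idempotent_def mult_linear)

lemma idempotent_unit: "idempotent J (junit J)"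
  by (simp add: idempotent_def)

lemma orthogonal_idempotents_aip:
  assumes "idempotent J c" "d \<in> carr J" "c \<circ> d = 0"
  shows "aip c d = 0"
  using aip_assoc[of c c d] assms by (simp add: idempotent_def)

text \<open>
  Nonzero idempotents with pairwise product zero are orthogonal for \<open>aip\<close>, hence linearly
  independent.
\<close>

lemma orthogonal_idempotents_card_bound:
  obtains N where "\<And>S. orthogonal_idempotents S \<Longrightarrow> 0 \<notin> S \<Longrightarrow> card S \<le> N"
proof -
  obtain B where B: "finite B" "span B = carr J" using finite_dim by blast
  have "card S \<le> card B" if S: "orthogonal_idempotents S" "0 \<notin> S" for S
  proof -
    have Sc: "s \<in> carr J" if "s \<in> S" for s
      using S that by (auto simp: orthogonal_idempotents_def idempotent_def)
    have "independent S"
    proof (rule independent_if_scalars_zero)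
      show "finite S" using S by (simp add: orthogonal_idempotents_def)
      fix f s assume s: "(\<Sum>x\<in>S. f x *\<^sub>R x) = 0" "s \<in> S"
      have "0 = aip s (\<Sum>x\<in>S. f x *\<^sub>R x)" using s Sc by simp
      also have "\<dots> = (\<Sum>x\<in>S. f x * aip s x)"
        using s Sc by (subst aip_sum_right) (auto simp: aip_scale_right)
      also have "\<dots> = (\<Sum>x\<in>S. if x = s then f s * aip s s else 0)"
        using S s(2) Sc
        by (intro sum.cong) (auto simp: orthogonal_idempotents_def orthogonal_idempotents_aip)
      also have "\<dots> = f s * aip s s"
        using S s(2) by (simp add: orthogonal_idempotents_def)
      finally have "f s * aip s s = 0" by simp
      moreover have "aip s s > 0" using aip_pos[of s] Sc[OF s(2)] S s(2) by metis
      ultimately show "f s = 0" by simp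
    qed
    moreover have "S \<subseteq> span B" using Sc B by auto
    ultimately show ?thesis using independent_span_bound[OF B(1)] by blast
  qed
  then show ?thesis using that by blast
qed

text \<open>
  The parts of \<open>s\<close> stay orthogonal to the other members \<open>t\<close> of the family: the inner
  products of \<open>t\<close> with \<open>a\<close> and \<open>b\<close> are nonnegative and add up to that with \<open>s\<close>, which is
  zero.
\<close>

lemma orthogonal_idempotents_split:
  assumes S: "orthogonal_idempotents S" "0 \<notin> S" "s \<in> S"
    and ab: "idempotent J a" "idempotent J b" "a \<noteq> 0" "b \<noteq> 0" "s = a + b"
  shows "\<exists>S'. orthogonal_idempotents S' \<and> 0 \<notin> S' \<and> \<Sum>S' = \<Sum>S \<and> card S' = Suc (card S)"
proof -
  have fin: "finite S" and si: "idempotent J s" using S by (auto simp: orthogonal_idempotents_def)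
  have abo: "a \<circ> b = 0" using idempotent_sum_orthogonal[OF ab(1,2)] si ab(5) by simp
  then have bao: "b \<circ> a = 0" using ab mult_commute by (simp add: idempotent_def)
  have ac: "a \<in> carr J" "b \<in> carr J" using ab idempotent_closed by auto
  have o: "a \<circ> t = 0 \<and> t \<circ> a = 0 \<and> b \<circ> t = 0 \<and> t \<circ> b = 0 \<and> t \<noteq> a \<and> t \<noteq> b" if t: "t \<in> S - {s}" for t
  proof -
    have ti: "idempotent J t" "t \<in> carr J" "s \<circ> t = 0"
      using S t by (auto simp: orthogonal_idempotents_def idempotent_def)
    have "aip a t + aip b t = aip s t" using ac ti ab(5) by (simp add: aip_linear)
    then have "aip a t + aip b t = 0" using orthogonal_idempotents_aip[OF si ti(2,3)] by simp
    moreover have "aip a t \<ge> 0" "aip b t \<ge> 0" using aip_idempotent_nonneg(1) ab ti by auto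
    ultimately have "aip a t = 0" "aip b t = 0" by linarith+
    then have "a \<circ> t = 0" "b \<circ> t = 0" using aip_idempotent_nonneg(2) ab ti by auto
    moreover have "t \<circ> a = a \<circ> t" "t \<circ> b = b \<circ> t" using ac ti mult_commute by auto
    ultimately show ?thesis using ab idempotent_square[OF ab(1)] idempotent_square[OF ab(2)] by auto
  qed
  have ne: "a \<noteq> b" using abo ab idempotent_square[OF ab(1)] by auto
  let ?S = "insert a (insert b (S - {s}))"
  have nin: "a \<notin> S - {s}" "b \<notin> S - {s}" using o by blast+
  have "orthogonal_idempotents ?S"
    unfolding orthogonal_idempotents_def
  proof (intro conjI ballI impI)
    show "finite ?S" using fin by simp
    show "idempotent J c" if "c \<in> ?S" for c
      using that ab S by (auto simp: orthogonal_idempotents_def)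
    show "c \<circ> d = 0" if "c \<in> ?S" "d \<in> ?S" "c \<noteq> d" for c d
      using that o abo bao S(1) unfolding orthogonal_idempotents_def by blast
  qed
  moreover have "0 \<notin> ?S" using S ab by auto
  moreover have "\<Sum>?S = \<Sum>S"
    using fin nin ne ab(5) S(3) by (simp add: sum.remove[OF fin S(3)] algebra_simps)
  moreover have "card ?S = Suc (card S)"
    using fin nin ne S(3) card_Suc_Diff1[OF fin S(3)] by simp
  ultimately show ?thesis by blast
qed

text \<open>
  A family of maximal cardinality among those with sum \<open>c\<close> consists of primitive idempotents,
  as any other member could be split.
\<close>

lemma primitive_refinement:
  assumes "idempotent J c"
  obtains S where "orthogonal_idempotents S" "\<And>s. s \<in> S \<Longrightarrow> primitive_idempotent J s" "\<Sum>S = c"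
proof -
  obtain N where N: "\<And>S. orthogonal_idempotents S \<Longrightarrow> 0 \<notin> S \<Longrightarrow> card S \<le> N"
    using orthogonal_idempotents_card_bound by blast
  let ?P = "\<lambda>S. orthogonal_idempotents S \<and> 0 \<notin> S \<and> \<Sum>S = c"
  have "\<exists>S. ?P S"
  proof (cases "c = 0")
    case True
    then show ?thesis by (intro exI[of _ "{}"]) (auto simp: orthogonal_idempotents_def)
  next
    case False
    then show ?thesis using assms by (intro exI[of _ "{c}"]) (auto simp: orthogonal_idempotents_def)
  qed
  then obtain S0 where "?P S0" by blast
  moreover have "\<forall>S. ?P S \<longrightarrow> card S < Suc N" using N by (simp add: less_Suc_eq_le)
  ultimately have "\<exists>S. ?P S \<and> (\<forall>S'. ?P S' \<longrightarrow> card S' \<le> card S)" by (rule ex_has_greatest_nat)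
  then obtain S where S: "?P S" "\<And>S'. ?P S' \<Longrightarrow> card S' \<le> card S" by blast
  have "primitive_idempotent J s" if s: "s \<in> S" for s
  proof (rule ccontr)
    assume "\<not> primitive_idempotent J s"
    moreover have "idempotent J s" "s \<noteq> 0" using S s by (auto simp: orthogonal_idempotents_def)
    ultimately obtain a b where "idempotent J a" "idempotent J b" "a \<noteq> 0" "b \<noteq> 0" "s = a + b"
      by (auto simp: primitive_idempotent_def)
    then obtain S' where "?P S'" "card S' = Suc (card S)"
      using orthogonal_idempotents_split[of S s a b] S s by auto
    then show False using S(2)[of S'] by simp
  qed
  then show ?thesis using that S by blast
qed

lemma primitiveD:
  assumes "primitive_idempotent J p"
  shows "idempotent J p" "p \<in> carr J" "p \<noteq> 0" "p \<circ> p = p" "aip p p > 0"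
  using assms by (auto simp: primitive_idempotent_def idempotent_def aip_pos)

theorem spectral_theorem:
  assumes "x \<in> carr J"
  obtains Q \<mu> where "spectral_decomp J x Q \<mu>"
proof -
  obtain \<Lambda> c where c: "finite \<Lambda>" "\<And>l. l \<in> \<Lambda> \<Longrightarrow> idempotent J (c l)"
    "\<And>l k. l \<in> \<Lambda> \<Longrightarrow> k \<in> \<Lambda> \<Longrightarrow> l \<noteq> k \<Longrightarrow> c l \<circ> c k = 0"
    "(\<Sum>l\<in>\<Lambda>. c l) = junit J" "x = (\<Sum>l\<in>\<Lambda>. l *\<^sub>R c l)"
    using weak_spectral[OF assms] by blast
  have "\<forall>l\<in>\<Lambda>. \<exists>S. orthogonal_idempotents S \<and> (\<forall>s\<in>S. primitive_idempotent J s) \<and> \<Sum>S = c l"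
    using c(2) primitive_refinement by metis
  then obtain S where S: "\<And>l. l \<in> \<Lambda> \<Longrightarrow> orthogonal_idempotents (S l)"
    "\<And>l s. l \<in> \<Lambda> \<Longrightarrow> s \<in> S l \<Longrightarrow> primitive_idempotent J s" "\<And>l. l \<in> \<Lambda> \<Longrightarrow> \<Sum>(S l) = c l"
    by metis
  have fin: "finite (S l)" if "l \<in> \<Lambda>" for l using S(1)[OF that] by (simp add: orthogonal_idempotents_def)
  have o: "s \<circ> t = 0" if l: "l \<in> \<Lambda>" "k \<in> \<Lambda>" "l \<noteq> k" and st: "s \<in> S l" "t \<in> S k" for l k s t
  proof -
    have idem: "idempotent J u" "u \<in> carr J" if "u \<in> S l \<union> S k" for u
      using S(2) l that primitiveD by blast+
    have "aip (c l) (c k) = 0"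
      using orthogonal_idempotents_aip[OF c(2)[OF l(1)] idempotent_closed[OF c(2)[OF l(2)]] c(3)[OF l]] .
    also have "aip (c l) (c k) = (\<Sum>u\<in>S l. \<Sum>v\<in>S k. aip u v)"
      unfolding S(3)[OF l(1), symmetric] S(3)[OF l(2), symmetric]
      using idem by (subst aip_sum_left) (auto simp: aip_sum_right intro!: sum.cong)
    finally have "(\<Sum>u\<in>S l. \<Sum>v\<in>S k. aip u v) = 0" .
    then have "(\<Sum>v\<in>S k. aip s v) = 0"
      using st idem fin[OF l(1)] by (subst (asm) sum_nonneg_eq_0_iff) (auto intro!: sum_nonneg aip_idempotent_nonneg)
    then have "aip s t = 0"
      using st idem fin[OF l(2)] by (subst (asm) sum_nonneg_eq_0_iff) (auto intro!: aip_idempotent_nonneg)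
    then show ?thesis using aip_idempotent_nonneg(2) idem st by blast
  qed
  have disj: "S l \<inter> S k = {}" if "l \<in> \<Lambda>" "k \<in> \<Lambda>" "l \<noteq> k" for l k
    using o[OF that] S(2)[OF that(1)] primitiveD by (metis disjoint_iff)
  define Q where "Q = (\<Union>l\<in>\<Lambda>. S l)"
  define \<mu> where "\<mu> q = (THE l. l \<in> \<Lambda> \<and> q \<in> S l)" for q
  have \<mu>: "\<mu> q = l" if "l \<in> \<Lambda>" "q \<in> S l" for l q
    unfolding \<mu>_def by (rule the_equality) (use that disj in blast)+
  have "p \<circ> q = 0" if pq: "p \<in> Q" "q \<in> Q" "p \<noteq> q" for p q
  proof -
    obtain l k where lk: "l \<in> \<Lambda>" "p \<in> S l" "k \<in> \<Lambda>" "q \<in> S k"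
      using pq unfolding Q_def by blast
    then show ?thesis
      using o[of l k p q] S(1)[of l] that(3) by (cases "l = k") (auto simp: orthogonal_idempotents_def)
  qed
  moreover have "\<Sum>Q = junit J"
    unfolding Q_def using c fin disj S(3) by (subst sum.UNION_disjoint) auto
  ultimately have "jordan_frame J Q"
    unfolding jordan_frame_def using c(1) fin S(2) by (auto simp: Q_def)
  moreover have "x = (\<Sum>q\<in>Q. \<mu> q *\<^sub>R q)"
  proof -
    have "(\<Sum>q\<in>Q. \<mu> q *\<^sub>R q) = (\<Sum>l\<in>\<Lambda>. \<Sum>q\<in>S l. \<mu> q *\<^sub>R q)"
      unfolding Q_def using c fin disj by (subst sum.UNION_disjoint) auto
    also have "\<dots> = (\<Sum>l\<in>\<Lambda>. l *\<^sub>R c l)"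
      using \<mu> S(3) by (intro sum.cong refl) (simp add: scaleR_sum_right[symmetric])
    finally show ?thesis using c(5) by simp
  qed
  ultimately show ?thesis using that by (auto simp: spectral_decomp_def)
qed

section \<open>Frames, rank and the trace form\<close>

lemma frameD:
  assumes "jordan_frame J Q"
  shows "finite Q" "\<And>q. q \<in> Q \<Longrightarrow> primitive_idempotent J q" "\<And>q. q \<in> Q \<Longrightarrow> q \<in> carr J"
    "\<And>p q. p \<in> Q \<Longrightarrow> q \<in> Q \<Longrightarrow> p \<noteq> q \<Longrightarrow> p \<circ> q = 0" "\<Sum>Q = junit J"
    "\<And>q. q \<in> Q \<Longrightarrow> q \<circ> q = q"
  using assms by (auto simp: jordan_frame_def primitive_idempotent_def idempotent_def)

lemma frame_closed: "jordan_frame J Q \<Longrightarrow> (\<Sum>q\<in>Q. f q *\<^sub>R q) \<in> carr J"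
  using frameD(3) by auto

lemma frame_mult:
  assumes "jordan_frame J Q"
  shows "(\<Sum>q\<in>Q. f q *\<^sub>R q) \<circ> (\<Sum>q\<in>Q. g q *\<^sub>R q) = (\<Sum>q\<in>Q. (f q * g q) *\<^sub>R q)"
proof -
  note Q = frameD[OF assms]
  have "(\<Sum>q\<in>Q. f q *\<^sub>R q) \<circ> (\<Sum>q\<in>Q. g q *\<^sub>R q) = (\<Sum>q\<in>Q. \<Sum>p\<in>Q. (f q * g p) *\<^sub>R (q \<circ> p))"
    using Q(3) by (subst mult_sum_left) (auto simp: mult_sum_right mult_linear intro!: sum.cong)
  also have "\<dots> = (\<Sum>q\<in>Q. \<Sum>p\<in>Q. if p = q then (f q * g q) *\<^sub>R q else 0)"
    using Q by (intro sum.cong refl) auto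
  also have "\<dots> = (\<Sum>q\<in>Q. (f q * g q) *\<^sub>R q)" using Q(1) by simp
  finally show ?thesis .
qed

lemma peirce_one_op_commute:
  assumes "idempotent J p" "a \<in> carr J" "p \<circ> a = a"
  shows "op_commute p a"
  unfolding op_commute_def
proof
  fix w assume w: "w \<in> carr J"
  have p: "p \<in> carr J" "p \<circ> p = p" using assms by (auto simp: idempotent_def)
  show "p \<circ> (a \<circ> w) = a \<circ> (p \<circ> w)"
    using jordan_linearised_quadratic[OF w p(1) assms(2)] assms p w
    by (simp add: jassoc_def scaleR_2 algebra_simps)
qed

text \<open>
  The Peirce 1-space of a primitive idempotent is a line. The square of \<open>a\<close> is annihilated by
  \<open>junit J - p\<close>; since inner products of idempotents are nonnegative, each frame element
  occurring in \<open>a\<close> is annihilated as well, thus lies below \<open>p\<close> and equals it.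
\<close>

lemma primitive_peirce_one:
  assumes p: "primitive_idempotent J p" and a: "a \<in> carr J" "p \<circ> a = a"
  obtains t where "a = t *\<^sub>R p"
proof -
  note pd = primitiveD[OF p]
  obtain Q \<mu> where "spectral_decomp J a Q \<mu>" using spectral_theorem[OF a(1)] .
  then have Q: "jordan_frame J Q" and aQ: "a = (\<Sum>q\<in>Q. \<mu> q *\<^sub>R q)" by (auto simp: spectral_decomp_def)
  note Qd = frameD[OF Q]
  let ?f = "junit J - p"
  have f: "idempotent J ?f" "?f \<in> carr J" using idempotent_diff[OF idempotent_unit pd(1)] pd by simp_all
  have "p \<circ> (a \<circ> a) = a \<circ> a"
    using op_commuteD[OF peirce_one_op_commute[OF pd(1) a] a(1)] a by simp
  then have "(a \<circ> a) \<circ> ?f = 0"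
    using a pd mult_commute[of "a \<circ> a" p] by (simp add: mult_linear)
  then have "aip (a \<circ> a) ?f = 0"
    using aip_assoc[of "a \<circ> a" ?f ?f] idempotent_square[OF f(1)] f(2) a(1) by simp
  also have "aip (a \<circ> a) ?f = (\<Sum>q\<in>Q. (\<mu> q)\<^sup>2 * aip q ?f)"
    unfolding aQ frame_mult[OF Q] using Qd f by (subst aip_sum_left) (auto simp: aip_scale_left power2_eq_square)
  finally have "\<forall>q\<in>Q. (\<mu> q)\<^sup>2 * aip q ?f = 0"
    using Qd(1) aip_idempotent_nonneg(1)[OF primitiveD(1)[OF Qd(2)] f(1)]
    by (subst (asm) sum_nonneg_eq_0_iff) auto
  then have z: "aip q ?f = 0" if "q \<in> Q" "\<mu> q \<noteq> 0" for q using that by auto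
  have eq: "q = p" if q: "q \<in> Q" "\<mu> q \<noteq> 0" for q
  proof -
    note qd = primitiveD[OF Qd(2)[OF q(1)]]
    have "q \<circ> ?f = 0" using aip_idempotent_nonneg(2)[OF qd(1) f(1) z[OF q]] .
    then have "q \<circ> p = q" using qd pd by (simp add: mult_linear)
    then have "idempotent J (p - q)" using idempotent_diff pd qd by blast
    moreover have "p = q + (p - q)" by simp
    ultimately have "p - q = 0" using p qd unfolding primitive_idempotent_def by blast
    then show ?thesis by simp
  qed
  have "a = (\<Sum>q\<in>Q. if q = p then \<mu> p *\<^sub>R p else 0)"
    unfolding aQ by (intro sum.cong refl) (use eq in auto)
  also have "\<dots> = (if p \<in> Q then \<mu> p else 0) *\<^sub>R p" using Qd(1) by simp
  finally show ?thesis using that by blast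
qed

text \<open>
  The combination \<open>2 p \<circ> (p \<circ> q) - p \<circ> q\<close> is the Peirce 1-component of \<open>q\<close>
  with respect to \<open>p\<close>, hence a multiple \<open>w p\<close>; its inner products with \<open>p\<close> and with \<open>q\<close>
  give the two equations.
\<close>

lemma primitive_overlap:
  assumes p: "primitive_idempotent J p" and q: "idempotent J q"
  obtains w where "w * aip p p = aip p q" "2 * aip (p \<circ> q) (p \<circ> q) = (1 + w) * aip p q"
proof -
  note pd = primitiveD[OF p]
  have qd: "q \<in> carr J" "q \<circ> q = q" using q by (auto simp: idempotent_def)
  let ?a = "2 *\<^sub>R (p \<circ> (p \<circ> q)) - p \<circ> q"
  have "p \<circ> ?a = ?a"
    using idempotent_cubic[OF pd(1) qd(1)] scaleR_left.add[of 2 1 "p \<circ> (p \<circ> q)"] pd qd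
    by (simp add: mult_linear scaleR_2 algebra_simps)
  then obtain w where w: "?a = w *\<^sub>R p"
    using primitive_peirce_one[OF p, of ?a] pd(2) qd(1) diff_closed mult_closed scale_closed by blast
  have "aip ?a p = w * aip p p" "aip ?a q = w * aip p q" unfolding w using pd qd by (simp_all add: aip_linear)
  moreover have "aip ?a p = aip p q"
    using pd qd aip_commute[of p q] by (simp add: aip_linear aip_assoc')
  moreover have "aip ?a q = 2 * aip (p \<circ> q) (p \<circ> q) - aip p q"
    using pd qd mult_commute[of "p \<circ> q" q]
    by (simp add: aip_linear aip_assoc'[of p "p \<circ> q" q] aip_assoc)
  ultimately show ?thesis using that[of w] by (simp add: algebra_simps)
qed

text \<open>
  The quantity \<open>\<langle>p \<circ> q, p \<circ> q\<rangle>\<close> in \<open>primitive_overlap\<close> is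
  symmetric in \<open>p\<close> and \<open>q\<close>. So the two coefficients agree if \<open>aip p q \<noteq> 0\<close>, and
  with them the norms.
\<close>

lemma primitive_norm_eq:
  assumes p: "primitive_idempotent J p" and q: "primitive_idempotent J q" and "aip p q \<noteq> 0"
  shows "aip p p = aip q q"
proof -
  note pd = primitiveD[OF p] and qd = primitiveD[OF q]
  obtain w where w: "w * aip p p = aip p q" "2 * aip (p \<circ> q) (p \<circ> q) = (1 + w) * aip p q"
    using primitive_overlap[OF p qd(1)] .
  obtain v where v: "v * aip q q = aip q p" "2 * aip (q \<circ> p) (q \<circ> p) = (1 + v) * aip q p"
    using primitive_overlap[OF q pd(1)] .
  have c: "aip q p = aip p q" "q \<circ> p = p \<circ> q" using pd qd aip_commute mult_commute by auto
  have "(1 + w) * aip p q = (1 + v) * aip p q"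
    by (rule trans[OF w(2)[symmetric] v(2)[unfolded c]])
  then have wv: "w = v" using assms(3) by simp
  have "w * aip p p = w * aip q q"
    by (rule trans[OF w(1) v(1)[unfolded c(1), folded wv, symmetric]])
  moreover have "w \<noteq> 0" using w(1) assms(3) by auto
  ultimately show ?thesis by simp
qed

text \<open>
  The element that represents the trace with respect to \<open>aip\<close>. The weights vary with the
  primitive idempotent because an associative inner product can be rescaled on each simple
  summand.
\<close>

definition trace_vector :: "'a set \<Rightarrow> 'a" where
  "trace_vector Q = (\<Sum>q\<in>Q. (1 / aip q q) *\<^sub>R q)"

lemma trace_vector_closed: "jordan_frame J Q \<Longrightarrow> trace_vector Q \<in> carr J"
  unfolding trace_vector_def by (rule frame_closed)

text \<open>
  Every primitive idempotent has inner product 1 with the trace vector of every frame: by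
  \<open>primitive_norm_eq\<close> the weight of \<open>q\<close> may be exchanged for that of \<open>p\<close>, and the frame
  sums to the unit. This makes the sum of the eigenvalues a linear function that depends on no
  frame.
\<close>

lemma sum_eigenvalues_eq_aip:
  assumes x: "spectral_decomp J x P \<nu>" and Q: "jordan_frame J Q"
  shows "(\<Sum>p\<in>P. \<nu> p) = aip x (trace_vector Q)"
proof -
  have P: "jordan_frame J P" and xP: "x = (\<Sum>p\<in>P. \<nu> p *\<^sub>R p)" using x by (auto simp: spectral_decomp_def)
  note Pd = frameD[OF P] and Qd = frameD[OF Q]
  have tc: "trace_vector Q \<in> carr J" using Q by (rule trace_vector_closed)
  have "aip p (trace_vector Q) = 1" if p: "p \<in> P" for p
  proof -
    have pp: "aip p p > 0" using primitiveD(5)[OF Pd(2)[OF p]] .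
    have "aip p (trace_vector Q) = (\<Sum>q\<in>Q. (1 / aip q q) * aip p q)"
      unfolding trace_vector_def using Pd(3)[OF p] Qd(3)
      by (subst aip_sum_right) (auto simp: aip_scale_right)
    also have "\<dots> = (\<Sum>q\<in>Q. (1 / aip p p) * aip p q)"
    proof (rule sum.cong[OF refl])
      fix q assume q: "q \<in> Q"
      show "(1 / aip q q) * aip p q = (1 / aip p p) * aip p q"
        using primitive_norm_eq[OF Pd(2)[OF p] Qd(2)[OF q]] by (cases "aip p q = 0") auto
    qed
    also have "\<dots> = (1 / aip p p) * aip p (\<Sum>Q)"
      using Pd(3)[OF p] Qd(3) by (subst aip_sum_right) (auto simp: sum_distrib_left)
    also have "\<dots> = (1 / aip p p) * aip p p"
      using Pd(3,6)[OF p] Qd(5) aip_assoc[of p p "junit J"] by simp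
    finally show ?thesis using pp by simp
  qed
  then show ?thesis
    unfolding xP using Pd tc by (subst aip_sum_left) (auto simp: aip_scale_left)
qed

lemma Tr_eqI:
  assumes "spectral_decomp J x P \<nu>"
  shows "Tr J x = (\<Sum>p\<in>P. \<nu> p)"
  unfolding Tr_def
proof (rule the_equality)
  show "\<exists>Q \<mu>. spectral_decomp J x Q \<mu> \<and> (\<Sum>p\<in>P. \<nu> p) = sum \<mu> Q" using assms by blast
  fix t assume "\<exists>Q \<mu>. spectral_decomp J x Q \<mu> \<and> t = sum \<mu> Q"
  then obtain Q \<mu> where Q: "spectral_decomp J x Q \<mu>" "t = sum \<mu> Q" by blast
  then have "jordan_frame J Q" by (simp add: spectral_decomp_def)
  then show "t = (\<Sum>p\<in>P. \<nu> p)" using sum_eigenvalues_eq_aip Q assms by metis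
qed

lemma Tr_eq_aip:
  assumes "x \<in> carr J" "jordan_frame J Q"
  shows "Tr J x = aip x (trace_vector Q)"
  using spectral_theorem[OF assms(1)] Tr_eqI sum_eigenvalues_eq_aip assms(2) by metis

lemma jrank_eq_card:
  assumes "jordan_frame J Q"
  shows "jrank J = card Q"
  unfolding jrank_def
proof (rule the_equality)
  fix r assume "\<exists>P. jordan_frame J P \<and> card P = r"
  then obtain P where P: "jordan_frame J P" "card P = r" by blast
  have "real (card P) = aip (junit J) (trace_vector Q)" if "jordan_frame J P" for P
    using sum_eigenvalues_eq_aip[of "junit J" P "\<lambda>_. 1" Q] that frameD(5)[OF that] assms
    by (simp add: spectral_decomp_def)
  then have "real (card P) = real (card Q)" using P(1) assms by metis
  then show "r = card Q" using P by simp
qed (use assms in blast)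

lemma frame_exists: obtains Q where "jordan_frame J Q"
  using spectral_theorem[OF unit_closed] by (auto simp: spectral_decomp_def)

lemma Tr_add: "x \<in> carr J \<Longrightarrow> y \<in> carr J \<Longrightarrow> Tr J (x + y) = Tr J x + Tr J y"
  using frame_exists by (metis Tr_eq_aip add_closed aip_add_left trace_vector_closed)

lemma Tr_scale: "x \<in> carr J \<Longrightarrow> Tr J (c *\<^sub>R x) = c * Tr J x"
  using frame_exists by (metis Tr_eq_aip scale_closed aip_scale_left trace_vector_closed)

lemma Tr_minus: "x \<in> carr J \<Longrightarrow> Tr J (- x) = - Tr J x"
  using Tr_scale[of x "-1"] by simp

lemma Tr_diff: "x \<in> carr J \<Longrightarrow> y \<in> carr J \<Longrightarrow> Tr J (x - y) = Tr J x - Tr J y"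
  using Tr_add[of x "- y"] by (simp add: Tr_minus)

lemmas Tr_linear = Tr_add Tr_diff Tr_scale Tr_minus

lemma Tr_unit: "Tr J (junit J) = real (jrank J)"
proof -
  obtain Q where Q: "jordan_frame J Q" using frame_exists .
  show ?thesis
    using Tr_eqI[of "junit J" Q "\<lambda>_. 1"] Q frameD(5)[OF Q]
    by (simp add: spectral_decomp_def jrank_eq_card[OF Q])
qed

text \<open>
  By \<open>sum_eigenvalues_eq_aip\<close> the frame for the trace vector may be chosen as one that
  diagonalises \<open>y\<close>, and the members of a frame commute as operators.
\<close>

lemma op_commute_trace_vector:
  assumes "spectral_decomp J y Q \<mu>"
  shows "op_commute y (trace_vector Q)"
proof -
  have Q: "jordan_frame J Q" and y: "y = (\<Sum>q\<in>Q. \<mu> q *\<^sub>R q)" using assms by (auto simp: spectral_decomp_def)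
  note Qd = frameD[OF Q]
  have pq: "op_commute p q" if "p \<in> Q" "q \<in> Q" for p q
    using orthogonal_idempotents_commute[of p q] op_commute_refl[of p] primitiveD[OF Qd(2)] Qd that
    by (cases "p = q") auto
  have "op_commute q y" if "q \<in> Q" for q
    unfolding y using that Qd pq by (intro op_commute_sum op_commute_scale) auto
  moreover have "y \<in> carr J" unfolding y using Q by (rule frame_closed)
  ultimately show ?thesis
    unfolding trace_vector_def using Qd by (intro op_commute_sum op_commute_scale) (auto simp: op_commute_sym)
qed

abbreviation ti :: "'a \<Rightarrow> 'a \<Rightarrow> real" where "ti \<equiv> trace_inner J"

lemma trace_inner_commute: "x \<in> carr J \<Longrightarrow> y \<in> carr J \<Longrightarrow> ti x y = ti y x"
  by (simp add: trace_inner_def mult_commute)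

lemma trace_inner_add_left: "x \<in> carr J \<Longrightarrow> y \<in> carr J \<Longrightarrow> z \<in> carr J \<Longrightarrow> ti (x + y) z = ti x z + ti y z"
  by (simp add: trace_inner_def mult_linear Tr_linear)

lemma trace_inner_add_right: "x \<in> carr J \<Longrightarrow> y \<in> carr J \<Longrightarrow> z \<in> carr J \<Longrightarrow> ti z (x + y) = ti z x + ti z y"
  by (simp add: trace_inner_def mult_linear Tr_linear)

lemma trace_inner_diff_left: "x \<in> carr J \<Longrightarrow> y \<in> carr J \<Longrightarrow> z \<in> carr J \<Longrightarrow> ti (x - y) z = ti x z - ti y z"
  by (simp add: trace_inner_def mult_linear Tr_linear)

lemma trace_inner_diff_right: "x \<in> carr J \<Longrightarrow> y \<in> carr J \<Longrightarrow> z \<in> carr J \<Longrightarrow> ti z (x - y) = ti z x - ti z y"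
  by (simp add: trace_inner_def mult_linear Tr_linear)

lemma trace_inner_scale_left: "x \<in> carr J \<Longrightarrow> z \<in> carr J \<Longrightarrow> ti (c *\<^sub>R x) z = c * ti x z"
  by (simp add: trace_inner_def mult_linear Tr_linear)

lemma trace_inner_scale_right: "x \<in> carr J \<Longrightarrow> z \<in> carr J \<Longrightarrow> ti z (c *\<^sub>R x) = c * ti z x"
  by (simp add: trace_inner_def mult_linear Tr_linear)

lemma trace_inner_minus_left: "x \<in> carr J \<Longrightarrow> z \<in> carr J \<Longrightarrow> ti (- x) z = - ti x z"
  by (simp add: trace_inner_def mult_linear Tr_linear)

lemma trace_inner_minus_right: "x \<in> carr J \<Longrightarrow> z \<in> carr J \<Longrightarrow> ti z (- x) = - ti z x"
  by (simp add: trace_inner_def mult_linear Tr_linear)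

lemmas trace_inner_linear = trace_inner_add_left trace_inner_add_right trace_inner_diff_left trace_inner_diff_right
  trace_inner_scale_left trace_inner_scale_right trace_inner_minus_left trace_inner_minus_right

lemma trace_inner_zero [simp]: "x \<in> carr J \<Longrightarrow> ti 0 x = 0" "x \<in> carr J \<Longrightarrow> ti x 0 = 0"
  using trace_inner_scale_left[of 0 x 0] trace_inner_scale_right[of 0 x 0] by simp_all

lemma trace_inner_sum_left:
  "\<lbrakk>\<And>i. i \<in> I \<Longrightarrow> f i \<in> carr J; z \<in> carr J\<rbrakk> \<Longrightarrow> ti (\<Sum>i\<in>I. f i) z = (\<Sum>i\<in>I. ti (f i) z)"
  by (induction I rule: infinite_finite_induct) (auto simp: trace_inner_linear)

lemma trace_inner_sum_right:
  "\<lbrakk>\<And>i. i \<in> I \<Longrightarrow> f i \<in> carr J; z \<in> carr J\<rbrakk> \<Longrightarrow> ti z (\<Sum>i\<in>I. f i) = (\<Sum>i\<in>I. ti z (f i))"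
  by (induction I rule: infinite_finite_induct) (auto simp: trace_inner_linear)

lemma trace_inner_unit: "x \<in> carr J \<Longrightarrow> ti x (junit J) = Tr J x" "x \<in> carr J \<Longrightarrow> ti (junit J) x = Tr J x"
  by (simp_all add: trace_inner_def)

text \<open>
  Associativity passes from \<open>aip\<close> to the trace form because the representing element commutes
  with \<open>y\<close>.
\<close>

lemma trace_inner_assoc:
  assumes "x \<in> carr J" "y \<in> carr J" "z \<in> carr J"
  shows "ti (x \<circ> y) z = ti x (y \<circ> z)"
proof -
  obtain Q \<mu> where y: "spectral_decomp J y Q \<mu>" using spectral_theorem[OF assms(2)] .
  then have Q: "jordan_frame J Q" by (simp add: spectral_decomp_def)
  let ?g = "trace_vector Q"
  have g: "?g \<in> carr J" using trace_vector_closed[OF Q] .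
  have "ti (x \<circ> y) z = aip x (y \<circ> (?g \<circ> z))"
    using assms g mult_commute[of z ?g] by (simp add: trace_inner_def Tr_eq_aip[OF _ Q] aip_assoc)
  also have "\<dots> = aip x ((y \<circ> z) \<circ> ?g)"
    using op_commuteD[OF op_commute_trace_vector[OF y] assms(3)] assms g
      mult_commute[of ?g "y \<circ> z"] by simp
  also have "\<dots> = ti x (y \<circ> z)"
    using assms g by (simp add: trace_inner_def Tr_eq_aip[OF _ Q] aip_assoc)
  finally show ?thesis .
qed

text \<open>
  Extend \<open>p\<close> to a frame; the other members are annihilated by \<open>p\<close>.
\<close>

lemma trace_inner_primitive:
  assumes p: "primitive_idempotent J p" and z: "z \<in> carr J"
  shows "ti p z = aip p z / aip p p"
proof -
  note pd = primitiveD[OF p]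
  have "idempotent J (junit J - p)" using idempotent_diff[OF idempotent_unit pd(1)] pd by simp
  then obtain S where S: "orthogonal_idempotents S" "\<And>s. s \<in> S \<Longrightarrow> primitive_idempotent J s"
    "\<Sum>S = junit J - p" using primitive_refinement by blast
  have fin: "finite S" using S by (simp add: orthogonal_idempotents_def)
  have Sc: "s \<in> carr J" if "s \<in> S" for s using S(2) primitiveD that by blast
  have "aip p (junit J - p) = 0"
    using pd by (intro orthogonal_idempotents_aip) (auto simp: mult_linear)
  then have "(\<Sum>s\<in>S. aip p s) = 0" unfolding S(3)[symmetric] using pd Sc by (simp add: aip_sum_right)
  then have "aip p s = 0" if "s \<in> S" for s
    using that fin aip_idempotent_nonneg(1)[OF pd(1)] primitiveD(1)[OF S(2)]
    by (subst (asm) sum_nonneg_eq_0_iff) auto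
  then have o: "p \<circ> s = 0" if "s \<in> S" for s
    using that aip_idempotent_nonneg(2)[OF pd(1)] primitiveD(1)[OF S(2)] by blast
  then have o': "s \<circ> p = 0" if "s \<in> S" for s
    using that mult_commute[of s p] Sc pd by simp
  have nin: "p \<notin> S" using o pd by force
  have Q: "jordan_frame J (insert p S)"
    unfolding jordan_frame_def using p S o o' fin nin by (auto simp: orthogonal_idempotents_def)
  let ?g = "trace_vector (insert p S)"
  have "p \<circ> ?g = (1 / aip p p) *\<^sub>R p"
  proof -
    have "p \<circ> ?g = (\<Sum>q\<in>insert p S. (1 / aip q q) *\<^sub>R (p \<circ> q))"
      unfolding trace_vector_def using frameD(3)[OF Q] pd by (subst mult_sum_right) (auto simp: mult_linear)
    also have "\<dots> = (1 / aip p p) *\<^sub>R p" using o fin nin pd by simp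
    finally show ?thesis .
  qed
  moreover have "ti p z = aip z (p \<circ> ?g)"
    using pd z trace_vector_closed[OF Q] by (simp add: trace_inner_def Tr_eq_aip[OF _ Q] aip_assoc')
  ultimately show ?thesis using pd z aip_commute[of p z] by (simp add: aip_linear)
qed

lemma trace_inner_primitive_square_nonneg:
  assumes p: "primitive_idempotent J p" and w: "w \<in> carr J"
  shows "ti p (w \<circ> w) \<ge> 0"
proof -
  note pd = primitiveD[OF p]
  have "aip p (w \<circ> w) = aip (p \<circ> w) w" using pd w by (simp add: aip_assoc)
  also have "\<dots> \<ge> 0" unfolding aip_idempotent_expand[OF pd(1) w] using pd w by (simp add: aip_nonneg)
  finally show ?thesis using trace_inner_primitive[OF p] w pd by simp
qed

lemma trace_inner_primitive_nonneg:
  assumes "primitive_idempotent J p" "primitive_idempotent J q"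
  shows "ti p q \<ge> 0"
  using trace_inner_primitive_square_nonneg[OF assms(1), of q] primitiveD[OF assms(2)] by simp

lemma Tr_primitive:
  assumes p: "primitive_idempotent J p"
  shows "Tr J p = 1" "ti p p = 1"
proof -
  show "ti p p = 1" using trace_inner_primitive[OF p] primitiveD[OF p] by simp
  then show "Tr J p = 1" using primitiveD[OF p] by (simp add: trace_inner_def)
qed

section \<open>Exponential and cone\<close>

lemma frame_eigen:
  assumes "spectral_decomp J x P \<nu>" "p \<in> P"
  shows "x \<circ> p = \<nu> p *\<^sub>R p"
proof -
  have P: "jordan_frame J P" and xP: "x = (\<Sum>p\<in>P. \<nu> p *\<^sub>R p)" using assms by (auto simp: spectral_decomp_def)
  note Pd = frameD[OF P]
  have "p = (\<Sum>q\<in>P. (if q = p then 1 else 0) *\<^sub>R q)"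
    using Pd(1) assms(2) by (simp add: if_distrib[of "\<lambda>c. c *\<^sub>R _"] cong: if_cong)
  then have "x \<circ> p = (\<Sum>q\<in>P. (\<nu> q * (if q = p then 1 else 0)) *\<^sub>R q)"
    using frame_mult[OF P, of \<nu> "\<lambda>q. if q = p then 1 else 0"] xP by metis
  also have "\<dots> = \<nu> p *\<^sub>R p"
    using Pd(1) assms(2) by (simp add: if_distrib[of "\<lambda>c. c *\<^sub>R _"] if_distrib[of "\<lambda>c. _ * c"] cong: if_cong)
  finally show ?thesis .
qed

lemma spectral_closed: "spectral_decomp J x P \<nu> \<Longrightarrow> x \<in> carr J"
  using frame_closed by (auto simp: spectral_decomp_def)

lemma trace_inner_frame_eigen:
  assumes "spectral_decomp J x P \<nu>" "p \<in> P"
  shows "ti p x = \<nu> p"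
proof -
  have p: "primitive_idempotent J p" using assms frameD(2) by (auto simp: spectral_decomp_def)
  have "ti p x = Tr J (x \<circ> p)"
    using primitiveD(2)[OF p] spectral_closed[OF assms(1)] mult_commute[of p x] by (simp add: trace_inner_def)
  then show ?thesis
    using frame_eigen[OF assms] Tr_scale[of p "\<nu> p"] Tr_primitive[OF p] primitiveD(2)[OF p] by simp
qed

text \<open>
  Both eigenvalue equations, joined by associativity of the trace form.
\<close>

lemma eigenvalues_agree:
  assumes "spectral_decomp J x P \<nu>" "spectral_decomp J x Q \<mu>" "p \<in> P" "q \<in> Q" "ti p q \<noteq> 0"
  shows "\<nu> p = \<mu> q"
proof -
  have c: "p \<in> carr J" "q \<in> carr J" "x \<in> carr J"
    using assms frameD(3) spectral_closed by (auto simp: spectral_decomp_def)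
  have "ti (p \<circ> x) q = ti p (x \<circ> q)" using c by (simp add: trace_inner_assoc)
  then have "ti (\<nu> p *\<^sub>R p) q = ti p (\<mu> q *\<^sub>R q)"
    using frame_eigen[OF assms(1,3)] frame_eigen[OF assms(2,4)] c mult_commute[of p x] by simp
  then show ?thesis using c assms(5) by (simp add: trace_inner_linear)
qed

lemma trace_inner_frame_sum:
  assumes "jordan_frame J Q" "x \<in> carr J"
  shows "(\<Sum>q\<in>Q. ti x q) = Tr J x" "(\<Sum>q\<in>Q. ti q x) = Tr J x"
proof -
  note Qd = frameD[OF assms(1)]
  show "(\<Sum>q\<in>Q. ti x q) = Tr J x"
    using Qd assms trace_inner_sum_right[of Q "\<lambda>q. q" x] by (simp add: trace_inner_unit)
  then show "(\<Sum>q\<in>Q. ti q x) = Tr J x"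
    using Qd(3) assms(2) trace_inner_commute by (metis (no_types, lifting) sum.cong)
qed

lemma Tr_frame_sum:
  assumes "jordan_frame J Q"
  shows "Tr J (\<Sum>q\<in>Q. f q *\<^sub>R q) = (\<Sum>q\<in>Q. f q)"
  using Tr_eqI[of "\<Sum>q\<in>Q. f q *\<^sub>R q" Q f] assms by (simp add: spectral_decomp_def)

lemma trace_inner_self_spectral:
  assumes "spectral_decomp J x Q \<mu>"
  shows "ti x x = (\<Sum>q\<in>Q. (\<mu> q)\<^sup>2)"
proof -
  have Q: "jordan_frame J Q" and x: "x = (\<Sum>p\<in>Q. \<mu> p *\<^sub>R p)" using assms by (auto simp: spectral_decomp_def)
  show ?thesis unfolding trace_inner_def x frame_mult[OF Q] Tr_frame_sum[OF Q] by (simp add: power2_eq_square)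
qed

lemma trace_inner_nonneg: "x \<in> carr J \<Longrightarrow> ti x x \<ge> 0"
  using spectral_theorem trace_inner_self_spectral by (metis sum_nonneg zero_le_power2)

lemma trace_inner_definite:
  assumes "x \<in> carr J" "ti x x = 0"
  shows "x = 0"
proof -
  obtain Q \<mu> where Q: "spectral_decomp J x Q \<mu>" using spectral_theorem[OF assms(1)] .
  then have "finite Q" using frameD(1) by (auto simp: spectral_decomp_def)
  then have "\<forall>q\<in>Q. \<mu> q = 0"
    using trace_inner_self_spectral[OF Q] assms(2) by (simp add: sum_nonneg_eq_0_iff)
  then show ?thesis using Q by (simp add: spectral_decomp_def)
qed

text \<open>
  By \<open>eigenvalues_agree\<close>, both sums have inner product \<open>f (\<nu> p)\<close> with each \<open>p\<close> and \<open>f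
  (\<mu> q)\<close> with each \<open>q\<close>, so that their difference is orthogonal to both of them.
\<close>

lemma functional_calculus_unique:
  assumes x: "spectral_decomp J x P \<nu>" "spectral_decomp J x Q \<mu>"
  shows "(\<Sum>p\<in>P. f (\<nu> p) *\<^sub>R p) = (\<Sum>q\<in>Q. f (\<mu> q) *\<^sub>R q)"
proof -
  have ex: "ti p (\<Sum>q\<in>Q. f (\<mu> q) *\<^sub>R q) = f (\<nu> p)"
    if "spectral_decomp J x P \<nu>" "spectral_decomp J x Q \<mu>" "p \<in> P" for P Q \<nu> \<mu> p
  proof -
    have P: "jordan_frame J P" and Q: "jordan_frame J Q" using that by (auto simp: spectral_decomp_def)
    have p: "primitive_idempotent J p" "p \<in> carr J" using frameD[OF P] that by auto
    note Qd = frameD[OF Q]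
    have "ti p (\<Sum>q\<in>Q. f (\<mu> q) *\<^sub>R q) = (\<Sum>q\<in>Q. f (\<mu> q) * ti p q)"
      using Qd p by (subst trace_inner_sum_right) (auto simp: trace_inner_linear)
    also have "\<dots> = (\<Sum>q\<in>Q. f (\<nu> p) * ti p q)"
    proof (rule sum.cong[OF refl])
      fix q assume "q \<in> Q"
      then show "f (\<mu> q) * ti p q = f (\<nu> p) * ti p q"
        using eigenvalues_agree[OF that(1,2,3)] by (cases "ti p q = 0") auto
    qed
    also have "\<dots> = f (\<nu> p)"
      using trace_inner_frame_sum(1)[OF Q p(2)] Tr_primitive[OF p(1)] by (simp add: sum_distrib_left[symmetric])
    finally show ?thesis .
  qed
  have P: "jordan_frame J P" and Q: "jordan_frame J Q" using x by (auto simp: spectral_decomp_def)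
  let ?u = "\<Sum>p\<in>P. f (\<nu> p) *\<^sub>R p" and ?v = "\<Sum>q\<in>Q. f (\<mu> q) *\<^sub>R q"
  have uv: "?u \<in> carr J" "?v \<in> carr J" using frame_closed P Q by auto
  have dP: "ti p (?u - ?v) = 0" if "p \<in> P" for p
    using ex[OF x(1,1) that] ex[OF x(1,2) that] uv frameD(3)[OF P that] by (simp add: trace_inner_linear)
  have dQ: "ti q (?u - ?v) = 0" if "q \<in> Q" for q
    using ex[OF x(2,1) that] ex[OF x(2,2) that] uv frameD(3)[OF Q that] by (simp add: trace_inner_linear)
  have "ti ?u (?u - ?v) = 0"
    using uv frameD(3)[OF P] dP by (subst trace_inner_sum_left) (auto simp: trace_inner_scale_left intro!: sum.neutral)
  moreover have "ti ?v (?u - ?v) = 0"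
    using uv frameD(3)[OF Q] dQ by (subst trace_inner_sum_left) (auto simp: trace_inner_scale_left intro!: sum.neutral)
  ultimately have "ti (?u - ?v) (?u - ?v) = 0" using uv trace_inner_diff_left[of ?u ?v "?u - ?v"] by simp
  then show ?thesis using trace_inner_definite[of "?u - ?v"] uv by simp
qed

lemma jexp_eqI:
  assumes "spectral_decomp J x P \<nu>"
  shows "jexp J x = (\<Sum>p\<in>P. exp (\<nu> p) *\<^sub>R p)"
  unfolding jexp_def
proof (rule the_equality)
  fix y assume "\<exists>Q \<mu>. spectral_decomp J x Q \<mu> \<and> y = (\<Sum>q\<in>Q. exp (\<mu> q) *\<^sub>R q)"
  then show "y = (\<Sum>p\<in>P. exp (\<nu> p) *\<^sub>R p)" using functional_calculus_unique[OF assms, of _ _ exp] by metis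
qed (use assms in blast)

lemma jexp_closed [simp]:
  assumes "x \<in> carr J"
  shows "jexp J x \<in> carr J"
proof -
  obtain P \<nu> where P: "spectral_decomp J x P \<nu>" using spectral_theorem[OF assms] .
  then have F: "jordan_frame J P" by (simp add: spectral_decomp_def)
  show ?thesis unfolding jexp_eqI[OF P] by (rule frame_closed[OF F])
qed

lemma spectral_scale:
  "spectral_decomp J x P \<nu> \<Longrightarrow> spectral_decomp J (c *\<^sub>R x) P (\<lambda>p. c * \<nu> p)"
  by (simp add: spectral_decomp_def scaleR_sum_right)

lemma jexp_half_square:
  assumes "x \<in> carr J"
  shows "jexp J ((1/2) *\<^sub>R x) \<circ> jexp J ((1/2) *\<^sub>R x) = jexp J x"
proof -
  obtain P \<nu> where P: "spectral_decomp J x P \<nu>" using spectral_theorem[OF assms] .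
  have F: "jordan_frame J P" using P by (simp add: spectral_decomp_def)
  show ?thesis
    by (simp add: jexp_eqI[OF P] jexp_eqI[OF spectral_scale[OF P]] frame_mult[OF F] exp_add[symmetric])
qed

lemma jexp_shift:
  assumes "x \<in> carr J"
  shows "jexp J (x + s *\<^sub>R junit J) = exp s *\<^sub>R jexp J x"
proof -
  obtain P \<nu> where P: "spectral_decomp J x P \<nu>" using spectral_theorem[OF assms] .
  have F: "jordan_frame J P" using P by (simp add: spectral_decomp_def)
  have "spectral_decomp J (x + s *\<^sub>R junit J) P (\<lambda>p. \<nu> p + s)"
    using P unfolding spectral_decomp_def
    by (simp add: scaleR_add_left sum.distrib scaleR_sum_right frameD(5)[OF F, symmetric])
  then show ?thesis
    by (simp add: jexp_eqI[OF P] jexp_eqI exp_add scaleR_sum_right mult.commute)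
qed

lemma Tr_jexp_pos:
  assumes "jrank J \<ge> 1" "x \<in> carr J"
  shows "Tr J (jexp J x) > 0"
proof -
  obtain P \<nu> where P: "spectral_decomp J x P \<nu>" using spectral_theorem[OF assms(2)] .
  have F: "jordan_frame J P" using P by (simp add: spectral_decomp_def)
  have "P \<noteq> {}" "finite P" using assms(1) jrank_eq_card[OF F] frameD(1)[OF F] by auto
  then show ?thesis by (simp add: jexp_eqI[OF P] Tr_frame_sum[OF F] sum_pos)
qed

lemma cone_closed: "x \<in> cone_of_squares J \<Longrightarrow> x \<in> carr J"
  by (auto simp: cone_of_squares_def)

lemma spectral_nonneg_cone:
  assumes "spectral_decomp J x Q \<mu>" "\<And>q. q \<in> Q \<Longrightarrow> \<mu> q \<ge> 0"
  shows "x \<in> cone_of_squares J"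
proof -
  have Q: "jordan_frame J Q" and x: "x = (\<Sum>q\<in>Q. \<mu> q *\<^sub>R q)" using assms by (auto simp: spectral_decomp_def)
  let ?y = "\<Sum>q\<in>Q. sqrt (\<mu> q) *\<^sub>R q"
  have "?y \<circ> ?y = x" unfolding frame_mult[OF Q] x using assms(2) by (intro sum.cong) auto
  moreover have "?y \<in> carr J" using frame_closed[OF Q] .
  ultimately show ?thesis unfolding cone_of_squares_def by fastforce
qed

text \<open>
  Self-duality of the cone turns membership into linear inequalities, which gives closure under
  sums at once.
\<close>

lemma cone_self_dual:
  "x \<in> cone_of_squares J \<longleftrightarrow> x \<in> carr J \<and> (\<forall>p. primitive_idempotent J p \<longrightarrow> ti p x \<ge> 0)"
proof
  assume "x \<in> cone_of_squares J"
  then show "x \<in> carr J \<and> (\<forall>p. primitive_idempotent J p \<longrightarrow> ti p x \<ge> 0)"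
    using trace_inner_primitive_square_nonneg by (auto simp: cone_of_squares_def)
next
  assume x: "x \<in> carr J \<and> (\<forall>p. primitive_idempotent J p \<longrightarrow> ti p x \<ge> 0)"
  then obtain Q \<mu> where Q: "spectral_decomp J x Q \<mu>" using spectral_theorem by blast
  have F: "jordan_frame J Q" using Q by (simp add: spectral_decomp_def)
  show "x \<in> cone_of_squares J"
    by (rule spectral_nonneg_cone[OF Q]) (use x trace_inner_frame_eigen[OF Q] frameD(2)[OF F] in metis)
qed

lemma cone_add: "x \<in> cone_of_squares J \<Longrightarrow> y \<in> cone_of_squares J \<Longrightarrow> x + y \<in> cone_of_squares J"
  unfolding cone_self_dual using primitiveD(2) by (auto simp: trace_inner_linear)

lemma cone_scale: "x \<in> cone_of_squares J \<Longrightarrow> c \<ge> 0 \<Longrightarrow> c *\<^sub>R x \<in> cone_of_squares J"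
  unfolding cone_self_dual using primitiveD(2) by (auto simp: trace_inner_linear)

lemma jexp_cone: "x \<in> carr J \<Longrightarrow> jexp J x \<in> cone_of_squares J"
proof -
  assume x: "x \<in> carr J"
  obtain P \<nu> where P: "spectral_decomp J x P \<nu>" using spectral_theorem[OF x] .
  then have "spectral_decomp J (jexp J x) P (\<lambda>p. exp (\<nu> p))"
    using jexp_eqI[OF P] by (simp only: spectral_decomp_def)
  then show ?thesis by (rule spectral_nonneg_cone) simp
qed

definition density_element :: "'a \<Rightarrow> bool" where
  "density_element x \<longleftrightarrow> x \<in> cone_of_squares J \<and> Tr J x = 1"

lemma density_closed: "density_element x \<Longrightarrow> x \<in> carr J"
  by (simp add: density_element_def cone_closed)

text \<open>
  The order interval \<open>- s e \<le> l \<le> s e\<close> for the unit \<open>e\<close>, expressed by pairing with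
  primitive idempotents. It covers both constraint elements, through their eigenvalues, and
  noise, through its norm.
\<close>

definition spectral_bound :: "'a \<Rightarrow> real \<Rightarrow> bool" where
  "spectral_bound l s \<longleftrightarrow> l \<in> carr J \<and> (\<forall>q. primitive_idempotent J q \<longrightarrow> \<bar>ti l q\<bar> \<le> s)"

lemma spectral_bound_square:
  assumes "spectral_bound l s" "w \<in> carr J"
  shows "\<bar>ti l (w \<circ> w)\<bar> \<le> s * ti w w"
proof -
  obtain Q \<mu> where Q: "spectral_decomp J w Q \<mu>" using spectral_theorem[OF assms(2)] .
  have F: "jordan_frame J Q" and w: "w = (\<Sum>q\<in>Q. \<mu> q *\<^sub>R q)" using Q by (auto simp: spectral_decomp_def)
  have l: "l \<in> carr J" using assms by (simp add: spectral_bound_def)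
  have "ti l (w \<circ> w) = (\<Sum>q\<in>Q. (\<mu> q)\<^sup>2 * ti l q)"
    unfolding w frame_mult[OF F] using frameD(3)[OF F] l
    by (subst trace_inner_sum_right) (auto simp: trace_inner_linear power2_eq_square)
  also have "\<bar>\<dots>\<bar> \<le> (\<Sum>q\<in>Q. (\<mu> q)\<^sup>2 * s)"
    using assms(1) frameD(2)[OF F] unfolding spectral_bound_def
    by (intro order.trans[OF sum_abs] sum_mono) (auto simp: abs_mult intro!: mult_left_mono)
  also have "\<dots> = s * ti w w" by (simp add: trace_inner_self_spectral[OF Q] sum_distrib_left mult.commute)
  finally show ?thesis .
qed

lemma spectral_bound_density:
  assumes "spectral_bound l s" "density_element x"
  shows "\<bar>ti l x\<bar> \<le> s"
proof -
  obtain w where w: "w \<in> carr J" "x = w \<circ> w" using assms(2) by (auto simp: density_element_def cone_of_squares_def)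
  have "ti w w = 1" using w assms(2) by (simp add: density_element_def trace_inner_def)
  then show ?thesis using spectral_bound_square[OF assms(1) w(1)] w(2) by simp
qed

lemma spectral_boundI:
  assumes "spectral_decomp J a P \<nu>" "\<And>p. p \<in> P \<Longrightarrow> \<bar>\<nu> p\<bar> \<le> s"
  shows "spectral_bound a s"
  unfolding spectral_bound_def
proof (intro conjI allI impI)
  show "a \<in> carr J" using spectral_closed[OF assms(1)] .
  fix q assume q: "primitive_idempotent J q"
  have F: "jordan_frame J P" and a: "a = (\<Sum>q\<in>P. \<nu> q *\<^sub>R q)" using assms by (auto simp: spectral_decomp_def)
  have qc: "q \<in> carr J" using primitiveD[OF q] by simp
  have "ti a q = (\<Sum>p\<in>P. \<nu> p * ti p q)"
    unfolding a using frameD(3)[OF F] qc by (subst trace_inner_sum_left) (auto simp: trace_inner_linear)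
  also have "\<bar>\<dots>\<bar> \<le> (\<Sum>p\<in>P. s * ti p q)"
    using assms(2) trace_inner_primitive_nonneg[OF frameD(2)[OF F] q]
    by (intro order.trans[OF sum_abs] sum_mono) (auto simp: abs_mult intro!: mult_right_mono)
  also have "\<dots> = s" using trace_inner_frame_sum(2)[OF F qc] Tr_primitive[OF q] by (simp add: sum_distrib_left[symmetric])
  finally show "\<bar>ti a q\<bar> \<le> s" .
qed

text \<open>
  The Cauchy-Schwarz inequality, with \<open>ti q q = 1\<close>.
\<close>

lemma spectral_bound_norm:
  assumes z: "z \<in> carr J" and "ti z z \<le> s\<^sup>2" "s \<ge> 0"
  shows "spectral_bound z s"
  unfolding spectral_bound_def
proof (intro conjI allI impI z)
  fix q assume q: "primitive_idempotent J q"
  have qc: "q \<in> carr J" using primitiveD[OF q] by simp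
  define t where "t = ti z q"
  have "ti (z - t *\<^sub>R q) (z - t *\<^sub>R q) \<ge> 0" using z qc by (simp add: trace_inner_nonneg)
  also have "ti (z - t *\<^sub>R q) (z - t *\<^sub>R q) = ti z z - t\<^sup>2"
    using z qc trace_inner_commute[of q z] Tr_primitive[OF q]
    by (simp add: trace_inner_linear t_def[symmetric] power2_eq_square algebra_simps)
  finally have "t\<^sup>2 \<le> s\<^sup>2" using assms by simp
  then show "\<bar>ti z q\<bar> \<le> s" using assms(3) unfolding t_def by (simp add: abs_le_square_iff[symmetric])
qed

lemma spectral_bound_half_sum:
  assumes "spectral_bound a 1" "spectral_bound z 1"
  shows "spectral_bound ((1/2) *\<^sub>R (a + z)) 1"
  using assms primitiveD(2) unfolding spectral_bound_def
  by (auto simp: trace_inner_linear abs_le_iff field_simps) (smt (verit))+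

section \<open>Regret of multiplicative weights\<close>

text \<open>
  The right-hand side is the (unnormalised) relative entropy of \<open>exp a\<close> and \<open>exp b\<close>, the
  left-hand side the squared distance of their square roots. After expansion in two frames both
  sides are averages with the nonnegative weights \<open>ti p q\<close>, whose row and column sums are 1;
  the claim reduces to \<open>1 + s \<le> exp s\<close> for \<open>s = (\<beta> - \<alpha>) / 2\<close>.
\<close>

lemma klein_hellinger:
  assumes a: "a \<in> carr J" and b: "b \<in> carr J"
  shows "ti (jexp J ((1/2) *\<^sub>R a) - jexp J ((1/2) *\<^sub>R b)) (jexp J ((1/2) *\<^sub>R a) - jexp J ((1/2) *\<^sub>R b))
     \<le> ti (jexp J a) (a - b) - Tr J (jexp J a) + Tr J (jexp J b)"
proof -
  obtain P \<alpha> where Pa: "spectral_decomp J a P \<alpha>" using spectral_theorem[OF a] .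
  obtain Q \<beta> where Qb: "spectral_decomp J b Q \<beta>" using spectral_theorem[OF b] .
  have P: "jordan_frame J P" and aP: "a = (\<Sum>p\<in>P. \<alpha> p *\<^sub>R p)" using Pa by (auto simp: spectral_decomp_def)
  have Q: "jordan_frame J Q" and bQ: "b = (\<Sum>q\<in>Q. \<beta> q *\<^sub>R q)" using Qb by (auto simp: spectral_decomp_def)
  note Pd = frameD[OF P] and Qd = frameD[OF Q]
  let ?X = "jexp J ((1/2) *\<^sub>R a)" and ?Y = "jexp J ((1/2) *\<^sub>R b)"
  let ?h = "\<lambda>p q. exp (\<alpha> p) * \<alpha> p - exp (\<alpha> p) * \<beta> q - 2 * exp (\<alpha> p)
      + 2 * (exp (1/2 * \<alpha> p) * exp (1/2 * \<beta> q))"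
  have mixed: "ti (\<Sum>p\<in>P. f p *\<^sub>R p) (\<Sum>q\<in>Q. g q *\<^sub>R q) = (\<Sum>p\<in>P. \<Sum>q\<in>Q. f p * g q * ti p q)" for f g
    using Pd(3) Qd(3) frame_closed[OF Q]
    by (subst trace_inner_sum_left) (auto simp: trace_inner_linear trace_inner_sum_right sum_distrib_left mult.assoc intro!: sum.cong)
  have left: "(\<Sum>p\<in>P. f p) = (\<Sum>p\<in>P. \<Sum>q\<in>Q. f p * ti p q)" for f
    using trace_inner_frame_sum(1)[OF Q Pd(3)] Tr_primitive(1)[OF Pd(2)] by (simp add: sum_distrib_left[symmetric])
  have c: "?X \<in> carr J" "?Y \<in> carr J" using a b by auto
  have "ti (?X - ?Y) (?X - ?Y) = Tr J (jexp J a) - 2 * ti ?X ?Y + Tr J (jexp J b)"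
    using c trace_inner_commute[of ?X ?Y] jexp_half_square[OF a] jexp_half_square[OF b]
    by (simp add: trace_inner_linear) (simp add: trace_inner_def)
  moreover have "ti (jexp J a) (a - b) = (\<Sum>p\<in>P. exp (\<alpha> p) * \<alpha> p) - ti (jexp J a) b"
    using a b by (simp add: trace_inner_linear) (simp add: trace_inner_def aP jexp_eqI[OF Pa[unfolded aP]] frame_mult[OF P] Tr_frame_sum[OF P])
  moreover have "0 \<le> (\<Sum>p\<in>P. \<Sum>q\<in>Q. ?h p q * ti p q)"
  proof (intro sum_nonneg mult_nonneg_nonneg trace_inner_primitive_nonneg[OF Pd(2) Qd(2)])
    fix p q
    let ?s = "(\<beta> q - \<alpha> p) / 2"
    have "0 \<le> exp (\<alpha> p) * (2 * (exp ?s - 1 - ?s))"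
      using exp_ge_add_one_self[of ?s] by (intro mult_nonneg_nonneg; (linarith | simp))
    also have "exp (\<alpha> p) * (2 * (exp ?s - 1 - ?s)) = 2 * (exp (\<alpha> p) * exp ?s) - 2 * exp (\<alpha> p) - exp (\<alpha> p) * (\<beta> q - \<alpha> p)"
      by (simp add: algebra_simps diff_divide_distrib)
    also have "exp (\<alpha> p) * exp ?s = exp (1/2 * \<alpha> p) * exp (1/2 * \<beta> q)"
      unfolding exp_add[symmetric] by (simp add: field_simps)
    finally show "0 \<le> ?h p q" by (simp add: algebra_simps)
  qed
  moreover have "(\<Sum>p\<in>P. \<Sum>q\<in>Q. ?h p q * ti p q)
    = (\<Sum>p\<in>P. exp (\<alpha> p) * \<alpha> p) - ti (jexp J a) b - 2 * Tr J (jexp J a) + 2 * ti ?X ?Y"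
    unfolding left[of "\<lambda>p. exp (\<alpha> p) * \<alpha> p"] jexp_eqI[OF Pa] jexp_eqI[OF spectral_scale[OF Pa]]
      jexp_eqI[OF spectral_scale[OF Qb]] Tr_frame_sum[OF P] left[of "\<lambda>p. exp (\<alpha> p)"]
      mixed mixed[of "\<lambda>p. exp (\<alpha> p)" \<beta>, folded bQ]
    by (simp add: algebra_simps sum.distrib sum_subtractf sum_distrib_left)
  ultimately show ?thesis by linarith
qed

definition log_partition :: "'a \<Rightarrow> real" where
  "log_partition v = ln (Tr J (jexp J v))"

definition gibbs :: "'a \<Rightarrow> 'a" where
  "gibbs v = jexp J v /\<^sub>R Tr J (jexp J v)"

lemma gibbs_eq_jexp:
  assumes "jrank J \<ge> 1" "v \<in> carr J"
  shows "gibbs v = jexp J (v - log_partition v *\<^sub>R junit J)"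
  using jexp_shift[OF assms(2), of "- log_partition v"] Tr_jexp_pos[OF assms]
  by (simp add: gibbs_def log_partition_def exp_minus)

lemma gibbs_closed: "v \<in> carr J \<Longrightarrow> gibbs v \<in> carr J"
  by (simp add: gibbs_def)

lemma gibbs_density:
  assumes "jrank J \<ge> 1" "v \<in> carr J"
  shows "density_element (gibbs v)"
  using Tr_jexp_pos[OF assms] jexp_cone[OF assms(2)] assms(2)
  by (simp add: density_element_def gibbs_def cone_scale Tr_scale[of "jexp J v"])

text \<open>
  The Gibbs variational principle without its entropy term: the left-hand side is an average of
  eigenvalues of \<open>v\<close>.
\<close>

lemma log_partition_ge:
  assumes r: "jrank J \<ge> 1" and v: "v \<in> carr J" and x: "density_element x"
  shows "ti v x \<le> log_partition v"
proof -
  obtain P \<nu> where Pv: "spectral_decomp J v P \<nu>" using spectral_theorem[OF v] .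
  have P: "jordan_frame J P" and vP: "v = (\<Sum>p\<in>P. \<nu> p *\<^sub>R p)" using Pv by (auto simp: spectral_decomp_def)
  note Pd = frameD[OF P]
  have xc: "x \<in> carr J" using density_closed[OF x] .
  have T: "Tr J (jexp J v) = (\<Sum>p\<in>P. exp (\<nu> p))" by (simp add: jexp_eqI[OF Pv] Tr_frame_sum[OF P])
  have le: "\<nu> p \<le> log_partition v" if "p \<in> P" for p
  proof -
    have "exp (\<nu> p) \<le> Tr J (jexp J v)" unfolding T using Pd(1) that by (intro member_le_sum) auto
    then show ?thesis unfolding log_partition_def using Tr_jexp_pos[OF r v] by (simp add: ln_ge_iff)
  qed
  have "ti v x = (\<Sum>p\<in>P. \<nu> p * ti p x)"
    unfolding vP using Pd xc by (subst trace_inner_sum_left) (auto simp: trace_inner_linear)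
  also have "\<dots> \<le> (\<Sum>p\<in>P. log_partition v * ti p x)"
    using le x Pd(2) by (intro sum_mono mult_right_mono) (auto simp: density_element_def cone_self_dual)
  also have "\<dots> = log_partition v"
    using trace_inner_frame_sum(2)[OF P xc] x by (simp add: sum_distrib_left[symmetric] density_element_def)
  finally show ?thesis .
qed

lemma log_partition_zero: "log_partition 0 = ln (real (jrank J))"
proof -
  obtain Q where Q: "jordan_frame J Q" using frame_exists .
  then have "spectral_decomp J 0 Q (\<lambda>_. 0)" by (simp add: spectral_decomp_def)
  then have "jexp J 0 = junit J" using jexp_eqI frameD(5)[OF Q] by simp
  then show ?thesis by (simp add: log_partition_def Tr_unit)
qed

lemma gibbs_zero: "gibbs 0 = junit J /\<^sub>R real (jrank J)"
proof -
  obtain Q where Q: "jordan_frame J Q" using frame_exists .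
  then have "spectral_decomp J 0 Q (\<lambda>_. 0)" by (simp add: spectral_decomp_def)
  then have "jexp J 0 = junit J" using jexp_eqI frameD(5)[OF Q] by simp
  then show ?thesis by (simp add: gibbs_def Tr_unit)
qed

text \<open>
  Write the product as a difference of squares, \<open>4 D \<circ> S = (c D + S / c)\<^sup>2 - (c D -
  S / c)\<^sup>2\<close>, and bound \<open>l\<close> on each square.
\<close>

lemma spectral_bound_product:
  assumes l: "spectral_bound l 1" and D: "D \<in> carr J" and S: "S \<in> carr J" and "\<eta> > 0"
  shows "\<eta> * ti l (D \<circ> S) \<le> ti D D + \<eta>\<^sup>2 * (ti S S / 4)"
proof -
  \<comment> \<open>the scale at which the coefficient of \<open>ti D D\<close> becomes 1\<close>
  define c where "c = sqrt (2 / \<eta>)"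
  have c: "c > 0" "c * c = 2 / \<eta>" using assms(4) by (auto simp: c_def)
  have lc: "l \<in> carr J" using l by (simp add: spectral_bound_def)
  let ?A = "c *\<^sub>R D + (1/c) *\<^sub>R S" and ?B = "c *\<^sub>R D - (1/c) *\<^sub>R S"
  have AB: "?A \<in> carr J" "?B \<in> carr J" using D S by auto
  have "ti l (?A \<circ> ?A) - ti l (?B \<circ> ?B) = 4 * ti l (D \<circ> S)"
    using D S lc c mult_commute[of S D] by (simp add: mult_linear trace_inner_linear field_simps)
  moreover have "ti ?A ?A + ti ?B ?B = 2 * (c * c * ti D D) + 2 * (ti S S / (c * c))"
    using D S by (simp add: trace_inner_linear algebra_simps)
  moreover have "\<bar>ti l (?A \<circ> ?A)\<bar> \<le> ti ?A ?A" "\<bar>ti l (?B \<circ> ?B)\<bar> \<le> ti ?B ?B"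
    using spectral_bound_square[OF l] AB by (metis mult_1)+
  ultimately have "4 * ti l (D \<circ> S) \<le> 2 * (2 / \<eta> * ti D D) + 2 * (ti S S / (2 / \<eta>))"
    unfolding c(2) by linarith
  from mult_left_mono[OF this, of "\<eta> / 4"]
  have "\<eta> * ti l (D \<circ> S) \<le> \<eta> / 4 * (2 * (2 / \<eta> * ti D D) + 2 * (ti S S / (2 / \<eta>)))"
    using assms(4) by simp
  also have "\<dots> = ti D D + \<eta>\<^sup>2 * (ti S S / 4)"
    using assms(4) by (simp add: field_simps power2_eq_square)
  finally show ?thesis .
qed

text \<open>
  The relative entropy of the new state \<open>y\<close> and the old state \<open>x\<close> equals the decrease of the
  potential minus \<open>\<eta> \<langle>l, y\<rangle>\<close> and is at least \<open>\<parallel>\<surd>x -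
  \<surd>y\<parallel>\<^sup>2\<close>. The same square distance, plus \<open>\<eta>\<^sup>2\<close>, bounds the
  error \<open>\<eta> \<langle>l, x - y\<rangle>\<close> made in replacing \<open>y\<close> by \<open>x\<close>, so that it
  cancels.
\<close>

lemma log_partition_step:
  assumes r: "jrank J \<ge> 1" and v: "v \<in> carr J" and l: "spectral_bound l 1" and \<eta>: "\<eta> > 0"
  shows "log_partition (v - \<eta> *\<^sub>R l) \<le> log_partition v - \<eta> * ti l (gibbs v) + \<eta>\<^sup>2"
proof -
  have lc: "l \<in> carr J" using l by (simp add: spectral_bound_def)
  define v' where "v' = v - \<eta> *\<^sub>R l"
  have v': "v' \<in> carr J" using v lc by (simp add: v'_def)
  \<comment> \<open>the logarithms of the two states; \<open>X\<close> and \<open>Y\<close> below are their square roots\<close>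
  define a b where "a = v' - log_partition v' *\<^sub>R junit J" and "b = v - log_partition v *\<^sub>R junit J"
  have ab: "a \<in> carr J" "b \<in> carr J" using v v' by (simp_all add: a_def b_def)
  define X Y where "X = jexp J ((1/2) *\<^sub>R b)" and "Y = jexp J ((1/2) *\<^sub>R a)"
  have XY: "X \<in> carr J" "Y \<in> carr J" using ab by (simp_all add: X_def Y_def)
  have x: "gibbs v = jexp J b" "gibbs v = X \<circ> X" and y: "gibbs v' = jexp J a" "gibbs v' = Y \<circ> Y"
    using gibbs_eq_jexp[OF r v] gibbs_eq_jexp[OF r v'] jexp_half_square ab
    by (simp_all add: a_def b_def X_def Y_def)
  have d: "Tr J (gibbs v) = 1" "Tr J (gibbs v') = 1"
    using gibbs_density[OF r] v v' by (simp_all add: density_element_def)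
  have c: "gibbs v \<in> carr J" "gibbs v' \<in> carr J" using v v' by (simp_all add: gibbs_closed)
  have n: "ti X X = 1" "ti Y Y = 1" using d x y by (simp_all add: trace_inner_def)
  have "ti (Y - X) (Y - X) \<le> ti (gibbs v') (a - b)"
    using klein_hellinger[OF ab] d unfolding x(1) y(1) X_def Y_def by simp
  also have "a - b = (log_partition v - log_partition v') *\<^sub>R junit J - \<eta> *\<^sub>R l"
    by (simp add: a_def b_def v'_def algebra_simps)
  also have "ti (gibbs v') ((log_partition v - log_partition v') *\<^sub>R junit J - \<eta> *\<^sub>R l)
      = log_partition v - log_partition v' - \<eta> * ti l (gibbs v')"
    using c lc d trace_inner_commute[of l "gibbs v'"] by (simp add: trace_inner_linear trace_inner_unit)
  finally have 1: "ti (Y - X) (Y - X) \<le> log_partition v - log_partition v' - \<eta> * ti l (gibbs v')" .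
  have "gibbs v - gibbs v' = (X - Y) \<circ> (X + Y)"
    unfolding x(2) y(2) using XY mult_commute[of X Y] by (simp add: mult_linear)
  then have "\<eta> * (ti l (gibbs v) - ti l (gibbs v')) \<le> ti (X - Y) (X - Y) + \<eta>\<^sup>2 * (ti (X + Y) (X + Y) / 4)"
    using spectral_bound_product[OF l _ _ \<eta>, of "X - Y" "X + Y"] XY c lc by (simp add: trace_inner_diff_right[symmetric, of "gibbs v" "gibbs v'" l])
  moreover have s: "ti (X + Y) (X + Y) + ti (X - Y) (X - Y) = 4" "ti (Y - X) (Y - X) = ti (X - Y) (X - Y)"
    using XY n by (simp_all add: trace_inner_linear)
  moreover have "\<eta>\<^sup>2 * (ti (X + Y) (X + Y) / 4) \<le> \<eta>\<^sup>2 * 1"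
    using s(1) trace_inner_nonneg[of "X - Y"] XY by (intro mult_left_mono) auto
  ultimately show ?thesis using 1 unfolding v'_def by (simp add: right_diff_distrib)
qed

end

section \<open>Coordinates and measurability\<close>

locale eja_coordinates = euclidean_jordan_algebra J
  for J :: "'a::real_vector jalg" (structure) +
  fixes \<phi> :: "'a \<Rightarrow> nat \<Rightarrow> real"
  assumes isometry: "coordinate_isometry J \<phi>"
begin

abbreviation dimJ :: nat where "dimJ \<equiv> jdim J"
abbreviation algM :: "'a measure" where "algM \<equiv> borel_alg J \<phi>"

lemma phi_bij: "bij_betw \<phi> (carr J) ({..<dimJ} \<rightarrow>\<^sub>E UNIV)"
  using isometry by (simp add: coordinate_isometry_def)

lemma phi_add: "x \<in> carr J \<Longrightarrow> y \<in> carr J \<Longrightarrow> i < dimJ \<Longrightarrow> \<phi> (x + y) i = \<phi> x i + \<phi> y i"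
  using isometry by (simp add: coordinate_isometry_def)

lemma phi_scale: "x \<in> carr J \<Longrightarrow> i < dimJ \<Longrightarrow> \<phi> (c *\<^sub>R x) i = c * \<phi> x i"
  using isometry by (simp add: coordinate_isometry_def)

lemma phi_inner: "x \<in> carr J \<Longrightarrow> y \<in> carr J \<Longrightarrow> ti x y = (\<Sum>i<dimJ. \<phi> x i * \<phi> y i)"
  using isometry by (simp add: coordinate_isometry_def)

lemma phi_zero: "i < dimJ \<Longrightarrow> \<phi> 0 i = 0"
  using phi_scale[of 0 i 0] by simp

lemma phi_sum: "i < dimJ \<Longrightarrow> (\<And>j. j \<in> S \<Longrightarrow> f j \<in> carr J) \<Longrightarrow> \<phi> (\<Sum>j\<in>S. f j) i = (\<Sum>j\<in>S. \<phi> (f j) i)"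
  by (induction S rule: infinite_finite_induct) (auto simp: phi_add phi_zero)

lemma phi_mem: "x \<in> carr J \<Longrightarrow> \<phi> x \<in> {..<dimJ} \<rightarrow>\<^sub>E UNIV"
  using phi_bij by (auto simp: bij_betw_def)

lemma phi_eqI:
  assumes "x \<in> carr J" "y \<in> carr J" "\<And>i. i < dimJ \<Longrightarrow> \<phi> x i = \<phi> y i"
  shows "x = y"
proof -
  have "\<phi> x = \<phi> y" using phi_mem[OF assms(1)] phi_mem[OF assms(2)] assms(3) by (intro PiE_ext) auto
  then show ?thesis using phi_bij assms(1,2) by (auto simp: bij_betw_def inj_on_def)
qed

definition coord_inv :: "(nat \<Rightarrow> real) \<Rightarrow> 'a" where "coord_inv = the_inv_into (carr J) \<phi>"

lemma coord_inv_closed: "v \<in> {..<dimJ} \<rightarrow>\<^sub>E UNIV \<Longrightarrow> coord_inv v \<in> carr J"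
  unfolding coord_inv_def using phi_bij by (auto simp: bij_betw_def intro!: the_inv_into_into)

lemma phi_coord_inv: "v \<in> {..<dimJ} \<rightarrow>\<^sub>E UNIV \<Longrightarrow> \<phi> (coord_inv v) = v"
  unfolding coord_inv_def using phi_bij by (auto simp: bij_betw_def intro!: f_the_inv_into_f)

definition coord_basis :: "nat \<Rightarrow> 'a" where
  "coord_basis i = coord_inv (\<lambda>j\<in>{..<dimJ}. if j = i then 1 else 0)"

lemma coord_basis_closed: "coord_basis i \<in> carr J"
  unfolding coord_basis_def by (rule coord_inv_closed) auto

lemma phi_coord_basis: "j < dimJ \<Longrightarrow> \<phi> (coord_basis i) j = (if j = i then 1 else 0)"
  unfolding coord_basis_def by (subst phi_coord_inv) auto

lemma coord_expand:
  assumes "x \<in> carr J"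
  shows "x = (\<Sum>i<dimJ. \<phi> x i *\<^sub>R coord_basis i)"
proof (rule phi_eqI)
  fix j assume j: "j < dimJ"
  have "\<phi> (\<Sum>i<dimJ. \<phi> x i *\<^sub>R coord_basis i) j = (\<Sum>i<dimJ. \<phi> x i * \<phi> (coord_basis i) j)"
    using j coord_basis_closed by (simp add: phi_sum phi_scale)
  also have "\<dots> = (\<Sum>i<dimJ. if i = j then \<phi> x j else 0)"
    using j by (intro sum.cong) (auto simp: phi_coord_basis)
  finally show "\<phi> x j = \<phi> (\<Sum>i<dimJ. \<phi> x i *\<^sub>R coord_basis i) j" using j by simp
qed (use assms coord_basis_closed in auto)

lemma space_algM [simp]: "space algM = carr J"
  by (simp add: borel_alg_def)

lemma measurable_coord [measurable]:
  assumes "i < dimJ" shows "(\<lambda>x. \<phi> x i) \<in> borel_measurable algM"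
proof -
  have "\<phi> \<in> algM \<rightarrow>\<^sub>M PiM {..<dimJ} (\<lambda>_. borel)"
    unfolding borel_alg_def by (rule measurable_vimage_algebra1) (use phi_mem in \<open>auto simp: space_PiM\<close>)
  from measurable_compose[OF this measurable_component_singleton] show ?thesis using assms by simp
qed

text \<open>
  Measurability into the algebra is measurability of each coordinate. All closure properties
  below reduce to it.
\<close>

lemma measurable_algI:
  assumes "\<And>w. w \<in> space M \<Longrightarrow> f w \<in> carr J"
    and "\<And>i. i < dimJ \<Longrightarrow> (\<lambda>w. \<phi> (f w) i) \<in> borel_measurable M"
  shows "f \<in> M \<rightarrow>\<^sub>M algM"
  unfolding borel_alg_def
proof (rule measurable_vimage_algebra2)
  show "f \<in> space M \<rightarrow> carr J" using assms(1) by auto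
  show "(\<lambda>w. \<phi> (f w)) \<in> M \<rightarrow>\<^sub>M PiM {..<dimJ} (\<lambda>_. borel)"
    by (rule measurable_PiM_single') (use assms phi_mem in auto)
qed

lemma measurable_alg_space: "f \<in> M \<rightarrow>\<^sub>M algM \<Longrightarrow> w \<in> space M \<Longrightarrow> f w \<in> carr J"
  using measurable_space[of f M algM w] by simp

lemma measurable_alg_coord:
  "f \<in> M \<rightarrow>\<^sub>M algM \<Longrightarrow> i < dimJ \<Longrightarrow> (\<lambda>w. \<phi> (f w) i) \<in> borel_measurable M"
  by (rule measurable_compose[OF _ measurable_coord])

lemma measurable_coord_inv: "coord_inv \<in> PiM {..<dimJ} (\<lambda>_. borel) \<rightarrow>\<^sub>M algM"
proof (rule measurable_algI)
  fix i assume i: "i < dimJ"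
  have "(\<lambda>v. v i) \<in> borel_measurable (PiM {..<dimJ} (\<lambda>_. borel :: real measure))" using i by simp
  then show "(\<lambda>v. \<phi> (coord_inv v) i) \<in> borel_measurable (PiM {..<dimJ} (\<lambda>_. borel))"
  proof (rule measurable_cong[THEN iffD1, rotated])
    fix v :: "nat \<Rightarrow> real" assume "v \<in> space (PiM {..<dimJ} (\<lambda>_. borel))"
    then have "v \<in> {..<dimJ} \<rightarrow>\<^sub>E UNIV" by (simp only: space_PiM space_borel)
    then show "v i = \<phi> (coord_inv v) i" by (simp only: phi_coord_inv)
  qed
qed (simp only: space_PiM space_borel coord_inv_closed)

lemma measurable_alg_add [measurable (raw)]:
  assumes f: "f \<in> M \<rightarrow>\<^sub>M algM" and g: "g \<in> M \<rightarrow>\<^sub>M algM"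
  shows "(\<lambda>w. f w + g w) \<in> M \<rightarrow>\<^sub>M algM"
proof (rule measurable_algI)
  note c = measurable_alg_space[OF f] measurable_alg_space[OF g]
  show "f w + g w \<in> carr J" if "w \<in> space M" for w using c that by simp
  fix i assume i: "i < dimJ"
  have "(\<lambda>w. \<phi> (f w) i + \<phi> (g w) i) \<in> borel_measurable M"
    by (intro borel_measurable_add measurable_alg_coord f g i)
  then show "(\<lambda>w. \<phi> (f w + g w) i) \<in> borel_measurable M"
    by (rule measurable_cong[THEN iffD1, rotated]) (simp add: phi_add i c)
qed

lemma measurable_alg_scale [measurable (raw)]:
  assumes h: "h \<in> borel_measurable M" and f: "f \<in> M \<rightarrow>\<^sub>M algM"
  shows "(\<lambda>w. h w *\<^sub>R f w) \<in> M \<rightarrow>\<^sub>M algM"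
proof (rule measurable_algI)
  note c = measurable_alg_space[OF f]
  show "h w *\<^sub>R f w \<in> carr J" if "w \<in> space M" for w using c that by simp
  fix i assume i: "i < dimJ"
  have "(\<lambda>w. h w * \<phi> (f w) i) \<in> borel_measurable M"
    by (intro borel_measurable_times measurable_alg_coord f h i)
  then show "(\<lambda>w. \<phi> (h w *\<^sub>R f w) i) \<in> borel_measurable M"
    by (rule measurable_cong[THEN iffD1, rotated]) (simp add: phi_scale i c)
qed

lemma measurable_alg_trace_inner [measurable (raw)]:
  assumes f: "f \<in> M \<rightarrow>\<^sub>M algM" and g: "g \<in> M \<rightarrow>\<^sub>M algM"
  shows "(\<lambda>w. ti (f w) (g w)) \<in> borel_measurable M"
proof -
  note c = measurable_alg_space[OF f] measurable_alg_space[OF g]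
  have "(\<lambda>w. \<Sum>i<dimJ. \<phi> (f w) i * \<phi> (g w) i) \<in> borel_measurable M"
    by (intro borel_measurable_sum borel_measurable_times measurable_alg_coord f g) simp_all
  then show ?thesis
    by (rule measurable_cong[THEN iffD1, rotated]) (simp add: phi_inner c)
qed

lemma measurable_alg_Tr [measurable (raw)]:
  assumes f: "f \<in> M \<rightarrow>\<^sub>M algM"
  shows "(\<lambda>w. Tr J (f w)) \<in> borel_measurable M"
proof -
  have "(\<lambda>w. ti (f w) (junit J)) \<in> borel_measurable M"
    by (rule measurable_alg_trace_inner[OF f]) simp
  then show ?thesis
    by (rule measurable_cong[THEN iffD1, rotated]) (simp add: trace_inner_unit measurable_alg_space[OF f])
qed

text \<open>
  The product is bilinear, so its coordinates are polynomials in the coordinates of the factors.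
\<close>

lemma phi_mult:
  assumes "x \<in> carr J" "y \<in> carr J" "i < dimJ"
  shows "\<phi> (x \<circ> y) i = (\<Sum>a<dimJ. \<Sum>b<dimJ. \<phi> x a * \<phi> y b * \<phi> (coord_basis a \<circ> coord_basis b) i)"
proof -
  have "x \<circ> y = (\<Sum>a<dimJ. \<phi> x a *\<^sub>R coord_basis a) \<circ> (\<Sum>b<dimJ. \<phi> y b *\<^sub>R coord_basis b)"
    using coord_expand assms by simp
  also have "\<dots> = (\<Sum>a<dimJ. \<Sum>b<dimJ. (\<phi> x a * \<phi> y b) *\<^sub>R (coord_basis a \<circ> coord_basis b))"
    using coord_basis_closed by (subst mult_sum_left) (auto simp: mult_sum_right mult_linear scaleR_sum_right mult.commute)
  finally show ?thesis
    using assms coord_basis_closed by (simp add: phi_sum phi_scale)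
qed

lemma measurable_alg_mult [measurable (raw)]:
  assumes f: "f \<in> M \<rightarrow>\<^sub>M algM" and g: "g \<in> M \<rightarrow>\<^sub>M algM"
  shows "(\<lambda>w. f w \<circ> g w) \<in> M \<rightarrow>\<^sub>M algM"
proof (rule measurable_algI)
  note c = measurable_alg_space[OF f] measurable_alg_space[OF g]
  show "f w \<circ> g w \<in> carr J" if "w \<in> space M" for w using c that by simp
  fix i assume i: "i < dimJ"
  have "(\<lambda>w. \<Sum>a<dimJ. \<Sum>b<dimJ. \<phi> (f w) a * \<phi> (g w) b * c a b) \<in> borel_measurable M" for c
    by (intro borel_measurable_sum borel_measurable_times measurable_alg_coord f g borel_measurable_const) simp_all
  then show "(\<lambda>w. \<phi> (f w \<circ> g w) i) \<in> borel_measurable M"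
    by (rule measurable_cong[THEN iffD1, rotated]) (simp add: phi_mult i c)
qed

primrec jpower :: "'a \<Rightarrow> nat \<Rightarrow> 'a" where
  "jpower x 0 = junit J"
| "jpower x (Suc n) = x \<circ> jpower x n"

lemma jpower_spectral:
  assumes "spectral_decomp J x P \<nu>"
  shows "jpower x n = (\<Sum>p\<in>P. (\<nu> p ^ n) *\<^sub>R p)"
proof -
  have P: "jordan_frame J P" and xP: "x = (\<Sum>p\<in>P. \<nu> p *\<^sub>R p)" using assms by (auto simp: spectral_decomp_def)
  show ?thesis
    by (induction n) (simp_all add: frameD(5)[OF P], simp add: xP frame_mult[OF P])
qed

text \<open>
  The exponential is defined through a frame depending on its argument in no evidently
  measurable way. Its power series only uses products.
\<close>

lemma jexp_sums:
  assumes x: "x \<in> carr J" and i: "i < dimJ"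
  shows "(\<lambda>n. \<phi> (jpower x n) i / fact n) sums \<phi> (jexp J x) i"
proof -
  obtain P \<nu> where P: "spectral_decomp J x P \<nu>" using spectral_theorem[OF x] .
  then have F: "jordan_frame J P" by (simp add: spectral_decomp_def)
  have "(\<lambda>n. \<Sum>p\<in>P. (\<nu> p ^ n /\<^sub>R fact n) * \<phi> p i) sums (\<Sum>p\<in>P. exp (\<nu> p) * \<phi> p i)"
    by (intro sums_sum sums_mult2 exp_converges)
  moreover have "\<phi> (jexp J x) i = (\<Sum>p\<in>P. exp (\<nu> p) * \<phi> p i)"
    unfolding jexp_eqI[OF P] using i frameD(3)[OF F] by (simp add: phi_sum phi_scale)
  moreover have "\<phi> (jpower x n) i / fact n = (\<Sum>p\<in>P. (\<nu> p ^ n /\<^sub>R fact n) * \<phi> p i)" for n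
    unfolding jpower_spectral[OF P] using i frameD(3)[OF F]
    by (simp add: phi_sum phi_scale sum_divide_distrib field_simps)
  ultimately show ?thesis by simp
qed

lemma measurable_alg_jpower:
  assumes f: "f \<in> M \<rightarrow>\<^sub>M algM"
  shows "(\<lambda>w. jpower (f w) n) \<in> M \<rightarrow>\<^sub>M algM"
  by (induction n) (auto intro: measurable_alg_mult f)

lemma measurable_alg_jexp [measurable (raw)]:
  assumes f: "f \<in> M \<rightarrow>\<^sub>M algM"
  shows "(\<lambda>w. jexp J (f w)) \<in> M \<rightarrow>\<^sub>M algM"
proof (rule measurable_algI)
  note c = measurable_alg_space[OF f]
  show "jexp J (f w) \<in> carr J" if "w \<in> space M" for w using c that by simp
  fix i assume i: "i < dimJ"
  have "(\<lambda>w. \<Sum>n. \<phi> (jpower (f w) n) i / fact n) \<in> borel_measurable M"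
    by (intro borel_measurable_suminf borel_measurable_divide measurable_alg_coord measurable_alg_jpower f i) simp
  then show "(\<lambda>w. \<phi> (jexp J (f w)) i) \<in> borel_measurable M"
    by (rule measurable_cong[THEN iffD1, rotated]) (simp add: sums_unique[OF jexp_sums] i c)
qed

text \<open>
  A negative eigenvalue makes \<open>Tr J (jexp J (- n x))\<close> unbounded in \<open>n\<close>. The condition is
  countable and hence measurable.
\<close>

lemma cone_iff_trace_jexp:
  assumes x: "x \<in> carr J"
  shows "x \<in> cone_of_squares J \<longleftrightarrow> (\<forall>n::nat. Tr J (jexp J ((- real n) *\<^sub>R x)) \<le> real (jrank J))"
proof -
  obtain Q \<mu> where Q: "spectral_decomp J x Q \<mu>" using spectral_theorem[OF x] .
  then have F: "jordan_frame J Q" by (simp add: spectral_decomp_def)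
  note Qd = frameD[OF F]
  have T: "Tr J (jexp J ((- real n) *\<^sub>R x)) = (\<Sum>q\<in>Q. exp (- real n * \<mu> q))" for n
    by (simp only: jexp_eqI[OF spectral_scale[OF Q]] Tr_frame_sum[OF F])
  show ?thesis
  proof
    assume "x \<in> cone_of_squares J"
    then have "\<mu> q \<ge> 0" if "q \<in> Q" for q
      using trace_inner_frame_eigen[OF Q that] Qd(2)[OF that] by (auto simp: cone_self_dual)
    then have "(\<Sum>q\<in>Q. exp (- real n * \<mu> q)) \<le> (\<Sum>q\<in>Q. 1)" for n
      by (intro sum_mono) simp
    then show "\<forall>n. Tr J (jexp J ((- real n) *\<^sub>R x)) \<le> real (jrank J)"
      unfolding T jrank_eq_card[OF F] by simp
  next
    assume A: "\<forall>n. Tr J (jexp J ((- real n) *\<^sub>R x)) \<le> real (jrank J)"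
    show "x \<in> cone_of_squares J"
    proof (rule spectral_nonneg_cone[OF Q], rule ccontr)
      fix q assume q: "q \<in> Q" and neg: "\<not> \<mu> q \<ge> 0"
      obtain n where n: "real (jrank J) < real n * - \<mu> q"
        using reals_Archimedean3[of "- \<mu> q"] neg by auto
      have "1 + real n * - \<mu> q \<le> exp (- real n * \<mu> q)" using exp_ge_add_one_self[of "- real n * \<mu> q"] by simp
      also have "\<dots> \<le> (\<Sum>q\<in>Q. exp (- real n * \<mu> q))" using q Qd(1) by (intro member_le_sum) auto
      also have "\<dots> \<le> real (jrank J)" using A T by metis
      finally show False using n by simp
    qed
  qed
qed

lemma measurable_cone [measurable]: "Measurable.pred algM (\<lambda>x. x \<in> cone_of_squares J)"
proof -
  have "Measurable.pred algM (\<lambda>x. \<forall>n::nat. Tr J (jexp J ((- real n) *\<^sub>R x)) \<le> real (jrank J))"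
    by measurable
  then show ?thesis
    by (rule measurable_cong[THEN iffD1, rotated]) (simp add: cone_iff_trace_jexp)
qed

lemma measurable_alg_gibbs [measurable (raw)]:
  "f \<in> M \<rightarrow>\<^sub>M algM \<Longrightarrow> (\<lambda>w. gibbs (f w)) \<in> M \<rightarrow>\<^sub>M algM"
  unfolding gibbs_def
  by (intro measurable_alg_scale borel_measurable_inverse measurable_alg_Tr measurable_alg_jexp)

lemma measurable_log_partition [measurable (raw)]:
  "f \<in> M \<rightarrow>\<^sub>M algM \<Longrightarrow> (\<lambda>w. log_partition (f w)) \<in> borel_measurable M"
  unfolding log_partition_def by measurable

lemma measurable_alg_eq [measurable (raw)]:
  assumes f: "f \<in> M \<rightarrow>\<^sub>M algM" and g: "g \<in> M \<rightarrow>\<^sub>M algM"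
  shows "Measurable.pred M (\<lambda>w. f w = g w)"
proof -
  note c = measurable_alg_space[OF f] measurable_alg_space[OF g]
  have "Measurable.pred M (\<lambda>w. ti (f w + (-1) *\<^sub>R g w) (f w + (-1) *\<^sub>R g w) = 0)"
    using f g by measurable
  then show ?thesis
  proof (rule measurable_cong[THEN iffD1, rotated])
    fix w assume "w \<in> space M"
    then show "(ti (f w + (-1) *\<^sub>R g w) (f w + (-1) *\<^sub>R g w) = 0) = (f w = g w)"
      using trace_inner_definite[of "f w - g w"] c by auto
  qed
qed

end

section \<open>Gaussian noise and the exponential mechanism\<close>

lemma bind_prob_ge:
  assumes M: "prob_space M" and f: "f \<in> M \<rightarrow>\<^sub>M prob_algebra N"
    and H: "H \<in> sets M" "measure M H \<ge> 1 - a" and G: "G \<in> sets N"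
    and step: "\<And>x. x \<in> H \<Longrightarrow> measure (f x) G \<ge> 1 - b" and ab: "a \<ge> 0" "b \<ge> 0"
  shows "measure (M \<bind> f) G \<ge> 1 - (a + b)"
proof (cases "b \<le> 1")
  case False
  then show ?thesis using ab measure_nonneg[of "M \<bind> f" G] by linarith
next
  case True
  interpret prob_space M by fact
  have fs: "f \<in> M \<rightarrow>\<^sub>M subprob_algebra N" using f by (rule measurable_prob_algebraD)
  have fm: "(\<lambda>x. measure (f x) G) \<in> borel_measurable M"
    using measurable_compose[OF f measurable_measure_prob_algebra[OF G]] .
  have fp: "prob_space (f x)" if "x \<in> space M" for x
    using measurable_space[OF f that] by (simp add: space_prob_algebra)
  have int: "integrable M (\<lambda>x. measure (f x) G)"
    using fm fp by (intro integrable_const_bound[where B = 1]) (auto intro!: AE_I2 prob_space.prob_le_1)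
  have "1 - (a + b) \<le> (1 - b) * (1 - a)" using ab by (simp add: algebra_simps)
  also have "\<dots> \<le> (1 - b) * measure M H" using True H(2) by (intro mult_left_mono) auto
  also have "\<dots> = (\<integral>x. (1 - b) * indicator H x \<partial>M)" using H(1) by simp
  also have "\<dots> \<le> (\<integral>x. measure (f x) G \<partial>M)"
  proof (rule integral_mono[OF _ int])
    show "integrable M (\<lambda>x. (1 - b) * indicat_real H x)"
      using H(1) by (intro integrable_mult_right integrable_real_indicator) (auto simp: emeasure_eq_measure)
    show "(1 - b) * indicat_real H x \<le> measure (f x) G" if "x \<in> space M" for x
      using step by (cases "x \<in> H") auto
  qed
  also have "\<dots> = measure (M \<bind> f) G" using measure_bind[OF fs G] by simp
  finally show ?thesis .
qed

text \<open>
  The integrand is \<open>sqrt 2\<close> times the density of variance \<open>2 \<sigma>\<^sup>2\<close>.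
\<close>

lemma normal_square_mgf:
  assumes "\<sigma> > 0"
  shows "(\<integral>\<^sup>+x. ennreal (exp (x\<^sup>2 / (4 * \<sigma>\<^sup>2))) \<partial>density lborel (normal_density 0 \<sigma>)) = ennreal (sqrt 2)"
proof -
  have eq: "normal_density 0 \<sigma> x * exp (x\<^sup>2 / (4 * \<sigma>\<^sup>2)) = sqrt 2 * normal_density 0 (sqrt 2 * \<sigma>) x" for x
  proof -
    have "- x\<^sup>2 / (2 * \<sigma>\<^sup>2) + x\<^sup>2 / (4 * \<sigma>\<^sup>2) = - x\<^sup>2 / (4 * \<sigma>\<^sup>2)" using assms by (simp add: field_simps)
    moreover have "1 / sqrt (2 * pi * \<sigma>\<^sup>2) = sqrt 2 * (1 / sqrt (4 * pi * \<sigma>\<^sup>2))"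
      using assms by (simp add: real_sqrt_mult real_sqrt_divide[symmetric])
        (simp add: field_simps real_sqrt_mult)
    ultimately show ?thesis
      by (simp add: normal_density_def power_mult_distrib mult.assoc exp_add[symmetric])
  qed
  interpret N: prob_space "density lborel (normal_density 0 (sqrt 2 * \<sigma>))"
    using assms by (intro prob_space_normal_density) simp
  have one: "(\<integral>\<^sup>+x. ennreal (normal_density 0 (sqrt 2 * \<sigma>) x) \<partial>lborel) = 1"
    using N.emeasure_space_1 by (simp add: emeasure_density)
  have "(\<integral>\<^sup>+x. ennreal (exp (x\<^sup>2 / (4 * \<sigma>\<^sup>2))) \<partial>density lborel (normal_density 0 \<sigma>))
      = (\<integral>\<^sup>+x. ennreal (normal_density 0 \<sigma> x) * ennreal (exp (x\<^sup>2 / (4 * \<sigma>\<^sup>2))) \<partial>lborel)"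
    by (simp add: nn_integral_density)
  also have "\<dots> = (\<integral>\<^sup>+x. ennreal (sqrt 2) * ennreal (normal_density 0 (sqrt 2 * \<sigma>) x) \<partial>lborel)"
    by (simp add: ennreal_mult[symmetric] eq)
  also have "\<dots> = ennreal (sqrt 2)" by (simp add: nn_integral_cmult one)
  finally show ?thesis .
qed

text \<open>
  Chernoff bound with the moment generating function of the sum of squares. A union bound over
  the coordinates would cost a factor \<open>ln k\<close>, and the dimension \<open>k\<close> is not bounded in terms
  of the rank.
\<close>

lemma chi_square_tail:
  assumes \<sigma>: "\<sigma> > 0" and b: "b > 0" and s: "s \<ge> 4 * \<sigma>\<^sup>2 * (real k + ln (1 / b))"
  defines "M \<equiv> PiM {..<k} (\<lambda>_. density lborel (normal_density 0 \<sigma>))"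
  shows "emeasure M {v \<in> space M. (\<Sum>i<k. (v i)\<^sup>2) \<ge> s} \<le> ennreal b"
proof -
  interpret N: prob_space "density lborel (normal_density 0 \<sigma>)"
    using \<sigma> by (rule prob_space_normal_density)
  interpret product_prob_space "\<lambda>_::nat. density lborel (normal_density 0 \<sigma>)" "{..<k}" by unfold_locales
  let ?f = "\<lambda>v. (\<Sum>i<k. (v i)\<^sup>2)" and ?l = "1 / (4 * \<sigma>\<^sup>2)"
  have [measurable]: "(\<lambda>v. v i) \<in> borel_measurable M" if "i < k" for i
    unfolding M_def using that by (auto intro: measurable_component_singleton[THEN measurable_compose] simp: measurable_component_singleton)
  have fm: "?f \<in> borel_measurable M" by measurable
  have "emeasure M {v \<in> space M. ?f v \<ge> s}
      \<le> ennreal (exp (- ?l * s)) * (\<integral>\<^sup>+v. ennreal (exp (?l * ?f v)) * indicator (space M) v \<partial>M)"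
    using Chernoff_ineq_nn_integral_ge[of ?l "space M" M ?f s] \<sigma> fm by simp
  also have "(\<integral>\<^sup>+v. ennreal (exp (?l * ?f v)) * indicator (space M) v \<partial>M)
      = (\<integral>\<^sup>+v. (\<Prod>i<k. ennreal (exp ((v i)\<^sup>2 / (4 * \<sigma>\<^sup>2)))) \<partial>M)"
    by (intro nn_integral_cong) (simp add: prod_ennreal exp_sum[symmetric] sum_divide_distrib)
  also have "\<dots> = (\<Prod>i<k. \<integral>\<^sup>+x. ennreal (exp (x\<^sup>2 / (4 * \<sigma>\<^sup>2))) \<partial>density lborel (normal_density 0 \<sigma>))"
    unfolding M_def by (rule product_nn_integral_prod) auto
  also have "\<dots> = ennreal (sqrt 2 ^ k)"
    by (simp add: normal_square_mgf[OF \<sigma>] ennreal_power)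
  also have "ennreal (exp (- ?l * s)) * ennreal (sqrt 2 ^ k) = ennreal (exp (- ?l * s) * sqrt 2 ^ k)"
    by (simp add: ennreal_mult)
  also have "\<dots> \<le> ennreal b"
  proof (rule ennreal_leI)
    have "?l * s \<ge> ?l * (4 * \<sigma>\<^sup>2 * (real k + ln (1 / b)))" using s by (intro mult_left_mono) auto
    then have "exp (- ?l * s) \<le> exp (- (real k + ln (1 / b)))" using \<sigma> by simp
    also have "\<dots> = exp (- 1) ^ k * b"
      using b by (simp add: exp_add exp_diff ln_div exp_minus exp_of_nat_mult[symmetric] field_simps)
    finally have "exp (- ?l * s) * sqrt 2 ^ k \<le> (exp (- 1) ^ k * b) * sqrt 2 ^ k"
      by (intro mult_right_mono) auto
    also have "\<dots> = (exp (- 1) * sqrt 2) ^ k * b" by (simp add: power_mult_distrib)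
    also have "\<dots> \<le> 1 * b"
    proof (intro mult_right_mono power_le_one)
      \<comment> \<open>the dimension drops out of the tail because \<open>sqrt 2 < exp 1\<close>\<close>
      have "sqrt 2 \<le> (2::real)" by (rule real_le_lsqrt) auto
      also have "\<dots> \<le> exp 1" using exp_ge_add_one_self[of 1] by simp
      finally show "exp (- 1) * sqrt 2 \<le> 1" by (simp add: exp_minus field_simps)
    qed (use b in auto)
    finally show "exp (- ?l * s) * sqrt 2 ^ k \<le> b" by simp
  qed
  finally show ?thesis .
qed

lemma exponential_mechanism_sets [simp, measurable_cong]:
  "sets (exponential_mechanism m \<epsilon> \<Delta> Q) = sets (count_space {..<m})"
  by (simp add: exponential_mechanism_def sets_point_measure)

lemma exponential_mechanism_space [simp]: "space (exponential_mechanism m \<epsilon> \<Delta> Q) = {..<m}"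
  by (simp add: exponential_mechanism_def space_point_measure)

definition exp_weight :: "nat \<Rightarrow> real \<Rightarrow> (nat \<Rightarrow> real) \<Rightarrow> nat \<Rightarrow> real" where
  "exp_weight m c Q i = exp (c * Q i) / (\<Sum>j<m. exp (c * Q j))"

lemma exponential_mechanism_emeasure:
  "X \<subseteq> {..<m} \<Longrightarrow>
    emeasure (exponential_mechanism m \<epsilon> \<Delta> Q) X = ennreal (\<Sum>i\<in>X. exp_weight m (\<epsilon> / (2 * \<Delta>)) Q i)"
  unfolding exponential_mechanism_def exp_weight_def
  by (subst emeasure_point_measure_finite) (auto intro!: sum_ennreal divide_nonneg_nonneg sum_nonneg)

lemma exp_weight_sum: "m \<ge> 1 \<Longrightarrow> (\<Sum>i<m. exp_weight m c Q i) = 1"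
proof -
  assume "m \<ge> 1"
  then have "(\<Sum>j<m. exp (c * Q j)) > 0" by (intro sum_pos) (auto simp: lessThan_empty_iff)
  then show ?thesis by (simp add: exp_weight_def sum_divide_distrib[symmetric])
qed

lemma exp_weight_nonneg: "exp_weight m c Q i \<ge> 0"
  by (simp add: exp_weight_def sum_nonneg)

lemma exponential_mechanism_prob_space: "m \<ge> 1 \<Longrightarrow> prob_space (exponential_mechanism m \<epsilon> \<Delta> Q)"
  by rule (simp add: exponential_mechanism_emeasure exp_weight_sum)

text \<open>
  A candidate that falls short of the optimum by more than \<open>\<gamma>\<close> is outweighed by it by a
  factor of at least \<open>m / b\<close>.
\<close>

lemma exponential_mechanism_utility:
  assumes m: "m \<ge> 1" and c: "\<epsilon> > 0" "\<Delta> > 0" and b: "b > 0"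
    and g: "\<gamma> \<ge> 2 * \<Delta> / \<epsilon> * ln (real m / b)"
  shows "measure (exponential_mechanism m \<epsilon> \<Delta> Q) {p. p < m \<and> (\<forall>i<m. Q i \<le> Q p + \<gamma>)} \<ge> 1 - b"
proof -
  interpret prob_space "exponential_mechanism m \<epsilon> \<Delta> Q" by (rule exponential_mechanism_prob_space[OF m])
  define c where "c = \<epsilon> / (2 * \<Delta>)"
  have c0: "c > 0" using assms by (simp add: c_def)
  let ?B = "{p. p < m \<and> \<not> (\<forall>i<m. Q i \<le> Q p + \<gamma>)}"
  have "exp_weight m c Q p \<le> b / real m" if p: "p \<in> ?B" for p
  proof -
    obtain i where i: "i < m" "Q i > Q p + \<gamma>" using p by auto
    have "ln (real m / b) = c * (2 * \<Delta> / \<epsilon> * ln (real m / b))" using assms by (simp add: c_def)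
    also have "\<dots> \<le> c * \<gamma>" using g c0 by (intro mult_left_mono) auto
    finally have "real m / b \<le> exp (c * \<gamma>)" using m b by (subst ln_le_cancel_iff[symmetric]) auto
    then have 1: "exp (- (c * \<gamma>)) \<le> b / real m" using m b by (simp add: exp_minus field_simps)
    have "c * Q p \<le> c * (Q i - \<gamma>)" using i c0 by (intro mult_left_mono) auto
    then have "exp (c * Q p) \<le> exp (c * Q i) * exp (- (c * \<gamma>))" by (simp add: exp_add[symmetric] algebra_simps)
    also have "\<dots> \<le> (\<Sum>j<m. exp (c * Q j)) * (b / real m)"
      using i 1 by (intro mult_mono member_le_sum) (auto intro!: sum_nonneg)
    finally have "exp (c * Q p) \<le> (b / real m) * (\<Sum>j<m. exp (c * Q j))" by (simp add: mult.commute)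
    moreover have "(\<Sum>j<m. exp (c * Q j)) > 0" using m by (intro sum_pos) (auto simp: lessThan_empty_iff)
    ultimately show ?thesis unfolding exp_weight_def by (simp add: divide_le_eq)
  qed
  then have "(\<Sum>p\<in>?B. exp_weight m c Q p) \<le> (\<Sum>p\<in>?B. b / real m)" by (rule sum_mono)
  also have "\<dots> \<le> (\<Sum>p<m. b / real m)" using b m by (intro sum_mono2) auto
  also have "\<dots> = b" using m by simp
  finally have le: "(\<Sum>p\<in>?B. exp_weight m c Q p) \<le> b" .
  have "?B \<subseteq> {..<m}" by auto
  from exponential_mechanism_emeasure[OF this, of \<epsilon> \<Delta> Q]
  have "prob ?B = (\<Sum>p\<in>?B. exp_weight m c Q p)"
    by (simp add: emeasure_eq_measure c_def sum_nonneg exp_weight_nonneg)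
  with le have "prob ?B \<le> b" by simp
  moreover have "{p. p < m \<and> (\<forall>i<m. Q i \<le> Q p + \<gamma>)} = space (exponential_mechanism m \<epsilon> \<Delta> Q) - ?B" by auto
  moreover have "?B \<in> events" by auto
  ultimately show ?thesis using prob_compl[of ?B] by simp
qed

lemma exponential_mechanism_measurable:
  assumes m: "m \<ge> 1" and Q: "\<And>i. i < m \<Longrightarrow> (\<lambda>w. Q w i) \<in> borel_measurable M"
  shows "(\<lambda>w. exponential_mechanism m \<epsilon> \<Delta> (Q w)) \<in> M \<rightarrow>\<^sub>M prob_algebra (count_space {..<m})"
proof (rule measurable_prob_algebraI)
  show "prob_space (exponential_mechanism m \<epsilon> \<Delta> (Q w))" for w by (rule exponential_mechanism_prob_space[OF m])
  show "(\<lambda>w. exponential_mechanism m \<epsilon> \<Delta> (Q w)) \<in> M \<rightarrow>\<^sub>M subprob_algebra (count_space {..<m})"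
  proof (rule measurable_subprob_algebra)
    show "subprob_space (exponential_mechanism m \<epsilon> \<Delta> (Q w))" for w
      by (intro prob_space_imp_subprob_space exponential_mechanism_prob_space m)
    fix A assume A: "A \<in> sets (count_space {..<m})"
    have "(\<lambda>w. ennreal (\<Sum>i\<in>A. exp_weight m (\<epsilon> / (2 * \<Delta>)) (Q w) i)) \<in> borel_measurable M"
      unfolding exp_weight_def using A
      by (intro measurable_compose[OF _ measurable_ennreal] borel_measurable_sum borel_measurable_divide
          borel_measurable_exp[THEN measurable_compose[rotated]] borel_measurable_times borel_measurable_const Q) auto
    then show "(\<lambda>w. emeasure (exponential_mechanism m \<epsilon> \<Delta> (Q w)) A) \<in> borel_measurable M"
      using A by (simp add: exponential_mechanism_emeasure)
  qed simp
qed

context eja_coordinates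
begin

lemma gaussian_noise_sets [simp, measurable_cong]: "sets (gaussian_noise J \<phi> \<sigma>) = sets algM"
  by (simp add: gaussian_noise_def)

lemma gaussian_sets_PiM:
  "sets (PiM {..<dimJ} (\<lambda>_. density lborel (normal_density 0 \<sigma>))) = sets (PiM {..<dimJ} (\<lambda>_. borel))"
  by (rule sets_PiM_cong) auto

lemma measurable_coord_inv_gaussian:
  "coord_inv \<in> PiM {..<dimJ} (\<lambda>_. density lborel (normal_density 0 \<sigma>)) \<rightarrow>\<^sub>M algM"
  using measurable_coord_inv measurable_cong_sets[OF gaussian_sets_PiM refl] by blast

lemma gaussian_noise_prob_space:
  assumes "\<sigma> > 0" shows "prob_space (gaussian_noise J \<phi> \<sigma>)"
proof -
  interpret N: prob_space "density lborel (normal_density 0 \<sigma>)"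
    using assms by (rule prob_space_normal_density)
  interpret product_prob_space "\<lambda>_::nat. density lborel (normal_density 0 \<sigma>)" "{..<dimJ}" by unfold_locales
  show ?thesis
    unfolding gaussian_noise_def coord_inv_def[symmetric] by (intro prob_space_distr measurable_coord_inv_gaussian)
qed

lemma gaussian_noise_bound:
  assumes \<sigma>: "\<sigma> > 0" and b: "b > 0" and s: "s\<^sup>2 \<ge> 4 * \<sigma>\<^sup>2 * (real dimJ + ln (1 / b))"
  shows "measure (gaussian_noise J \<phi> \<sigma>) {z \<in> carr J. ti z z \<le> s\<^sup>2} \<ge> 1 - b"
proof -
  interpret prob_space "gaussian_noise J \<phi> \<sigma>" using \<sigma> by (rule gaussian_noise_prob_space)
  let ?M = "PiM {..<dimJ} (\<lambda>_. density lborel (normal_density 0 \<sigma>))"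
  let ?G = "{z \<in> carr J. ti z z \<le> s\<^sup>2}"
  have spG: "space (gaussian_noise J \<phi> \<sigma>) = carr J" using sets_eq_imp_space_eq[OF gaussian_noise_sets] by simp
  have "{z \<in> space algM. ti z z \<le> s\<^sup>2} \<in> sets algM" by measurable
  then have G: "?G \<in> sets algM" by simp
  have cG: "carr J - ?G \<in> sets algM" using sets.compl_sets[OF G] by simp
  have "emeasure (gaussian_noise J \<phi> \<sigma>) (carr J - ?G) = emeasure ?M (coord_inv -` (carr J - ?G) \<inter> space ?M)"
    unfolding gaussian_noise_def coord_inv_def[symmetric] by (rule emeasure_distr[OF measurable_coord_inv_gaussian cG])
  also have "\<dots> \<le> emeasure ?M {v \<in> space ?M. (\<Sum>i<dimJ. (v i)\<^sup>2) \<ge> s\<^sup>2}"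
  proof (rule emeasure_mono)
    show "coord_inv -` (carr J - ?G) \<inter> space ?M \<subseteq> {v \<in> space ?M. (\<Sum>i<dimJ. (v i)\<^sup>2) \<ge> s\<^sup>2}"
    proof
      fix v assume v: "v \<in> coord_inv -` (carr J - ?G) \<inter> space ?M"
      then have vs: "v \<in> {..<dimJ} \<rightarrow>\<^sub>E UNIV" by (simp add: space_PiM)
      have "ti (coord_inv v) (coord_inv v) = (\<Sum>i<dimJ. (v i)\<^sup>2)"
        using phi_inner[OF coord_inv_closed[OF vs] coord_inv_closed[OF vs]] phi_coord_inv[OF vs] by (simp add: power2_eq_square)
      then show "v \<in> {v \<in> space ?M. (\<Sum>i<dimJ. (v i)\<^sup>2) \<ge> s\<^sup>2}" using v by auto
    qed
    have "(\<lambda>v. v i) \<in> borel_measurable ?M" if "i < dimJ" for i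
      using measurable_component_singleton[of i "{..<dimJ}" "\<lambda>_. density lborel (normal_density 0 \<sigma>)"] that by simp
    then have "(\<lambda>v. \<Sum>i<dimJ. (v i)\<^sup>2) \<in> borel_measurable ?M"
      by (intro borel_measurable_sum borel_measurable_power) auto
    then show "{v \<in> space ?M. (\<Sum>i<dimJ. (v i)\<^sup>2) \<ge> s\<^sup>2} \<in> sets ?M" by simp
  qed
  also have "\<dots> \<le> ennreal b" by (rule chi_square_tail[OF \<sigma> b s])
  finally have "prob (carr J - ?G) \<le> b" using b by (simp add: emeasure_eq_measure)
  moreover have "prob (carr J - ?G) = 1 - prob ?G" using prob_compl[of ?G] G spG by simp
  ultimately show ?thesis by simp
qed

end

section \<open>The iteration\<close>

text \<open>
  Here \<open>\<epsilon>\<close> is the privacy parameter of a single round.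
\<close>

locale mw_iteration = eja_coordinates J \<phi>
  for J :: "'a::real_vector jalg" (structure) and \<phi> +
  fixes m :: nat and a :: "nat \<Rightarrow> 'a" and b :: "nat \<Rightarrow> real" and \<Delta> \<epsilon> \<eta> \<sigma> :: real
  assumes m_pos: "m \<ge> 1" and a_closed: "\<And>i. i < m \<Longrightarrow> a i \<in> carr J" and sigma_pos: "\<sigma> > 0"
begin

abbreviation stateM :: "('a \<times> 'a \<times> 'a) measure" where
  "stateM \<equiv> algM \<Otimes>\<^sub>M algM \<Otimes>\<^sub>M algM"

definition oracle_dist :: "'a \<times> 'a \<times> 'a \<Rightarrow> nat measure" where
  "oracle_dist s = exponential_mechanism m \<epsilon> \<Delta> (\<lambda>i. ti (a i) (fst (snd s)) - b i)"

abbreviation noise :: "'a measure" where "noise \<equiv> gaussian_noise J \<phi> \<sigma>"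

definition update :: "'a \<times> 'a \<times> 'a \<Rightarrow> nat \<Rightarrow> 'a \<Rightarrow> 'a \<times> 'a \<times> 'a" where
  "update s p z = (fst s + (1/2) *\<^sub>R (a p + z), gibbs (- \<eta> *\<^sub>R (fst s + (1/2) *\<^sub>R (a p + z))),
     snd (snd s) + fst (snd s))"

definition step :: "'a \<times> 'a \<times> 'a \<Rightarrow> ('a \<times> 'a \<times> 'a) measure" where
  "step s = oracle_dist s \<bind> (\<lambda>p. noise \<bind> (\<lambda>z. return stateM (update s p z)))"

abbreviation run :: "nat \<Rightarrow> ('a \<times> 'a \<times> 'a) measure" where
  "run \<equiv> mw_run J \<phi> m a b \<Delta> \<epsilon> \<eta> \<sigma>"

lemma run_Suc: "run (Suc t) = run t \<bind> step"
proof -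
  have "step = (\<lambda>(L, x, S). step (L, x, S))" by auto
  also have "\<dots> = (\<lambda>(L, x, S). do {
     p \<leftarrow> exponential_mechanism m \<epsilon> \<Delta> (\<lambda>i. ti (a i) x - b i);
     z \<leftarrow> noise;
     let L' = L + (1 / 2) *\<^sub>R (a p + z); w = jexp J (- \<eta> *\<^sub>R L')
     in return stateM (L', w /\<^sub>R Tr J w, S + x)})"
    by (simp add: step_def oracle_dist_def update_def gibbs_def Let_def)
  finally show ?thesis by simp
qed

lemma noise_space: "space noise = carr J"
  using sets_eq_imp_space_eq[OF gaussian_noise_sets] by simp

lemma noise_prob: "noise \<in> space (prob_algebra algM)"
  using gaussian_noise_prob_space[OF sigma_pos] by (simp add: space_prob_algebra)

lemma stateM_space: "s \<in> space stateM \<longleftrightarrow> fst s \<in> carr J \<and> fst (snd s) \<in> carr J \<and> snd (snd s) \<in> carr J"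
  by (cases s) (auto simp: space_pair_measure)

lemma oracle_dist_measurable: "oracle_dist \<in> stateM \<rightarrow>\<^sub>M prob_algebra (count_space {..<m})"
  unfolding oracle_dist_def
proof (rule exponential_mechanism_measurable[OF m_pos])
  fix i assume i: "i < m"
  have "(\<lambda>w. ti (a i) (fst (snd w))) \<in> borel_measurable stateM"
    by (rule measurable_alg_trace_inner) (use a_closed[OF i] in auto)
  then show "(\<lambda>w. ti (a i) (fst (snd w)) - b i) \<in> borel_measurable stateM" by simp
qed

lemma update_measurable:
  "(\<lambda>w. update (fst (fst w)) (snd (fst w)) (snd w)) \<in> (stateM \<Otimes>\<^sub>M count_space {..<m}) \<Otimes>\<^sub>M algM \<rightarrow>\<^sub>M stateM"
proof -
  let ?W = "(stateM \<Otimes>\<^sub>M count_space {..<m}) \<Otimes>\<^sub>M algM"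
  have "a \<in> count_space {..<m} \<rightarrow>\<^sub>M algM" using a_closed by auto
  moreover have "(\<lambda>w. snd (fst w)) \<in> ?W \<rightarrow>\<^sub>M count_space {..<m}" by measurable
  ultimately have A: "(\<lambda>w. a (snd (fst w))) \<in> ?W \<rightarrow>\<^sub>M algM" by (rule measurable_compose[rotated])
  have L: "(\<lambda>w. fst (fst (fst w)) + (1/2) *\<^sub>R (a (snd (fst w)) + snd w)) \<in> ?W \<rightarrow>\<^sub>M algM"
    by (intro measurable_alg_add measurable_alg_scale A) auto
  show ?thesis
    unfolding update_def
    by (intro measurable_Pair L measurable_alg_gibbs measurable_alg_scale measurable_alg_add) auto
qed

lemma inner_measurable:
  "(\<lambda>w. noise \<bind> (\<lambda>z. return stateM (update (fst w) (snd w) z)))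
     \<in> stateM \<Otimes>\<^sub>M count_space {..<m} \<rightarrow>\<^sub>M prob_algebra stateM"
proof (rule measurable_bind_prob_space2)
  show "(\<lambda>_. noise) \<in> stateM \<Otimes>\<^sub>M count_space {..<m} \<rightarrow>\<^sub>M prob_algebra algM"
    using noise_prob by simp
  show "(\<lambda>(w, z). return stateM (update (fst w) (snd w) z))
      \<in> (stateM \<Otimes>\<^sub>M count_space {..<m}) \<Otimes>\<^sub>M algM \<rightarrow>\<^sub>M prob_algebra stateM"
    using measurable_compose[OF update_measurable measurable_return_prob_space] by (simp add: case_prod_beta)
qed

lemma step_measurable: "step \<in> stateM \<rightarrow>\<^sub>M prob_algebra stateM"
  unfolding step_def
  by (rule measurable_bind_prob_space2[OF oracle_dist_measurable])
    (use inner_measurable in \<open>simp add: case_prod_beta\<close>)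

lemma init_space: "(0, junit J /\<^sub>R real (jrank J), 0) \<in> space stateM"
  by (auto simp: space_pair_measure)

lemma run_prob: "run t \<in> space (prob_algebra stateM)"
proof (induction t)
  case 0
  show ?case using prob_space_return[OF init_space] by (simp add: space_prob_algebra)
next
  case (Suc t)
  have c: "(\<lambda>_. run t) \<in> count_space {()} \<rightarrow>\<^sub>M prob_algebra stateM" using Suc by simp
  have "(\<lambda>_. run t \<bind> step) \<in> count_space {()} \<rightarrow>\<^sub>M prob_algebra stateM"
    by (rule measurable_bind_prob_space[OF c step_measurable])
  from measurable_space[OF this, of "()"] show ?case unfolding run_Suc by simp
qed

lemma step_prob_ge:
  assumes s: "s \<in> space stateM"
    and P: "P \<subseteq> {..<m}" "measure (oracle_dist s) P \<ge> 1 - \<beta>1" "\<beta>1 \<ge> 0"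
    and Z: "Z \<in> sets algM" "measure noise Z \<ge> 1 - \<beta>2" "\<beta>2 \<ge> 0"
    and G: "G \<in> sets stateM" "\<And>p z. p \<in> P \<Longrightarrow> z \<in> Z \<Longrightarrow> update s p z \<in> G"
  shows "measure (step s) G \<ge> 1 - (\<beta>1 + \<beta>2)"
  unfolding step_def
proof (rule bind_prob_ge)
  have osets: "sets (oracle_dist s) = sets (count_space {..<m})" by (simp add: oracle_dist_def)
  show "prob_space (oracle_dist s)"
    unfolding oracle_dist_def by (rule exponential_mechanism_prob_space[OF m_pos])
  have "(\<lambda>p. (s, p)) \<in> count_space {..<m} \<rightarrow>\<^sub>M stateM \<Otimes>\<^sub>M count_space {..<m}"
    using s by (intro measurable_Pair1')
  from measurable_compose[OF this inner_measurable]
  show "(\<lambda>p. noise \<bind> (\<lambda>z. return stateM (update s p z))) \<in> oracle_dist s \<rightarrow>\<^sub>M prob_algebra stateM"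
    by (simp only: measurable_cong_sets[OF osets refl] fst_conv snd_conv)
  show "P \<in> sets (oracle_dist s)" using P osets by simp
  show "1 - \<beta>2 \<le> measure (noise \<bind> (\<lambda>z. return stateM (update s p z))) G" if p: "p \<in> P" for p
  proof -
    have "measure (noise \<bind> (\<lambda>z. return stateM (update s p z))) G \<ge> 1 - (\<beta>2 + 0)"
    proof (rule bind_prob_ge)
      show "prob_space noise" by (rule gaussian_noise_prob_space[OF sigma_pos])
      have "(\<lambda>z. ((s, p), z)) \<in> algM \<rightarrow>\<^sub>M (stateM \<Otimes>\<^sub>M count_space {..<m}) \<Otimes>\<^sub>M algM"
        using s p P by (intro measurable_Pair1') (auto simp: space_pair_measure)
      from measurable_compose[OF measurable_compose[OF this update_measurable] measurable_return_prob_space]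
      show "(\<lambda>z. return stateM (update s p z)) \<in> noise \<rightarrow>\<^sub>M prob_algebra stateM"
        by (simp only: measurable_cong_sets[OF gaussian_noise_sets refl] fst_conv snd_conv)
      show "Z \<in> sets noise" using Z by simp
      show "1 - 0 \<le> measure (return stateM (update s p z)) G" if "z \<in> Z" for z
        using G p that by (simp add: measure_return)
    qed (use Z G in auto)
    then show ?thesis by simp
  qed
qed (use P Z G in auto)

text \<open>
  Induction on the number of rounds. An invariant of the state alone suffices, since the state
  carries the accumulated losses and the accumulated iterates.
\<close>

lemma run_invariant:
  assumes meas: "\<And>t. Measurable.pred stateM (I t)"
    and init: "I 0 (0, junit J /\<^sub>R real (jrank J), 0)"
    and Z: "Z \<in> sets algM" "measure noise Z \<ge> 1 - \<beta>2" "\<beta>2 \<ge> 0" and "\<beta>1 \<ge> 0"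
    and P: "\<And>t s. s \<in> space stateM \<Longrightarrow> I t s \<Longrightarrow> measure (oracle_dist s) {p. p < m \<and> R s p} \<ge> 1 - \<beta>1"
    and stp: "\<And>t s p z. s \<in> space stateM \<Longrightarrow> I t s \<Longrightarrow> p < m \<Longrightarrow> R s p \<Longrightarrow> z \<in> Z \<Longrightarrow> I (Suc t) (update s p z)"
  shows "measure (run t) {s \<in> space stateM. I t s} \<ge> 1 - real t * (\<beta>1 + \<beta>2)"
proof (induction t)
  case 0
  show ?case using init init_space meas[of 0] by (simp add: measure_return)
next
  case (Suc t)
  let ?G = "\<lambda>t. {s \<in> space stateM. I t s}"
  have G: "?G t \<in> sets stateM" for t using meas[of t] by simp
  have rs: "sets (run t) = sets stateM" "prob_space (run t)"
    using run_prob[of t] by (simp_all add: space_prob_algebra)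
  have "measure (run t \<bind> step) (?G (Suc t)) \<ge> 1 - (real t * (\<beta>1 + \<beta>2) + (\<beta>1 + \<beta>2))"
  proof (rule bind_prob_ge[OF rs(2) _ _ Suc G])
    show "step \<in> run t \<rightarrow>\<^sub>M prob_algebra stateM"
      using step_measurable measurable_cong_sets[OF rs(1) refl] by blast
    show "?G t \<in> sets (run t)" using G rs by simp
    fix s assume s: "s \<in> ?G t"
    show "1 - (\<beta>1 + \<beta>2) \<le> measure (step s) (?G (Suc t))"
    proof (rule step_prob_ge)
      show "measure (oracle_dist s) {p. p < m \<and> R s p} \<ge> 1 - \<beta>1" by (rule P) (use s in auto)
      fix p z assume pz: "p \<in> {p. p < m \<and> R s p}" "z \<in> Z"
      have "z \<in> carr J" using pz Z sets.sets_into_space[OF Z(1)] by auto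
      then have "update s p z \<in> space stateM"
        using s pz a_closed by (auto simp: stateM_space update_def gibbs_closed)
      then show "update s p z \<in> ?G (Suc t)" using stp s pz by auto
    qed (use s Z G assms(6) in auto)
  qed (use assms in auto)
  then show ?case unfolding run_Suc by (simp add: algebra_simps)
qed

definition state_inv :: "nat \<Rightarrow> 'a \<times> 'a \<times> 'a \<Rightarrow> bool" where
  "state_inv t s \<longleftrightarrow> fst (snd s) = gibbs (- \<eta> *\<^sub>R fst s) \<and>
     snd (snd s) \<in> cone_of_squares J \<and> Tr J (snd (snd s)) = real t"

lemma state_inv_measurable: "Measurable.pred stateM (state_inv t)"
proof -
  have L: "fst \<in> stateM \<rightarrow>\<^sub>M algM" and x: "(\<lambda>s. fst (snd s)) \<in> stateM \<rightarrow>\<^sub>M algM"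
    and S: "(\<lambda>s. snd (snd s)) \<in> stateM \<rightarrow>\<^sub>M algM" by auto
  have 1: "Measurable.pred stateM (\<lambda>s. fst (snd s) = gibbs (- \<eta> *\<^sub>R fst s))"
    by (intro measurable_alg_eq x measurable_alg_gibbs measurable_alg_scale L) simp
  have 2: "Measurable.pred stateM (\<lambda>s. snd (snd s) \<in> cone_of_squares J)"
    by (rule measurable_compose[OF S measurable_cone])
  have 3: "(\<lambda>s. Tr J (snd (snd s))) \<in> borel_measurable stateM" by (rule measurable_alg_Tr[OF S])
  show ?thesis unfolding state_inv_def using 1 2 3 by measurable
qed

lemma state_inv_init: "state_inv 0 (0, junit J /\<^sub>R real (jrank J), 0)"
proof -
  have "Tr J 0 = 0" using Tr_scale[of 0 0] by simp
  moreover have "0 \<in> cone_of_squares J" unfolding cone_self_dual using primitiveD(2) by auto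
  ultimately show ?thesis by (simp add: state_inv_def gibbs_zero)
qed

lemma state_inv_step:
  assumes "jrank J \<ge> 1" "s \<in> space stateM" "state_inv t s" "p < m" "z \<in> carr J"
  shows "state_inv (Suc t) (update s p z)"
proof -
  have "density_element (fst (snd s))"
    using gibbs_density[OF assms(1), of "- \<eta> *\<^sub>R fst s"] assms(2,3)
    by (simp add: state_inv_def stateM_space)
  then show ?thesis
    using assms(2,3) by (auto simp: state_inv_def update_def stateM_space density_element_def cone_add Tr_add)
qed

text \<open>
  Twice the regret against \<open>y\<close>, accumulated over \<open>t\<close> good rounds with loss sum \<open>L\<close> and
  written with the potential, plus the error \<open>c\<close> of noise and oracle per round. The factor 2
  undoes the halving of the losses. The individual choices of the oracle do not occur: their
  contribution is contained in the loss sum.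
\<close>

definition regret_bound :: "'a \<Rightarrow> real \<Rightarrow> nat \<Rightarrow> 'a \<Rightarrow> real" where
  "regret_bound y c t L =
     2 * ((ln (real (jrank J)) - log_partition (- \<eta> *\<^sub>R L)) / \<eta> + \<eta> * real t - ti L y) + c * real t"

definition regret_inv :: "'a \<Rightarrow> real \<Rightarrow> nat \<Rightarrow> 'a \<times> 'a \<times> 'a \<Rightarrow> bool" where
  "regret_inv y c t s \<longleftrightarrow> state_inv t s \<and>
     (\<forall>i<m. ti (a i) (snd (snd s)) - real t * b i \<le> regret_bound y c t (fst s))"

lemma regret_inv_measurable:
  assumes "y \<in> carr J"
  shows "Measurable.pred stateM (regret_inv y c t)"
proof -
  have L: "fst \<in> stateM \<rightarrow>\<^sub>M algM" and S: "(\<lambda>s. snd (snd s)) \<in> stateM \<rightarrow>\<^sub>M algM" by auto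
  have y: "(\<lambda>s. ti (fst s) y) \<in> borel_measurable stateM"
    by (rule measurable_alg_trace_inner[OF L]) (use assms in simp)
  have bound: "(\<lambda>s. regret_bound y c t (fst s)) \<in> borel_measurable stateM"
    unfolding regret_bound_def
    by (intro borel_measurable_add borel_measurable_diff borel_measurable_times borel_measurable_divide
        borel_measurable_const measurable_log_partition measurable_alg_scale L y)
  have "Measurable.pred stateM (\<lambda>s. ti (a i) (snd (snd s)) - real t * b i \<le> regret_bound y c t (fst s))"
    if "i \<in> {..<m}" for i
  proof -
    have "(\<lambda>s. ti (a i) (snd (snd s))) \<in> borel_measurable stateM"
      by (rule measurable_alg_trace_inner[OF _ S]) (use a_closed that in simp)
    then show ?thesis
      unfolding pred_def by (intro borel_measurable_le borel_measurable_diff borel_measurable_const bound)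
  qed
  then show ?thesis
    unfolding regret_inv_def lessThan_iff[symmetric] Ball_def[symmetric]
    by (intro pred_intros_logic(3) pred_intros_finite(3) state_inv_measurable) auto
qed

lemma regret_inv_init:
  assumes "y \<in> carr J"
  shows "regret_inv y c 0 (0, junit J /\<^sub>R real (jrank J), 0)"
  using assms a_closed state_inv_init by (simp add: regret_inv_def regret_bound_def log_partition_zero)

text \<open>
  For the chosen \<open>p\<close>, each violation is at most \<open>\<langle>a\<^sub>p, x\<rangle> - b\<^sub>p +
  \<gamma>\<close>, and feasibility of \<open>y\<close> replaces \<open>b\<^sub>p\<close> by \<open>\<langle>a\<^sub>p,
  y\<rangle>\<close>. Up to noise this is twice the regret of the loss \<open>l\<close>, which
  \<open>log_partition_step\<close> charges to the potential.
\<close>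

lemma regret_inv_step:
  assumes r: "jrank J \<ge> 1" and \<eta>: "\<eta> > 0" and y: "density_element y" "\<And>i. i < m \<Longrightarrow> ti (a i) y \<le> b i"
    and ab: "\<And>i. i < m \<Longrightarrow> spectral_bound (a i) 1" and zeta: "0 \<le> \<zeta>" "\<zeta> \<le> 1"
    and s: "s \<in> space stateM" "regret_inv y (2 * \<zeta> + \<gamma>) t s"
    and p: "p < m" "\<And>i. i < m \<Longrightarrow> ti (a i) (fst (snd s)) - b i \<le> ti (a p) (fst (snd s)) - b p + \<gamma>"
    and z: "z \<in> carr J" "ti z z \<le> \<zeta>\<^sup>2"
  shows "regret_inv y (2 * \<zeta> + \<gamma>) (Suc t) (update s p z)"
proof -
  obtain L x S where sL: "s = (L, x, S)" by (cases s)
  have c: "L \<in> carr J" "x \<in> carr J" "S \<in> carr J" using s(1) by (auto simp: sL space_pair_measure)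
  have str: "state_inv t s" using s(2) by (simp add: regret_inv_def)
  have xg: "x = gibbs (- \<eta> *\<^sub>R L)" using str by (simp add: state_inv_def sL)
  have vL: "- \<eta> *\<^sub>R L \<in> carr J" using c by simp
  have xd: "density_element x" unfolding xg by (rule gibbs_density[OF r vL])
  have yc: "y \<in> carr J" using density_closed[OF y(1)] .
  have ac: "a p \<in> carr J" using a_closed p by simp
  have zb: "spectral_bound z \<zeta>" using spectral_bound_norm[OF z zeta(1)] .
  then have zb1: "spectral_bound z 1" using zeta(2) unfolding spectral_bound_def by (meson order.trans)
  define l where "l = (1/2) *\<^sub>R (a p + z)"
  have lb: "spectral_bound l 1" unfolding l_def using ab[OF p(1)] zb1 by (rule spectral_bound_half_sum)
  have lc: "l \<in> carr J" using lb by (simp add: spectral_bound_def)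
  have "log_partition (- \<eta> *\<^sub>R L - \<eta> *\<^sub>R l) \<le> log_partition (- \<eta> *\<^sub>R L) - \<eta> * ti l x + \<eta>\<^sup>2"
    unfolding xg by (rule log_partition_step[OF r vL lb \<eta>])
  also have "- \<eta> *\<^sub>R L - \<eta> *\<^sub>R l = - \<eta> *\<^sub>R (L + l)" by (simp add: algebra_simps)
  finally have st: "log_partition (- \<eta> *\<^sub>R (L + l)) / \<eta> \<le> log_partition (- \<eta> *\<^sub>R L) / \<eta> - ti l x + \<eta>"
    using \<eta> by (simp add: field_simps power2_eq_square)
  have l2: "ti (a p) w = 2 * ti l w - ti z w" if "w \<in> carr J" for w
    using that ac z by (simp add: l_def trace_inner_linear field_simps)
  have zx: "\<bar>ti z x\<bar> \<le> \<zeta>" "\<bar>ti z y\<bar> \<le> \<zeta>"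
    using spectral_bound_density[OF zb xd] spectral_bound_density[OF zb y(1)] by auto
  have main: "ti (a i) (S + x) - real (Suc t) * b i \<le> regret_bound y (2 * \<zeta> + \<gamma>) (Suc t) (L + l)"
    if i: "i < m" for i
  proof -
    have old: "ti (a i) S - real t * b i \<le> regret_bound y (2 * \<zeta> + \<gamma>) t L"
      using s(2) i by (simp add: regret_inv_def sL)
    have "ti (a i) x - b i \<le> ti (a p) x - b p + \<gamma>" using p(2)[OF i] by (simp add: sL)
    also have "\<dots> \<le> ti (a p) x - ti (a p) y + \<gamma>" using y(2)[OF p(1)] by simp
    also have "\<dots> \<le> 2 * ti l x - 2 * ti l y + (2 * \<zeta> + \<gamma>)"
      using zx unfolding l2[OF c(2)] l2[OF yc] by linarith
    finally have new: "ti (a i) x - b i \<le> 2 * ti l x - 2 * ti l y + (2 * \<zeta> + \<gamma>)" .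
    have e: "ti (a i) (S + x) = ti (a i) S + ti (a i) x" "ti (L + l) y = ti L y + ti l y"
      using c yc lc a_closed[OF i] by (simp_all add: trace_inner_linear)
    show ?thesis
      using old new st unfolding e regret_bound_def diff_divide_distrib of_nat_Suc by (simp add: algebra_simps)
  qed
  have "state_inv (Suc t) (update s p z)" by (rule state_inv_step[OF r s(1) str p(1) z(1)])
  then show ?thesis using main unfolding regret_inv_def by (simp add: update_def sL l_def)
qed

text \<open>
  The potential is at least \<open>- \<eta> \<langle>L, y\<rangle>\<close> by \<open>log_partition_ge\<close>, so that
  the terms depending on the state cancel.
\<close>

lemma regret_inv_final:
  assumes r: "jrank J \<ge> 1" and \<eta>: "\<eta> > 0" and y: "density_element y"
    and s: "s \<in> space stateM" "regret_inv y c t s" and i: "i < m"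
  shows "ti (a i) (snd (snd s)) - real t * b i \<le> 2 * (ln (real (jrank J)) / \<eta> + \<eta> * real t) + c * real t"
proof -
  have L: "fst s \<in> carr J" using s by (simp add: stateM_space)
  have "ti (- \<eta> *\<^sub>R fst s) y \<le> log_partition (- \<eta> *\<^sub>R fst s)"
    using L by (intro log_partition_ge r y) simp
  then have "- log_partition (- \<eta> *\<^sub>R fst s) / \<eta> \<le> ti (fst s) y"
    using \<eta> L density_closed[OF y] by (simp add: trace_inner_linear field_simps)
  moreover have "ti (a i) (snd (snd s)) - real t * b i \<le> regret_bound y c t (fst s)"
    using s(2) i by (simp add: regret_inv_def)
  ultimately show ?thesis unfolding regret_bound_def diff_divide_distrib by (simp add: algebra_simps)
qed

lemma structural_run:
  assumes r: "jrank J \<ge> 1"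
  shows "measure (run t) {s \<in> space stateM. state_inv t s} \<ge> 1"
proof -
  have "measure (run t) {s \<in> space stateM. state_inv t s} \<ge> 1 - real t * (0 + 0)"
  proof (rule run_invariant[where R = "\<lambda>_ _. True" and Z = "carr J"])
    show "carr J \<in> sets algM" using sets.top[of algM] by simp
    interpret prob_space noise by (rule gaussian_noise_prob_space[OF sigma_pos])
    show "1 - 0 \<le> measure noise (carr J)" using prob_space noise_space by simp
    fix s :: "'a \<times> 'a \<times> 'a"
    interpret E: prob_space "oracle_dist s"
      unfolding oracle_dist_def by (rule exponential_mechanism_prob_space[OF m_pos])
    show "1 - 0 \<le> measure (oracle_dist s) {p. p < m \<and> True}"
      using E.prob_space by (simp add: oracle_dist_def lessThan_def)
  qed (use state_inv_measurable state_inv_init state_inv_step[OF r] in auto)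
  then show ?thesis by simp
qed

lemma regret_run:
  assumes r: "jrank J \<ge> 1" and \<eta>: "\<eta> > 0" and y: "density_element y" "\<And>i. i < m \<Longrightarrow> ti (a i) y \<le> b i"
    and ab: "\<And>i. i < m \<Longrightarrow> spectral_bound (a i) 1" and zeta: "0 \<le> \<zeta>" "\<zeta> \<le> 1"
    and \<epsilon>: "\<epsilon> > 0" "\<Delta> > 0" and \<beta>: "\<beta> > 0"
    and g: "\<gamma> \<ge> 2 * \<Delta> / \<epsilon> * ln (real m / \<beta>)"
    and z: "\<zeta>\<^sup>2 \<ge> 4 * \<sigma>\<^sup>2 * (real dimJ + ln (1 / \<beta>))"
  shows "measure (run t) {s \<in> space stateM. regret_inv y (2 * \<zeta> + \<gamma>) t s} \<ge> 1 - real t * (\<beta> + \<beta>)"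
proof (rule run_invariant[where Z = "{z \<in> carr J. ti z z \<le> \<zeta>\<^sup>2}" and
    R = "\<lambda>s p. \<forall>i<m. ti (a i) (fst (snd s)) - b i \<le> ti (a p) (fst (snd s)) - b p + \<gamma>"])
  have "{z \<in> space algM. ti z z \<le> \<zeta>\<^sup>2} \<in> sets algM" by measurable
  then show "{z \<in> carr J. ti z z \<le> \<zeta>\<^sup>2} \<in> sets algM" by simp
  show "1 - \<beta> \<le> measure noise {z \<in> carr J. ti z z \<le> \<zeta>\<^sup>2}" by (rule gaussian_noise_bound[OF sigma_pos \<beta> z])
  show "1 - \<beta> \<le> measure (oracle_dist s)
     {p. p < m \<and> (\<forall>i<m. ti (a i) (fst (snd s)) - b i \<le> ti (a p) (fst (snd s)) - b p + \<gamma>)}" for s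
    unfolding oracle_dist_def by (rule exponential_mechanism_utility[OF m_pos \<epsilon> \<beta> g])
  show "Measurable.pred stateM (regret_inv y (2 * \<zeta> + \<gamma>) t)" for t
    by (rule regret_inv_measurable[OF density_closed[OF y(1)]])
  show "regret_inv y (2 * \<zeta> + \<gamma>) 0 (0, junit J /\<^sub>R real (jrank J), 0)"
    by (rule regret_inv_init[OF density_closed[OF y(1)]])
  show "regret_inv y (2 * \<zeta> + \<gamma>) (Suc t) (update s p z)"
    if "s \<in> space stateM" "regret_inv y (2 * \<zeta> + \<gamma>) t s" "p < m"
      "\<forall>i<m. ti (a i) (fst (snd s)) - b i \<le> ti (a p) (fst (snd s)) - b p + \<gamma>"
      "z \<in> {z \<in> carr J. ti z z \<le> \<zeta>\<^sup>2}" for t s p z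
    by (rule regret_inv_step[OF r \<eta> y ab zeta]) (use that in auto)
qed (use \<beta> in auto)

lemma output_prob_ge:
  assumes t: "t \<ge> 1" and I: "Measurable.pred stateM (I t)" "measure (run t) {s \<in> space stateM. I t s} \<ge> q"
    and out: "\<And>s. s \<in> space stateM \<Longrightarrow> I t s \<Longrightarrow> state_inv t s \<and> (\<forall>i<m. ti (a i) (snd (snd s)) \<le> real t * (b i + \<alpha>))"
  shows "measure (distr (run t) algM (\<lambda>(L, x, S). S /\<^sub>R real t))
     {x \<in> carr J. x \<in> cone_of_squares J \<and> Tr J x = 1 \<and> (\<forall>i<m. ti (a i) x \<le> b i + \<alpha>)} \<ge> q"
proof -
  let ?E = "{x \<in> carr J. x \<in> cone_of_squares J \<and> Tr J x = 1 \<and> (\<forall>i<m. ti (a i) x \<le> b i + \<alpha>)}"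
  have rs: "sets (run t) = sets stateM" "prob_space (run t)"
    using run_prob[of t] by (simp_all add: space_prob_algebra)
  interpret prob_space "run t" by fact
  have sp: "space (run t) = space stateM" using sets_eq_imp_space_eq[OF rs(1)] .
  have S: "(\<lambda>s. snd (snd s)) \<in> stateM \<rightarrow>\<^sub>M algM" by auto
  have f: "(\<lambda>(L, x, S). S /\<^sub>R real t) \<in> run t \<rightarrow>\<^sub>M algM"
    unfolding case_prod_beta measurable_cong_sets[OF rs(1) refl] by (intro measurable_alg_scale S) simp
  have id: "(\<lambda>x. x) \<in> algM \<rightarrow>\<^sub>M algM" by simp
  have 1: "(\<lambda>x. ti (a i) x) \<in> borel_measurable algM" if "i < m" for i
    by (rule measurable_alg_trace_inner[OF _ id]) (use a_closed[OF that] in simp)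
  have "Measurable.pred algM (\<lambda>x. \<forall>i\<in>{..<m}. ti (a i) x \<le> b i + \<alpha>)"
  proof (rule pred_intros_finite(3))
    fix i assume "i \<in> {..<m}"
    then have "i < m" by simp
    show "Measurable.pred algM (\<lambda>x. ti (a i) x \<le> b i + \<alpha>)"
      unfolding pred_def by (intro borel_measurable_le borel_measurable_const 1[OF \<open>i < m\<close>])
  qed simp
  moreover have "Measurable.pred algM (\<lambda>x. Tr J x = 1)"
    unfolding pred_def by (intro borel_measurable_eq measurable_alg_Tr[OF id] borel_measurable_const)
  ultimately have "Measurable.pred algM (\<lambda>x. x \<in> cone_of_squares J \<and> Tr J x = 1 \<and> (\<forall>i\<in>{..<m}. ti (a i) x \<le> b i + \<alpha>))"
    by (intro pred_intros_logic(3) measurable_cone)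
  then have E: "?E \<in> sets algM" by (simp only: pred_def space_algM Ball_def lessThan_iff)
  have "q \<le> prob {s \<in> space stateM. I t s}" by fact
  also have "\<dots> \<le> prob ((\<lambda>(L, x, S). S /\<^sub>R real t) -` ?E \<inter> space (run t))"
  proof (rule finite_measure_mono)
    show "(\<lambda>(L, x, S). S /\<^sub>R real t) -` ?E \<inter> space (run t) \<in> events" using f E by (rule measurable_sets)
    show "{s \<in> space stateM. I t s} \<subseteq> (\<lambda>(L, x, S). S /\<^sub>R real t) -` ?E \<inter> space (run t)"
    proof
      fix s assume s: "s \<in> {s \<in> space stateM. I t s}"
      then have o: "state_inv t s" "\<forall>i<m. ti (a i) (snd (snd s)) \<le> real t * (b i + \<alpha>)" using out by auto
      have Sc: "snd (snd s) \<in> carr J" using s by (simp add: stateM_space)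
      have "ti (a i) (snd (snd s) /\<^sub>R real t) \<le> b i + \<alpha>" if "i < m" for i
        using o(2) that t a_closed[OF that] Sc by (simp add: trace_inner_linear field_simps)
      then show "s \<in> (\<lambda>(L, x, S). S /\<^sub>R real t) -` ?E \<inter> space (run t)"
        using o(1) Sc t s by (auto simp: case_prod_beta state_inv_def sp Tr_scale cone_scale)
    qed
  qed
  also have "\<dots> = measure (distr (run t) algM (\<lambda>(L, x, S). S /\<^sub>R real t)) ?E"
    using measure_distr[OF f E] by simp
  finally show ?thesis .
qed

end

section \<open>Calibration of the accuracy\<close>

text \<open>
  The first power of each logarithm suffices. The constant only has to be large enough for the
  comparisons in \<open>mw_parameters\<close>.
\<close>

definition mw_accuracy :: "nat \<Rightarrow> nat \<Rightarrow> nat \<Rightarrow> real \<Rightarrow> real \<Rightarrow> real \<Rightarrow> real \<Rightarrow> real" where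
  "mw_accuracy r k m \<Delta> \<epsilon> \<beta> \<delta> =
     soft_O_bound (1000 * (1 + ln (real m)) ^ 1) 1 (accuracy_rate 1 r k \<Delta> \<epsilon> \<beta> \<delta>)"

lemma accuracy_rate_pos:
  assumes "r \<ge> 1" "k \<ge> 1" "\<Delta> > 0" "\<epsilon> > 0" "0 < \<delta>" "\<delta> < 1"
  shows "accuracy_rate 1 r k \<Delta> \<epsilon> \<beta> \<delta> > 0"
proof -
  have "1 + ln (real r) + \<bar>ln (1 / \<beta>)\<bar> + ln (1 / \<delta>) > 0"
    using assms by (intro add_pos_nonneg) auto
  then show ?thesis using assms by (simp add: accuracy_rate_def)
qed

lemma mw_accuracy_pos:
  assumes "r \<ge> 1" "k \<ge> 1" "m \<ge> 1" "\<Delta> > 0" "\<epsilon> > 0" "0 < \<delta>" "\<delta> < 1"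
  shows "mw_accuracy r k m \<Delta> \<epsilon> \<beta> \<delta> > 0"
proof -
  have "1 + ln (real m) > 0" using assms(3) by (intro add_pos_nonneg) auto
  then show ?thesis
    using accuracy_rate_pos[OF assms(1,2,4-7), of \<beta>]
    by (auto simp: mw_accuracy_def soft_O_bound_def intro!: mult_pos_pos add_pos_nonneg)
qed

lemma mw_rounds_bounds:
  assumes "r \<ge> 1" "\<alpha> > 0"
  shows "mw_rounds r \<alpha> \<ge> 1" "144 * ln (real r) \<le> \<alpha>\<^sup>2 * real (mw_rounds r \<alpha>)"
    "\<alpha> < 2 \<Longrightarrow> real (mw_rounds r \<alpha>) \<le> 144 * (1 + ln (real r)) / \<alpha>\<^sup>2"
proof -
  define y where "y = 144 * ln (real r) / \<alpha>\<^sup>2"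
  have y: "y \<ge> 0" using assms by (simp add: y_def)
  have T: "mw_rounds r \<alpha> = max 1 (nat \<lceil>y\<rceil>)" by (simp add: mw_rounds_def y_def)
  show "mw_rounds r \<alpha> \<ge> 1" unfolding T by simp
  have "y \<le> real (mw_rounds r \<alpha>)" unfolding T using real_nat_ceiling_ge[of y] by linarith
  then show "144 * ln (real r) \<le> \<alpha>\<^sup>2 * real (mw_rounds r \<alpha>)"
    using assms by (simp add: y_def field_simps)
  have "real (mw_rounds r \<alpha>) \<le> 1 + y" unfolding T using y by linarith
  moreover have "1 + y \<le> 144 * (1 + ln (real r)) / \<alpha>\<^sup>2" if "\<alpha> < 2"
  proof -
    have "\<alpha>\<^sup>2 \<le> 2\<^sup>2" using assms that by (intro power_mono) auto
    then have "1 \<le> 144 / \<alpha>\<^sup>2" using assms by (simp add: le_divide_eq)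
    then show ?thesis by (simp add: y_def add_divide_distrib distrib_left)
  qed
  ultimately show "real (mw_rounds r \<alpha>) \<le> 144 * (1 + ln (real r)) / \<alpha>\<^sup>2" if "\<alpha> < 2" using that by linarith
qed

lemma mw_eps_pos:
  assumes "r \<ge> 1" "\<alpha> > 0" "\<epsilon> > 0" "0 < \<delta>" "\<delta> < 1"
  shows "mw_eps r \<alpha> \<epsilon> \<delta> > 0"
  using mw_rounds_bounds(1)[OF assms(1,2)] assms by (simp add: mw_eps_def)

lemma mw_sigma_pos:
  assumes "r \<ge> 1" "\<alpha> > 0" "\<Delta> > 0" "\<epsilon> > 0" "0 < \<delta>" "\<delta> < 1"
  shows "mw_sigma r \<alpha> \<Delta> \<epsilon> \<delta> > 0"
proof -
  have "real (mw_rounds r \<alpha>) / \<delta> > 1"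
    using mw_rounds_bounds(1)[OF assms(1,2)] assms by (simp add: less_divide_eq)
  then have "ln (real (mw_rounds r \<alpha>) / \<delta>) > 0" by simp
  then show ?thesis using mw_eps_pos[of r \<alpha> \<epsilon> \<delta>] assms by (simp add: mw_sigma_def)
qed

text \<open>
  All error terms are compared with \<open>\<alpha>\<^sup>2 = 10\<^sup>6 M\<^sup>2 X Y\<^sup>2\<close>,
  where \<open>X = \<Delta> sqrt (r k) / \<epsilon>\<close> and the other letters stand for logarithms. The
  bound on \<open>\<gamma>\<close> is of order \<open>X M\<^sup>2 Y\<^sup>2 / \<alpha>\<close> and the bound on
  \<open>\<zeta>\<close> of order \<open>X Y\<^sup>2 / \<alpha>\<close>. The circularity that \<open>T\<close> depends on
  \<open>\<alpha>\<close> and \<open>\<alpha>\<close> on \<open>ln T\<close> is resolved by \<open>\<alpha> \<ge> g\<close>: it bounds \<open>ln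
  T\<close> by \<open>\<bar>ln g\<bar>\<close> and logarithmic terms, and \<open>\<bar>ln g\<bar>\<close> is part of
  \<open>\<alpha>\<close>.
\<close>

lemma mw_parameters:
  assumes r: "r \<ge> 1" and k: "k \<ge> 1" and m: "m \<ge> 1" and pos: "\<Delta> > 0" "\<epsilon> > 0"
    and \<beta>: "0 < \<beta>" "\<beta> < 1" and \<delta>: "0 < \<delta>" "\<delta> < 1"
    and \<alpha>: "\<alpha> = mw_accuracy r k m \<Delta> \<epsilon> \<beta> \<delta>" "\<alpha> < 2"
  defines "T \<equiv> mw_rounds r \<alpha>" and "\<epsilon>' \<equiv> mw_eps r \<alpha> \<epsilon> \<delta>" and "\<sigma> \<equiv> mw_sigma r \<alpha> \<Delta> \<epsilon> \<delta>"
  defines "\<beta>' \<equiv> \<beta> / (2 * real T)"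
  obtains \<zeta> \<gamma> where "0 \<le> \<zeta>" "\<zeta> \<le> 1" "2 * \<zeta> + \<gamma> \<le> \<alpha> / 2"
    "\<gamma> \<ge> 2 * \<Delta> / \<epsilon>' * ln (real m / \<beta>')" "\<zeta>\<^sup>2 \<ge> 4 * \<sigma>\<^sup>2 * (real k + ln (1 / \<beta>'))"
proof -
  define \<Lambda> where "\<Lambda> = 1 + ln (real r) + \<bar>ln (1 / \<beta>)\<bar> + ln (1 / \<delta>)"
  define g where "g = accuracy_rate 1 r k \<Delta> \<epsilon> \<beta> \<delta>"
  define G where "G = 1 + \<bar>ln g\<bar>"
  define M where "M = 1 + ln (real m)"
  define X where "X = \<Delta> * sqrt (real r * real k) / \<epsilon>"
  define Y where "Y = \<Lambda> * G"
  have a0: "\<alpha> > 0" unfolding \<alpha>(1) using mw_accuracy_pos r k m pos \<delta> by simp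
  have g0: "g > 0" unfolding g_def using accuracy_rate_pos r k pos \<delta> by simp
  have ge1: "\<Lambda> \<ge> 1" "G \<ge> 1" "M \<ge> 1" using r m \<delta> by (auto simp: \<Lambda>_def G_def M_def)
  have Y: "Y \<ge> 1" "\<Lambda> \<le> Y" "G \<le> Y" unfolding Y_def
    using mult_mono[of 1 \<Lambda> 1 G] mult_left_mono[of 1 G \<Lambda>] mult_right_mono[of 1 \<Lambda> G] ge1 by auto
  have X0: "X > 0" using pos r k by (simp add: X_def)
  have \<alpha>g: "\<alpha> = 1000 * M * g * G"
    by (simp add: \<alpha>(1) mw_accuracy_def soft_O_bound_def M_def g_def G_def)
  have g2: "g\<^sup>2 = X * \<Lambda>\<^sup>2"
  proof -
    have p: "(x powr (1/4))\<^sup>2 = sqrt x" "(x powr (1/2))\<^sup>2 = x" if "x > 0" for x :: real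
      using that by (simp_all add: powr_half_sqrt[symmetric] powr_power)
    have "g = \<Delta> powr (1/2) * real r powr (1/4) * real k powr (1/4) / \<epsilon> powr (1/2) * \<Lambda>"
      by (simp add: g_def accuracy_rate_def \<Lambda>_def)
    then show ?thesis using pos r k
      by (simp add: power_mult_distrib power_divide p X_def real_sqrt_mult)
  qed
  have \<alpha>2: "\<alpha>\<^sup>2 = 1000000 * M\<^sup>2 * X * Y\<^sup>2"
    unfolding \<alpha>g power_mult_distrib g2 Y_def by simp
  have g\<alpha>: "g \<le> \<alpha>"
  proof -
    have "g * 1 \<le> g * (1000 * M * G)" using ge1 g0 mult_mono[of 1 M 1 G] by (intro mult_left_mono) auto
    then show ?thesis unfolding \<alpha>g by (simp add: mult_ac)
  qed
  have T1: "real T \<ge> 1" using mw_rounds_bounds(1)[OF r a0] by (simp add: T_def)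
  have "real T \<le> 144 * (1 + ln (real r)) / \<alpha>\<^sup>2" using mw_rounds_bounds(3)[OF r a0 \<alpha>(2)] by (simp add: T_def)
  also have "\<dots> \<le> 144 * \<Lambda> / \<alpha>\<^sup>2" using \<delta> by (intro divide_right_mono) (auto simp: \<Lambda>_def)
  finally have T2: "real T \<le> 144 * \<Lambda> / \<alpha>\<^sup>2" .
  have lnT: "ln (real T) \<le> 11 * Y"
  proof -
    have "ln (real T) \<le> ln (144 * \<Lambda> / \<alpha>\<^sup>2)" using T1 T2 by (subst ln_le_cancel_iff) auto
    also have "\<dots> = ln 144 + ln \<Lambda> - 2 * ln \<alpha>"
      using ge1 a0 by (simp add: ln_div ln_mult ln_realpow)
    finally have 1: "ln (real T) \<le> ln 144 + ln \<Lambda> - 2 * ln \<alpha>" .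
    have 2: "ln 144 \<le> (8::real)"
    proof -
      have "ln (144::real) \<le> ln (2 ^ 8)" by (subst ln_le_cancel_iff) auto
      also have "\<dots> = 8 * ln 2" by (subst ln_realpow) auto
      also have "\<dots> \<le> 8" using ln_le_minus_one[of "2::real"] by simp
      finally show ?thesis .
    qed
    have 3: "ln \<Lambda> \<le> Y" using ln_le_minus_one[of \<Lambda>] ge1 Y by linarith
    have 4: "- ln \<alpha> \<le> Y"
    proof -
      have "ln g \<le> ln \<alpha>" using g0 g\<alpha> by simp
      then show ?thesis using Y(3) unfolding G_def by linarith
    qed
    show ?thesis using 1 2 3 4 Y(1) by linarith
  qed
  have l\<delta>: "ln (1 / \<delta>) > 0" "ln (1 / \<delta>) \<le> \<Lambda>" using \<delta> r by (auto simp: \<Lambda>_def)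
  have l\<beta>: "ln (1 / \<beta>) \<ge> 0" "ln (1 / \<beta>) \<le> Y"
  proof -
    show "ln (1 / \<beta>) \<ge> 0" using \<beta> by simp
    have "ln (real r) \<ge> 0" using r by simp
    then show "ln (1 / \<beta>) \<le> Y" using Y(2) l\<delta>(1) unfolding \<Lambda>_def by linarith
  qed
  have lT\<delta>: "ln (real T / \<delta>) \<le> 12 * Y" "ln (real T / \<delta>) \<ge> 0"
    using lnT l\<delta> Y T1 \<delta> by (auto simp: ln_div)
  have \<beta>': "1 / \<beta>' = 2 * real T * (1 / \<beta>)" using \<beta> T1 by (simp add: \<beta>'_def)
  have \<beta>'0: "\<beta>' > 0" using \<beta> T1 by (simp add: \<beta>'_def)
  have "ln (1 / \<beta>') = ln 2 + ln (real T) + ln (1 / \<beta>)"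
    unfolding \<beta>' using T1 \<beta> by (simp add: ln_mult ln_div)
  then have l\<beta>': "ln (1 / \<beta>') \<le> 13 * Y" "ln (1 / \<beta>') \<ge> 0"
    using lnT l\<beta> Y T1 ln_le_minus_one[of "2::real"] by (auto intro!: add_nonneg_nonneg)
  have "ln (real m / \<beta>') = ln (real m) + ln (1 / \<beta>')" using m \<beta>'0 by (simp add: ln_div)
  also have "\<dots> \<le> M * Y + 13 * (M * Y)"
  proof -
    have "M * 1 \<le> M * Y" "1 * Y \<le> M * Y" using ge1 Y by (intro mult_left_mono mult_right_mono; simp)+
    moreover have "ln (real m) = M - 1" by (simp add: M_def)
    ultimately show ?thesis using l\<beta>'(1) by linarith
  qed
  finally have lm: "ln (real m / \<beta>') \<le> 14 * (M * Y)" by simp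
  have ie: "1 / \<epsilon>' \<le> 48 * \<Lambda> / (\<alpha> * \<epsilon>)" "1 / \<epsilon>' > 0"
  proof -
    have "real T * ln (1 / \<delta>) \<le> (144 * \<Lambda> / \<alpha>\<^sup>2) * \<Lambda>" using T1 T2 l\<delta> ge1 by (intro mult_mono) auto
    also have "\<dots> = (12 * \<Lambda> / \<alpha>)\<^sup>2" by (simp add: power2_eq_square)
    finally have "sqrt (real T * ln (1 / \<delta>)) \<le> 12 * \<Lambda> / \<alpha>"
      using ge1 a0 by (intro real_le_lsqrt) auto
    then have "4 * sqrt (real T * ln (1 / \<delta>)) / \<epsilon> \<le> 4 * (12 * \<Lambda> / \<alpha>) / \<epsilon>"
      using pos by (intro divide_right_mono mult_left_mono) auto
    then show "1 / \<epsilon>' \<le> 48 * \<Lambda> / (\<alpha> * \<epsilon>)" by (simp add: \<epsilon>'_def mw_eps_def T_def[symmetric])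
    show "1 / \<epsilon>' > 0" using mw_eps_pos[OF r a0 pos(2) \<delta>] by (simp add: \<epsilon>'_def)
  qed
  have DX: "\<Delta> / \<epsilon> \<le> X"
  proof -
    have "1 \<le> sqrt (real r * real k)" using mult_mono[of 1 "real r" 1 "real k"] r k by simp
    then have "\<Delta> * 1 / \<epsilon> \<le> X" unfolding X_def using pos by (intro divide_right_mono mult_left_mono) auto
    then show ?thesis by simp
  qed
  define \<gamma> where "\<gamma> = 2 * \<Delta> / \<epsilon>' * (14 * (M * Y))"
  have \<gamma>1: "\<gamma> \<ge> 2 * \<Delta> / \<epsilon>' * ln (real m / \<beta>')"
    unfolding \<gamma>_def using lm ie(2) pos by (intro mult_left_mono) auto
  have \<gamma>2: "\<gamma> \<le> \<alpha> / 4"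
  proof -
    have "\<gamma> = 28 * \<Delta> * (M * Y) * (1 / \<epsilon>')" by (simp add: \<gamma>_def)
    also have "\<dots> \<le> 28 * \<Delta> * (M * Y) * (48 * \<Lambda> / (\<alpha> * \<epsilon>))"
      using ie(1) pos ge1 Y by (intro mult_left_mono) auto
    also have "\<dots> = 1344 * M * (\<Delta> / \<epsilon>) * (Y * \<Lambda>) / \<alpha>" by (simp add: mult_ac)
    also have "\<dots> \<le> 1344 * M\<^sup>2 * X * (Y\<^sup>2) / \<alpha>"
    proof -
      have "M \<le> M\<^sup>2" using ge1 by (simp add: power2_eq_square)
      moreover have "Y * \<Lambda> \<le> Y\<^sup>2" using Y ge1 by (simp add: power2_eq_square)
      ultimately show ?thesis
        using a0 DX ge1 Y X0 pos by (intro divide_right_mono mult_mono) auto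
    qed
    also have "\<dots> = 1344 / 1000000 * \<alpha>\<^sup>2 / \<alpha>" unfolding \<alpha>2 by simp
    also have "\<dots> \<le> \<alpha> / 4" using a0 by (simp add: power2_eq_square)
    finally show ?thesis .
  qed
  define \<zeta> where "\<zeta> = sqrt (4 * \<sigma>\<^sup>2 * (real k + ln (1 / \<beta>')))"
  have \<zeta>1: "\<zeta>\<^sup>2 = 4 * \<sigma>\<^sup>2 * (real k + ln (1 / \<beta>'))" "\<zeta> \<ge> 0"
    using l\<beta>'(2) by (auto simp: \<zeta>_def)
  have "\<zeta> \<le> \<alpha> / 8"
    unfolding \<zeta>_def
  proof (rule real_le_lsqrt)
    have s: "\<sigma>\<^sup>2 = \<Delta>\<^sup>2 * (2 * real r * ln (real T / \<delta>)) * (1 / \<epsilon>')\<^sup>2"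
      using lT\<delta>(2) by (simp add: \<sigma>_def mw_sigma_def T_def[symmetric] \<epsilon>'_def power_mult_distrib power_divide)
    have "real k + ln (1 / \<beta>') \<le> real k * Y + 13 * (real k * Y)"
    proof -
      have "real k * 1 \<le> real k * Y" "1 * Y \<le> real k * Y"
        using k Y by (intro mult_left_mono mult_right_mono; simp)+
      then show ?thesis using l\<beta>'(1) by linarith
    qed
    then have kb: "real k + ln (1 / \<beta>') \<le> 14 * real k * Y" by (simp add: mult_ac)
    have "\<sigma>\<^sup>2 \<le> \<Delta>\<^sup>2 * (2 * real r * (12 * Y)) * (48 * \<Lambda> / (\<alpha> * \<epsilon>))\<^sup>2"
      unfolding s using ie lT\<delta> Y pos by (intro mult_mono mult_nonneg_nonneg power_mono) auto
    then have "4 * \<sigma>\<^sup>2 * (real k + ln (1 / \<beta>'))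
        \<le> 4 * (\<Delta>\<^sup>2 * (2 * real r * (12 * Y)) * (48 * \<Lambda> / (\<alpha> * \<epsilon>))\<^sup>2) * (14 * real k * Y)"
      using kb l\<beta>'(2) Y by (intro mult_mono mult_nonneg_nonneg) auto
    also have "\<dots> = 3096576 * X\<^sup>2 * (Y * \<Lambda>)\<^sup>2 / \<alpha>\<^sup>2"
      using pos by (simp add: X_def power_mult_distrib power_divide) (simp add: power2_eq_square mult_ac)
    also have "\<dots> \<le> 1000000000000 / 64 * M ^ 4 * X\<^sup>2 * (Y * Y)\<^sup>2 / \<alpha>\<^sup>2"
    proof -
      have "1 \<le> M ^ 4" using ge1 by simp
      then have "3096576 * 1 \<le> 1000000000000 / 64 * M ^ 4" by (intro mult_mono) auto
      moreover have "(Y * \<Lambda>)\<^sup>2 \<le> (Y * Y)\<^sup>2" using Y ge1 by (intro power_mono mult_left_mono) auto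
      ultimately show ?thesis using ge1 by (intro divide_right_mono mult_mono) auto
    qed
    also have "\<dots> = (\<alpha>\<^sup>2)\<^sup>2 / 64 / \<alpha>\<^sup>2"
      unfolding \<alpha>2 by (simp add: power_mult_distrib power2_eq_square power4_eq_xxxx)
    also have "\<dots> = (\<alpha> / 8)\<^sup>2" using a0 by (simp add: power2_eq_square)
    finally show "4 * \<sigma>\<^sup>2 * (real k + ln (1 / \<beta>')) \<le> (\<alpha> / 8)\<^sup>2" .
  qed (use a0 in auto)
  then show ?thesis using that[of \<zeta> \<gamma>] \<zeta>1 \<gamma>1 \<gamma>2 \<alpha>(2) by simp
qed

lemma (in eja_coordinates) rank_dim_pos:
  assumes "x \<in> carr J" "Tr J x = 1"
  shows "jrank J \<ge> 1" "dimJ \<ge> 1"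
proof -
  obtain Q \<mu> where Q: "spectral_decomp J x Q \<mu>" using spectral_theorem[OF assms(1)] .
  then have F: "jordan_frame J Q" by (simp add: spectral_decomp_def)
  have "Q \<noteq> {}" using Tr_eqI[OF Q] assms(2) by auto
  then obtain q where q: "q \<in> Q" by auto
  show "jrank J \<ge> 1" unfolding jrank_eq_card[OF F] using q frameD(1)[OF F] by (simp add: Suc_le_eq card_gt_0_iff, blast)
  have "(\<Sum>i<dimJ. \<phi> q i * \<phi> q i) = 1"
    using phi_inner[of q q] Tr_primitive(2)[OF frameD(2)[OF F q]] frameD(3)[OF F q] by simp
  then show "dimJ \<ge> 1" by (cases "dimJ = 0") auto
qed

text \<open>
  The failure probability \<open>\<beta>\<close> is shared equally by the oracle and the noise over the
  \<open>T\<close> rounds.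
\<close>

lemma noisy_mw_accurate:
  fixes J :: "'a::real_vector jalg"
  assumes J: "euclidean_jordan_algebra J" and iso: "coordinate_isometry J \<phi>" and m: "m \<ge> 1"
    and a: "\<And>i. i < m \<Longrightarrow> a i \<in> carr J \<and> eigenvalues J (a i) \<subseteq> {-1..1}"
    and y: "y \<in> cone_of_squares J" "Tr J y = 1" "\<And>i. i < m \<Longrightarrow> trace_inner J (a i) y \<le> b i"
    and pos: "\<Delta> > 0" "\<epsilon> > 0" "\<beta> > 0" and \<delta>: "0 < \<delta>" "\<delta> < 1"
    and \<alpha>: "\<alpha> = mw_accuracy (jrank J) (jdim J) m \<Delta> \<epsilon> \<beta> \<delta>"
  shows "\<P>(x in noisy_mw J \<phi> m a b \<Delta> \<epsilon> \<delta> \<alpha>. x \<in> cone_of_squares J \<and> Tr J x = 1 \<and>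
            (\<forall>i<m. trace_inner J (a i) x \<le> b i + \<alpha>)) \<ge> 1 - \<beta>"
proof (cases "\<beta> < 1")
  case False
  then show ?thesis using measure_nonneg[of "noisy_mw J \<phi> m a b \<Delta> \<epsilon> \<delta> \<alpha>"] by (smt (verit))
next
  case True
  interpret eja_coordinates J \<phi> using J iso by (simp add: eja_coordinates_def eja_coordinates_axioms_def)
  have yd: "density_element y" using y by (simp add: density_element_def)
  have yc: "y \<in> carr J" using density_closed[OF yd] .
  note rk = rank_dim_pos[OF yc y(2)]
  have a0: "\<alpha> > 0" unfolding \<alpha> using mw_accuracy_pos rk m pos \<delta> by simp
  define T where "T = mw_rounds (jrank J) \<alpha>"
  have T: "T \<ge> 1" "144 * ln (real (jrank J)) \<le> \<alpha>\<^sup>2 * real T"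
    using mw_rounds_bounds[OF rk(1) a0] by (simp_all add: T_def)
  interpret mw_iteration J \<phi> m a b \<Delta> "mw_eps (jrank J) \<alpha> \<epsilon> \<delta>" "\<alpha> / 12" "mw_sigma (jrank J) \<alpha> \<Delta> \<epsilon> \<delta>"
    by unfold_locales (use m a mw_sigma_pos[OF rk(1) a0 pos(1,2) \<delta>] in auto)
  have ab: "spectral_bound (a i) 1" if i: "i < m" for i
  proof -
    obtain Q \<mu> where Q: "spectral_decomp J (a i) Q \<mu>" using spectral_theorem a[OF i] by blast
    have "\<mu> q \<in> eigenvalues J (a i)" if "q \<in> Q" for q using Q that unfolding eigenvalues_def by blast
    then show ?thesis using a[OF i] by (intro spectral_boundI[OF Q]) (force simp: abs_le_iff)
  qed
  let ?E = "{x \<in> carr J. x \<in> cone_of_squares J \<and> Tr J x = 1 \<and> (\<forall>i<m. ti (a i) x \<le> b i + \<alpha>)}"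
  have "1 - \<beta> \<le> measure (distr (run T) algM (\<lambda>(L, x, S). S /\<^sub>R real T)) ?E"
  proof (cases "\<alpha> < 2")
    case False
    \<comment> \<open>the constraints hold trivially, as \<open>ti (a i)\<close> takes values in \<open>[-1, 1]\<close> on density elements\<close>
    show ?thesis
    proof (rule output_prob_ge[OF T(1), where I = state_inv])
      show "Measurable.pred stateM (state_inv T)" by (rule state_inv_measurable)
      show "1 - \<beta> \<le> measure (run T) {s \<in> space stateM. state_inv T s}"
        using structural_run[OF rk(1), of T] pos by linarith
      fix s assume s: "s \<in> space stateM" "state_inv T s"
      let ?S = "snd (snd s)"
      have Sc: "?S \<in> carr J" using s by (simp add: stateM_space)
      have "density_element (?S /\<^sub>R real T)"
        using s T(1) Sc by (simp add: state_inv_def density_element_def cone_scale Tr_scale)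
      then have "ti (a i) ?S \<le> real T * (b i + \<alpha>)" if i: "i < m" for i
      proof -
        assume d: "density_element (?S /\<^sub>R real T)"
        have "ti (a i) (?S /\<^sub>R real T) \<le> 1" using spectral_bound_density[OF ab[OF i] d] by simp
        moreover have "- 1 \<le> b i" using spectral_bound_density[OF ab[OF i] yd] y(3)[OF i] by simp
        ultimately have "ti (a i) (?S /\<^sub>R real T) \<le> b i + \<alpha>" using False by simp
        then show ?thesis using T(1) a_closed[OF i] Sc by (simp add: trace_inner_linear field_simps)
      qed
      then show "state_inv T s \<and> (\<forall>i<m. ti (a i) ?S \<le> real T * (b i + \<alpha>))" using s by simp
    qed
  next
    case \<alpha>2: True
    obtain \<zeta> \<gamma> where z: "0 \<le> \<zeta>" "\<zeta> \<le> 1" "2 * \<zeta> + \<gamma> \<le> \<alpha> / 2"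
      "\<gamma> \<ge> 2 * \<Delta> / mw_eps (jrank J) \<alpha> \<epsilon> \<delta> * ln (real m / (\<beta> / (2 * real T)))"
      "\<zeta>\<^sup>2 \<ge> 4 * (mw_sigma (jrank J) \<alpha> \<Delta> \<epsilon> \<delta>)\<^sup>2 * (real dimJ + ln (1 / (\<beta> / (2 * real T))))"
      unfolding T_def using mw_parameters[OF rk m pos(1,2,3) True \<delta> \<alpha> \<alpha>2] by blast
    have \<beta>': "\<beta> / (2 * real T) > 0" using pos T(1) by simp
    show ?thesis
    proof (rule output_prob_ge[OF T(1), where I = "regret_inv y (2 * \<zeta> + \<gamma>)"])
      show "Measurable.pred stateM (regret_inv y (2 * \<zeta> + \<gamma>) T)" by (rule regret_inv_measurable[OF yc])
      have "1 - real T * (\<beta> / (2 * real T) + \<beta> / (2 * real T))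
          \<le> measure (run T) {s \<in> space stateM. regret_inv y (2 * \<zeta> + \<gamma>) T s}"
        using a0 by (intro regret_run[OF rk(1) _ yd y(3) ab z(1,2) mw_eps_pos[OF rk(1) a0 pos(2) \<delta>] pos(1) \<beta>' z(4,5)]) auto
      then show "1 - \<beta> \<le> measure (run T) {s \<in> space stateM. regret_inv y (2 * \<zeta> + \<gamma>) T s}"
        using T(1) by simp
      fix s assume s: "s \<in> space stateM" "regret_inv y (2 * \<zeta> + \<gamma>) T s"
      have "ti (a i) (snd (snd s)) \<le> real T * (b i + \<alpha>)" if i: "i < m" for i
      proof -
        have "ti (a i) (snd (snd s)) - real T * b i
          \<le> 2 * (ln (real (jrank J)) / (\<alpha> / 12) + \<alpha> / 12 * real T) + (2 * \<zeta> + \<gamma>) * real T"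
          by (rule regret_inv_final[OF rk(1) _ yd s i]) (use a0 in simp)
        also have "\<dots> \<le> 2 * (\<alpha> * real T / 12 + \<alpha> / 12 * real T) + \<alpha> / 2 * real T"
        proof -
          have "ln (real (jrank J)) / (\<alpha> / 12) \<le> \<alpha> * real T / 12"
            using T(2) a0 by (simp add: field_simps power2_eq_square)
          then show ?thesis using z(3) by (intro add_mono mult_left_mono mult_right_mono) auto
        qed
        also have "\<dots> \<le> real T * \<alpha>" using a0 by (simp add: field_simps)
        finally show ?thesis by (simp add: algebra_simps)
      qed
      then show "state_inv T s \<and> (\<forall>i<m. ti (a i) (snd (snd s)) \<le> real T * (b i + \<alpha>))"
        using s by (simp add: regret_inv_def)
    qed
  qed
  then show ?thesis by (simp add: noisy_mw_def Let_def T_def)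
qed

theorem theoremC9:
  "\<exists>acc :: nat \<Rightarrow> nat \<Rightarrow> nat \<Rightarrow> real \<Rightarrow> real \<Rightarrow> real \<Rightarrow> real \<Rightarrow> real.
     (\<exists>C p q s. \<forall>r k m \<Delta> \<epsilon> \<beta> \<delta>.
        r \<ge> 1 \<longrightarrow> k \<ge> 1 \<longrightarrow> m \<ge> 1 \<longrightarrow> \<Delta> > 0 \<longrightarrow> \<epsilon> > 0 \<longrightarrow> \<beta> > 0 \<longrightarrow> 0 < \<delta> \<longrightarrow> \<delta> < 1 \<longrightarrow>
        0 < acc r k m \<Delta> \<epsilon> \<beta> \<delta> \<and>
        acc r k m \<Delta> \<epsilon> \<beta> \<delta>
          \<le> soft_O_bound (C * (1 + ln (real m)) ^ s) q (accuracy_rate p r k \<Delta> \<epsilon> \<beta> \<delta>)) \<and>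
     (\<forall>(J :: 'a::real_vector jalg) \<phi> r k m a b \<Delta> \<epsilon> \<beta> \<delta> \<alpha>.
        euclidean_jordan_algebra J \<longrightarrow>
        r = jrank J \<longrightarrow> k = jdim J \<longrightarrow>
        coordinate_isometry J \<phi> \<longrightarrow>
        m \<ge> 1 \<longrightarrow>
        (\<forall>i<m. a i \<in> carr J \<and> eigenvalues J (a i) \<subseteq> {-1..1}) \<longrightarrow>
        (\<exists>x\<in>cone_of_squares J. Tr J x = 1 \<and> (\<forall>i<m. trace_inner J (a i) x \<le> b i)) \<longrightarrow>
        \<Delta> > 0 \<longrightarrow> \<epsilon> > 0 \<longrightarrow> \<beta> > 0 \<longrightarrow> 0 < \<delta> \<longrightarrow> \<delta> < 1 \<longrightarrow>
        \<alpha> = acc r k m \<Delta> \<epsilon> \<beta> \<delta> \<longrightarrow>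
        \<P>(x in noisy_mw J \<phi> m a b \<Delta> \<epsilon> \<delta> \<alpha>.
            x \<in> cone_of_squares J \<and> Tr J x = 1 \<and>
            (\<forall>i<m. trace_inner J (a i) x \<le> b i + \<alpha>)) \<ge> 1 - \<beta>)"
proof (intro exI[of _ mw_accuracy] conjI, goal_cases)
  case 1
  show ?case
    by (rule exI[of _ 1000], rule exI[of _ 1], rule exI[of _ 1], rule exI[of _ 1])
      (use mw_accuracy_pos in \<open>auto simp: mw_accuracy_def\<close>)
next
  case 2
  show ?case using noisy_mw_accurate by blast
qed

end
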